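(* Let $(R,\mathfrak m)$ be a regular local ring with quotient field $F$ and $\dim R\ge 2$, let $\{(R_i,\mathfrak m_i)\}_{i\ge 0}$ be an infinite sequence of local quadratic transforms with $R_0=R$, and let $S=\bigcup_{i\ge 0}R_i$ with maximal ideal $N=\bigcup_i \mathfrak m_i$. Let $V$ be the boundary valuation ring of $S$ and let $T$ be the Noetherian hull of $S$. Then $S=V\cap T$.
   Context: A local quadratic transform of a regular local ring $(A,\mathfrak n)$ is a local ring $A[\mathfrak n/x]_{\mathfrak q}$ with $x\in\mathfrak n\setminus\mathfrak n^2$ and $\mathfrak q$ a prime ideal of $A[\mathfrak n/x]$ containing $\mathfrak n$. The sequence satisfies: for each $i\ge 0$, $R_{i+1}$ is a local quadratic transform of $R_i$, $R_i\subsetneq R_{i+1}$, and each $R_i$ is a regular local ring of dimension at least $2$ with maximal ideal $\mathfrak m_i$. For each $i$, $\mathrm{ord}_i$ is the order valuation of $R_i$ ($\mathrm{ord}_i(a)=\max\{n: a\in\mathfrak m_i^n\}$ for $0\neq a\in R_i$, extended to $F$ by $\mathrm{ord}_i(a/b)=\mathrm{ord}_i(a)-\mathrm{ord}_i(b)$), with valuation ring $V_i$. Let $\mathfrak X$ be the set of valuation rings $U$ with $R\subseteq U\subseteq F$; the patch topology on $\mathfrak X$ has basic open sets $\{U\in\mathfrak X: G\subseteq U,\ H\subseteq \mathfrak M_U\}$ for finite subsets $G,H\subseteq F$ ($\mathfrak M_U$ the maximal ideal of $U$). A boundary valuation ring of $S$ is a $V\in\mathfrak X$ that is a limit point of $\{V_i: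 i\ge 0\}$ in the patch topology; $S$ has exactly one such $V$. The Noetherian hull $T$ of $S$ is the intersection of all discrete valuation rings with quotient field $F$ that properly contain $S$ (an empty intersection being $F$). *)

theory Defs
  imports Main "HOL-Library.Extended_Nat"
begin

text \<open>All rings are subrings of a fixed field F, modelled as the type 'a :: field.\<close>

definition subring :: "'a::field set \<Rightarrow> bool" where
  "subring A \<longleftrightarrow> 0 \<in> A \<and> 1 \<in> A \<and> (\<forall>a\<in>A. \<forall>b\<in>A. a + b \<in> A \<and> a * b \<in> A \<and> - a \<in> A)"

definition quotient_field_is_F :: "'a::field set \<Rightarrow> bool" where
  "quotient_field_is_F A \<longleftrightarrow> (\<forall>z. \<exists>a\<in>A. \<exists>b\<in>A. b \<noteq> 0 \<and> z = a / b)"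

definition ideal :: "'a::field set \<Rightarrow> 'a set \<Rightarrow> bool" where
  "ideal A I \<longleftrightarrow> I \<subseteq> A \<and> 0 \<in> I \<and> (\<forall>x\<in>I. \<forall>y\<in>I. x + y \<in> I) \<and> (\<forall>a\<in>A. \<forall>x\<in>I. a * x \<in> I)"

definition prime_ideal :: "'a::field set \<Rightarrow> 'a set \<Rightarrow> bool" where
  "prime_ideal A P \<longleftrightarrow> ideal A P \<and> P \<noteq> A \<and> (\<forall>a\<in>A. \<forall>b\<in>A. a * b \<in> P \<longrightarrow> a \<in> P \<or> b \<in> P)"

definition maximal_ideal :: "'a::field set \<Rightarrow> 'a set \<Rightarrow> bool" where
  "maximal_ideal A M \<longleftrightarrow> ideal A M \<and> M \<noteq> A \<and> (\<forall>J. ideal A J \<and> M \<subseteq> J \<longrightarrow> J = M \<or> J = A)"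

definition local_ring :: "'a::field set \<Rightarrow> bool" where
  "local_ring A \<longleftrightarrow> subring A \<and> (\<exists>!M. maximal_ideal A M)"

definition max_ideal :: "'a::field set \<Rightarrow> 'a set" where
  "max_ideal A = (THE M. maximal_ideal A M)"

definition ideal_gen :: "'a::field set \<Rightarrow> 'a set \<Rightarrow> 'a set" where
  "ideal_gen A X = \<Inter>{I. ideal A I \<and> X \<subseteq> I}"

definition noetherian :: "'a::field set \<Rightarrow> bool" where
  "noetherian A \<longleftrightarrow> subring A \<and> (\<forall>I. ideal A I \<longrightarrow> (\<exists>X. finite X \<and> X \<subseteq> I \<and> ideal_gen A X = I))"

definition ideal_pow :: "'a::field set \<Rightarrow> 'a set \<Rightarrow> nat \<Rightarrow> 'a set" where
  "ideal_pow A I n = ideal_gen A {prod_list xs | xs. length xs = n \<and> set xs \<subseteq> I}"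

definition krull_dim :: "'a::field set \<Rightarrow> enat" where
  "krull_dim A = Sup {enat n | n. \<exists>P :: nat \<Rightarrow> 'a set.
      (\<forall>i\<le>n. prime_ideal A (P i)) \<and> (\<forall>i<n. P i \<subset> P (Suc i))}"

definition emb_dim :: "'a::field set \<Rightarrow> nat" where
  "emb_dim A = (LEAST n. \<exists>X. finite X \<and> card X = n \<and> ideal_gen A X = max_ideal A)"

definition regular_local_ring :: "'a::field set \<Rightarrow> bool" where
  "regular_local_ring A \<longleftrightarrow> noetherian A \<and> local_ring A \<and> krull_dim A = enat (emb_dim A)"

definition ring_adjoin :: "'a::field set \<Rightarrow> 'a set \<Rightarrow> 'a set" where
  "ring_adjoin A X = \<Inter>{B. subring B \<and> A \<union> X \<subseteq> B}"

definition localization :: "'a::field set \<Rightarrow> 'a set \<Rightarrow> 'a set" where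
  "localization B q = {a / b | a b. a \<in> B \<and> b \<in> B \<and> b \<notin> q}"

definition local_quadratic_transform :: "'a::field set \<Rightarrow> 'a set \<Rightarrow> bool" where
  "local_quadratic_transform A A' \<longleftrightarrow>
     (\<exists>x q. x \<in> max_ideal A \<and> x \<notin> ideal_pow A (max_ideal A) 2 \<and>
        (let B = ring_adjoin A {y / x | y. y \<in> max_ideal A} in
          prime_ideal B q \<and> max_ideal A \<subseteq> q \<and> A' = localization B q))"

definition ord :: "'a::field set \<Rightarrow> 'a \<Rightarrow> nat" where
  "ord A a = (GREATEST n. a \<in> ideal_pow A (max_ideal A) n)"

definition ord_valuation_ring :: "'a::field set \<Rightarrow> 'a set" where
  "ord_valuation_ring A = {z. z = 0 \<or> (\<exists>a b. a \<in> A \<and> b \<in> A \<and> a \<noteq> 0 \<and> b \<noteq> 0 \<and>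
       z = a / b \<and> ord A b \<le> ord A a)}"

definition valuation_ring :: "'a::field set \<Rightarrow> bool" where
  "valuation_ring U \<longleftrightarrow> subring U \<and> (\<forall>z. z \<noteq> 0 \<longrightarrow> z \<in> U \<or> inverse z \<in> U)"

definition DVR :: "'a::field set \<Rightarrow> bool" where
  "DVR U \<longleftrightarrow> (\<exists>v :: 'a \<Rightarrow> int.
      (\<forall>a b. a \<noteq> 0 \<longrightarrow> b \<noteq> 0 \<longrightarrow> v (a * b) = v a + v b) \<and>
      (\<forall>a b. a \<noteq> 0 \<longrightarrow> b \<noteq> 0 \<longrightarrow> a + b \<noteq> 0 \<longrightarrow> min (v a) (v b) \<le> v (a + b)) \<and>
      (\<forall>k. \<exists>a. a \<noteq> 0 \<and> v a = k) \<and>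
      U = {z. z = 0 \<or> v z \<ge> 0})"

definition ZR :: "'a::field set \<Rightarrow> 'a set set" where
  "ZR R = {U. valuation_ring U \<and> R \<subseteq> U}"

definition patch_basic :: "'a::field set \<Rightarrow> 'a set \<Rightarrow> 'a set \<Rightarrow> 'a set set" where
  "patch_basic R G H = {U \<in> ZR R. G \<subseteq> U \<and> H \<subseteq> max_ideal U}"

definition patch_limit_point :: "'a::field set \<Rightarrow> (nat \<Rightarrow> 'a set) \<Rightarrow> 'a set \<Rightarrow> bool" where
  "patch_limit_point R Vs V \<longleftrightarrow> V \<in> ZR R \<and>
     (\<forall>G H. finite G \<longrightarrow> finite H \<longrightarrow> V \<in> patch_basic R G H \<longrightarrow>
        (\<exists>i. Vs i \<in> patch_basic R G H \<and> Vs i \<noteq> V))"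

text \<open>Noetherian hull: intersection of all DVRs of F properly containing S (empty = F).\<close>
definition noetherian_hull :: "'a::field set \<Rightarrow> 'a set" where
  "noetherian_hull S = {z. \<forall>U. DVR U \<and> S \<subset> U \<longrightarrow> z \<in> U}"

end

theory Submission
  imports Defs "HOL-Library.Set_Algebras" "HOL-Library.Poly_Mapping" "HOL-Library.Multiset"
begin

text \<open>
  Write \<open>S\<close> for the union, \<open>x\<^sub>i\<close> for the chosen element of \<open>\<mm>\<^sub>i\<close>, so that
  \<open>\<mm>\<^sub>i R\<^sub>i\<^sub>+\<^sub>1 = x\<^sub>i R\<^sub>i\<^sub>+\<^sub>1\<close>, and suppose that \<open>z\<close> lies in \<open>V\<close> and in the
  Noetherian hull, but not in \<open>S\<close>.

  Each \<open>S[1/x\<^sub>i]\<close> is a ring of fractions of the Noetherian normal domain \<open>R\<^sub>i\<close>, hence an intersection of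
  discrete valuation rings, all of which properly contain \<open>S\<close>; therefore \<open>z\<close> lies in every \<open>S[1/x\<^sub>i]\<close>.

  Since the order of a strict transform never increases, the sign of \<open>ord\<^sub>i z\<close> is eventually constant.
  As \<open>z \<in> V\<close> and \<open>V\<close> is a limit of the order valuation rings, \<open>ord\<^sub>i z \<ge> 0\<close> for all \<open>i \<ge> i\<^sub>0\<close>.

  For some \<open>n > i\<^sub>0\<close> we may write \<open>z = a/b\<close> in \<open>R\<^sub>n\<close>, where \<open>b\<close> is a product of prime elements (the prime factors
  of \<open>x\<^sub>i\<close> for \<open>i = i\<^sub>0\<close>), none of which divides \<open>a\<close>. Because \<open>ord\<^sub>i z \<ge> 0\<close>, the product of \<open>z\<close> and the strict
  transform of \<open>b\<close> in \<open>R\<^sub>i\<close> lies in \<open>R\<^sub>i\<close> for all \<open>i \<ge> n\<close>. So some prime factor \<open>p\<close> of \<open>b\<close> has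
  non-unit strict transforms in all \<open>R\<^sub>i\<close>, as otherwise \<open>z \<in> S\<close>. Then the localization of \<open>R\<^sub>n\<close> at \<open>p\<close> is a
  discrete valuation ring that properly contains \<open>S\<close> and does not contain \<open>z\<close>, a contradiction.

  By Krull's height theorem, the associated graded ring of a regular local ring is a polynomial ring. Hence the order
  is a valuation and the ring is normal.
\<close>

section \<open>Ideals of subrings of a field\<close>

text \<open>All rings lie in one field, so no quotient ring is ever formed: facts about A/I become
  congruences modulo I, and the height theorem, primality and normality are proved relative to an
  ideal.

  The prime factors come from the sequence itself. On a quadratic transform A' of A the order of A
  measures divisibility by x, so additivity of the order makes x prime in A'; the strict transform
  of a prime is again prime or a unit. Hence every x_i is a product of primes at each later stage.

  The valuation ring U of a surviving prime is fixed once. What moves is the pair of R_i and the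
  strict transform p_i, with the invariant that R_i lies in U and p_i U meets R_i exactly in p_i
  R_i. This invariant yields both that U contains S and that p_i stays prime.

  The sign of ord_i z settles because numerator and denominator are divided at each step by the same
  power of x_i, the smaller of their orders. These minima descend and so become constant.

  Since S may itself be a discrete valuation ring, the containment of S in each test ring must be
  shown to be proper. The witness is always 1/x_n, which never lies in S.\<close>

definition pid :: "'a::field set \<Rightarrow> 'a \<Rightarrow> 'a set" where
  "pid A x = (\<lambda>a. a * x) ` A"

text \<open>A list rather than a set: its length counts generators, the quantity on which the height
  theorem inducts, and the recursion adds one generator at a time. For a subring \<open>A\<close>
  containing \<open>set xs\<close> this is \<open>ideal_gen A (set xs)\<close>.\<close>

fun lin :: "'a::field set \<Rightarrow> 'a list \<Rightarrow> 'a set" where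
  "lin A [] = {0}"
| "lin A (x # xs) = pid A x + lin A xs"

lemma idealD:
  assumes "ideal A I"
  shows "I \<subseteq> A" "0 \<in> I" "x \<in> I \<Longrightarrow> y \<in> I \<Longrightarrow> x + y \<in> I" "a \<in> A \<Longrightarrow> x \<in> I \<Longrightarrow> a * x \<in> I"
    "a \<in> A \<Longrightarrow> x \<in> I \<Longrightarrow> x * a \<in> I" "x \<in> I \<Longrightarrow> x \<in> A"
  using assms by (auto simp: ideal_def mult.commute)

lemma prime_idealD:
  assumes "prime_ideal A P"
  shows "ideal A P" "P \<noteq> A" "a \<in> A \<Longrightarrow> b \<in> A \<Longrightarrow> a * b \<in> P \<Longrightarrow> a \<in> P \<or> b \<in> P"
  using assms by (auto simp: prime_ideal_def)

lemma mem_plus: "u \<in> I + J \<longleftrightarrow> (\<exists>i\<in>I. \<exists>j\<in>J. u = i + j)"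
  by (auto simp: set_plus_def)

lemma mem_pid: "u \<in> pid A x \<longleftrightarrow> (\<exists>a\<in>A. u = a * x)"
  by (auto simp: pid_def)

lemma plusI: "i \<in> I \<Longrightarrow> j \<in> J \<Longrightarrow> i + j \<in> I + J"
  and plusE: "u \<in> I + J \<Longrightarrow> (\<And>i j. i \<in> I \<Longrightarrow> j \<in> J \<Longrightarrow> u = i + j \<Longrightarrow> P) \<Longrightarrow> P"
  by (auto simp: mem_plus)

lemma plus_pidI: "i \<in> I \<Longrightarrow> a \<in> A \<Longrightarrow> i + a * x \<in> I + pid A x"
  and plus_pidE: "u \<in> I + pid A x \<Longrightarrow> (\<And>i a. i \<in> I \<Longrightarrow> a \<in> A \<Longrightarrow> u = i + a * x \<Longrightarrow> P) \<Longrightarrow> P"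
  by (force simp: mem_plus mem_pid)+

locale field_subring =
  fixes A :: "'a::field set"
  assumes subring: "subring A"
begin

lemma zero_mem [simp, intro]: "0 \<in> A" and one_mem [simp, intro]: "1 \<in> A"
  and add_mem [intro]: "a \<in> A \<Longrightarrow> b \<in> A \<Longrightarrow> a + b \<in> A"
  and mult_mem [intro]: "a \<in> A \<Longrightarrow> b \<in> A \<Longrightarrow> a * b \<in> A"
  and neg_mem [intro]: "a \<in> A \<Longrightarrow> - a \<in> A"
  using subring by (auto simp: subring_def)

lemma diff_mem [intro]: "a \<in> A \<Longrightarrow> b \<in> A \<Longrightarrow> a - b \<in> A"
  using add_mem[of a "- b"] by auto

lemma power_mem [intro]: "a \<in> A \<Longrightarrow> a ^ n \<in> A"
  by (induction n) auto

lemma prod_list_mem: "set xs \<subseteq> A \<Longrightarrow> prod_list xs \<in> A"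
  by (induction xs) auto

lemma ideal_neg: "ideal A I \<Longrightarrow> x \<in> I \<Longrightarrow> - x \<in> I"
  using idealD(4)[of A I "-1" x] by auto

lemma ideal_diff: "ideal A I \<Longrightarrow> x \<in> I \<Longrightarrow> y \<in> I \<Longrightarrow> x - y \<in> I"
  using idealD(3)[of A I x "-y"] ideal_neg[of I y] by auto

lemma ideal_sum: "ideal A I \<Longrightarrow> (\<And>i. i \<in> S \<Longrightarrow> f i \<in> I) \<Longrightarrow> sum f S \<in> I"
  by (induction S rule: infinite_finite_induct) (simp_all add: idealD)

lemma ideal_self [simp, intro]: "ideal A A"
  by (auto simp: ideal_def)

lemma ideal_zero [simp, intro]: "ideal A {0}"
  by (auto simp: ideal_def)

lemma ideal_one: "ideal A I \<Longrightarrow> 1 \<in> I \<longleftrightarrow> I = A"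
  using idealD[of A I] by (metis mult.right_neutral one_mem subset_antisym subsetI)

lemma plus_least: "ideal A K \<Longrightarrow> I \<subseteq> K \<Longrightarrow> J \<subseteq> K \<Longrightarrow> I + J \<subseteq> K"
  by (auto simp: mem_plus subset_iff ideal_def)

lemma ideal_plus: "ideal A I \<Longrightarrow> ideal A J \<Longrightarrow> ideal A (I + J)"
proof -
  assume I: "ideal A I" and J: "ideal A J"
  have "i + j + (i' + j') \<in> I + J" if "i \<in> I" "j \<in> J" "i' \<in> I" "j' \<in> J" for i j i' j'
  proof -
    have "i + j + (i' + j') = (i + i') + (j + j')" by simp
    then show ?thesis unfolding mem_plus using that idealD(3)[OF I] idealD(3)[OF J] by blast
  qed
  moreover have "a * (i + j) \<in> I + J" if "i \<in> I" "j \<in> J" "a \<in> A" for a i j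
    unfolding mem_plus distrib_left using that idealD(4)[OF I] idealD(4)[OF J] by blast
  moreover have "0 \<in> I + J" unfolding mem_plus using idealD(2)[OF I] idealD(2)[OF J] by force
  moreover have "I + J \<subseteq> A"
    by (rule plus_least) (use I J idealD in auto)
  ultimately show ?thesis
    unfolding ideal_def by (auto simp: mem_plus)
qed

lemma plus_sub1: "ideal A J \<Longrightarrow> I \<subseteq> I + J" and plus_sub2: "ideal A J \<Longrightarrow> I \<subseteq> J + I"
  by (force simp: mem_plus dest: idealD(2))+

lemma ideal_pid: "x \<in> A \<Longrightarrow> ideal A (pid A x)"
  unfolding ideal_def pid_def
  by (auto simp flip: distrib_right mult.assoc)

lemma pid_mem [intro]: "x \<in> pid A x"
  by (force simp: mem_pid)

lemma pid_least: "ideal A I \<Longrightarrow> x \<in> I \<Longrightarrow> pid A x \<subseteq> I"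
  by (auto simp: mem_pid dest: idealD(4))

lemma ideal_lin: "set xs \<subseteq> A \<Longrightarrow> ideal A (lin A xs)"
  by (induction xs) (auto intro: ideal_plus ideal_pid)

lemma lin_mem: "set xs \<subseteq> A \<Longrightarrow> x \<in> set xs \<Longrightarrow> x \<in> lin A xs"
proof (induction xs)
  case (Cons y ys)
  have "pid A y \<subseteq> lin A (y # ys)" "lin A ys \<subseteq> lin A (y # ys)"
    using Cons.prems by (auto intro!: plus_sub1 plus_sub2 ideal_lin ideal_pid simp: subsetI)
  then show ?case using Cons by auto
qed simp

lemma lin_least: "ideal A I \<Longrightarrow> set xs \<subseteq> I \<Longrightarrow> lin A xs \<subseteq> I"
proof (induction xs)
  case (Cons x xs)
  then show ?case using plus_least[of I "pid A x" "lin A xs"] pid_least[of I x] by auto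
qed (simp add: idealD(2))

lemma lin_eqI: "set xs \<subseteq> A \<Longrightarrow> set xs = set ys \<Longrightarrow> lin A xs = lin A ys"
  by (intro subset_antisym lin_least ideal_lin subsetI) (auto intro: lin_mem)

lemma lin_append: "lin A (xs @ ys) = lin A xs + lin A ys"
  by (induction xs) (auto simp: add.assoc)

lemma ideal_Inter: "\<I> \<noteq> {} \<Longrightarrow> (\<And>I. I \<in> \<I> \<Longrightarrow> ideal A I) \<Longrightarrow> ideal A (\<Inter>\<I>)"
  unfolding ideal_def by blast

lemma ideal_gen_ideal: "X \<subseteq> A \<Longrightarrow> ideal A (ideal_gen A X)"
  unfolding ideal_gen_def by (rule ideal_Inter) (auto intro: exI[of _ A])

lemma ideal_gen_sub: "X \<subseteq> ideal_gen A X"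
  unfolding ideal_gen_def by blast

lemma ideal_gen_least: "ideal A I \<Longrightarrow> X \<subseteq> I \<Longrightarrow> ideal_gen A X \<subseteq> I"
  unfolding ideal_gen_def by blast

lemma lin_gen: "set xs \<subseteq> A \<Longrightarrow> ideal_gen A (set xs) = lin A xs"
  by (meson ideal_gen_ideal ideal_gen_least ideal_gen_sub ideal_lin lin_least lin_mem subsetI subset_antisym)

lemma ideal_pow_ideal: "I \<subseteq> A \<Longrightarrow> ideal A (ideal_pow A I n)"
  unfolding ideal_pow_def by (rule ideal_gen_ideal) (auto intro!: prod_list_mem)

lemma ideal_pow_least:
  "ideal A K \<Longrightarrow> (\<And>xs. length xs = n \<Longrightarrow> set xs \<subseteq> I \<Longrightarrow> prod_list xs \<in> K) \<Longrightarrow> ideal_pow A I n \<subseteq> K"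
  unfolding ideal_pow_def by (rule ideal_gen_least) auto

lemma prod_list_pow: "set xs \<subseteq> I \<Longrightarrow> prod_list xs \<in> ideal_pow A I (length xs)"
  unfolding ideal_pow_def by (rule subsetD[OF ideal_gen_sub]) auto

lemma ideal_colon: "ideal A K \<Longrightarrow> u \<in> A \<Longrightarrow> ideal A {v \<in> A. u * v \<in> K}"
  unfolding ideal_def by (auto simp: distrib_left mult.left_commute)

lemma ideal_pow_mult:
  assumes I: "I \<subseteq> A" and u: "u \<in> ideal_pow A I k" and v: "v \<in> ideal_pow A I n"
  shows "u * v \<in> ideal_pow A I (k + n)"
proof -
  have id: "ideal A (ideal_pow A I j)" for j by (rule ideal_pow_ideal[OF I])
  have 1: "prod_list xs * v \<in> ideal_pow A I (k + n)" if "length xs = k" "set xs \<subseteq> I" for xs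
  proof -
    have "ideal_pow A I n \<subseteq> {v \<in> A. prod_list xs * v \<in> ideal_pow A I (k + n)}"
    proof (rule ideal_pow_least)
      show "ideal A {v \<in> A. prod_list xs * v \<in> ideal_pow A I (k + n)}"
        using that I by (intro ideal_colon id prod_list_mem) auto
    next
      fix ys assume "length ys = n" "set ys \<subseteq> I"
      then show "prod_list ys \<in> {v \<in> A. prod_list xs * v \<in> ideal_pow A I (k + n)}"
        using prod_list_pow[of "xs @ ys" I] that I prod_list_mem[of ys] by auto
    qed
    then show ?thesis using v by auto
  qed
  have vA: "v \<in> A" using v id idealD by blast
  have "ideal_pow A I k \<subseteq> {u \<in> A. v * u \<in> ideal_pow A I (k + n)}"
    using vA 1 I by (intro ideal_pow_least ideal_colon id) (auto simp: mult.commute intro: prod_list_mem)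
  then show ?thesis using u by (auto simp: mult.commute)
qed

lemma ideal_pow_0 [simp]: "I \<subseteq> A \<Longrightarrow> ideal_pow A I 0 = A"
  using ideal_one[OF ideal_pow_ideal, of I 0] prod_list_pow[of "[]" I] by auto

lemma ideal_pow_1 [simp]: "ideal A I \<Longrightarrow> ideal_pow A I (Suc 0) = I"
proof
  assume I: "ideal A I"
  show "ideal_pow A I (Suc 0) \<subseteq> I"
    using I by (intro ideal_pow_least) (auto simp: length_Suc_conv)
  show "I \<subseteq> ideal_pow A I (Suc 0)"
    using prod_list_pow[of "[_]" I] by auto
qed

lemma ideal_pow_Suc_mem: "ideal A I \<Longrightarrow> a \<in> I \<Longrightarrow> u \<in> ideal_pow A I n \<Longrightarrow> a * u \<in> ideal_pow A I (Suc n)"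
  using ideal_pow_mult[of I a "Suc 0" u n] by (simp add: idealD(1))

lemma power_pow: "ideal A I \<Longrightarrow> a \<in> I \<Longrightarrow> a ^ n \<in> ideal_pow A I n"
  by (induction n) (simp_all add: idealD(1) ideal_pow_Suc_mem)

lemma power_pow_mult:
  assumes "I \<subseteq> A" "a \<in> ideal_pow A I k" shows "a ^ n \<in> ideal_pow A I (k * n)"
proof (induction n)
  case 0
  then show ?case using assms by auto
next
  case (Suc n)
  then show ?case using ideal_pow_mult[OF assms(1) assms(2) Suc] by (simp add: algebra_simps)
qed

text \<open>Takes the place of the equation I^(n+1) = I I^n. Products of ideals are never formed;
  containments of powers are checked on single products \<open>a * u\<close>.\<close>

lemma ideal_pow_Suc_least:
  assumes K: "ideal A K" and I: "ideal A I"
    and step: "\<And>a u. a \<in> I \<Longrightarrow> u \<in> ideal_pow A I n \<Longrightarrow> a * u \<in> K"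
  shows "ideal_pow A I (Suc n) \<subseteq> K"
proof (rule ideal_pow_least[OF K])
  fix xs assume xs: "length xs = Suc n" "set xs \<subseteq> I"
  then obtain a ys where "xs = a # ys" "length ys = n" by (auto simp: length_Suc_conv)
  then show "prod_list xs \<in> K" using step[of a "prod_list ys"] xs prod_list_pow[of ys I] by auto
qed

lemma ideal_pow_Suc_sub: "ideal A I \<Longrightarrow> ideal_pow A I (Suc n) \<subseteq> ideal_pow A I n"
  by (rule ideal_pow_Suc_least) (simp_all add: ideal_pow_ideal idealD(1) idealD(4)[OF ideal_pow_ideal] idealD(6))

lemma ideal_pow_anti: "ideal A I \<Longrightarrow> k \<le> n \<Longrightarrow> ideal_pow A I n \<subseteq> ideal_pow A I k"
  using lift_Suc_antimono_le[of "ideal_pow A I" k n] ideal_pow_Suc_sub by blast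

lemma prime_ideal_one: "prime_ideal A P \<Longrightarrow> 1 \<notin> P"
  using ideal_one by (auto simp: prime_ideal_def)

lemma prime_ideal_power: "prime_ideal A P \<Longrightarrow> a \<in> A \<Longrightarrow> a ^ n \<in> P \<Longrightarrow> a \<in> P"
  by (induction n) (auto dest: prime_ideal_one prime_idealD(3))

lemma prime_ideal_pow_sub:
  assumes P: "prime_ideal A P" and I: "ideal A I" and sub: "ideal_pow A I n \<subseteq> P"
  shows "I \<subseteq> P"
proof
  fix a assume "a \<in> I"
  then show "a \<in> P" using prime_ideal_power[OF P] power_pow[OF I] sub idealD[OF I] by blast
qed

end

section \<open>Noetherian subrings: maximal members of families of ideals\<close>

locale noetherian_subring = field_subring +
  assumes noetherian: "noetherian A"
begin

lemma finitely_generated: "ideal A I \<Longrightarrow> \<exists>xs. set xs \<subseteq> I \<and> lin A xs = I"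
proof -
  assume I: "ideal A I"
  then obtain X where X: "finite X" "X \<subseteq> I" "ideal_gen A X = I" using noetherian by (auto simp: noetherian_def)
  then obtain xs where "set xs = X" using finite_list by blast
  then show ?thesis using X lin_gen[of xs] idealD[OF I] by auto
qed

text \<open>The union of a chain is finitely generated, and finitely many generators already lie in
  one member of the chain, so the union is that member and Zorn's lemma applies.\<close>

lemma max_exists:
  assumes ne: "I0 \<in> \<F>" and id: "\<And>I. I \<in> \<F> \<Longrightarrow> ideal A I"
  shows "\<exists>M\<in>\<F>. \<forall>I\<in>\<F>. M \<subseteq> I \<longrightarrow> I = M"
proof (rule subset_Zorn_nonempty)
  show "\<F> \<noteq> {}" using ne by auto
next
  fix \<C> assume ne: "\<C> \<noteq> {}" and ch: "subset.chain \<F> \<C>"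
  have sub: "\<C> \<subseteq> \<F>" and tot: "\<And>X Y. X \<in> \<C> \<Longrightarrow> Y \<in> \<C> \<Longrightarrow> X \<subseteq> Y \<or> Y \<subseteq> X"
    using ch by (auto simp: subset_chain_def)
  have idU: "ideal A (\<Union>\<C>)"
    unfolding ideal_def
  proof (intro conjI ballI)
    show "\<Union>\<C> \<subseteq> A" using id sub idealD by blast
    show "0 \<in> \<Union>\<C>" using ne id sub idealD by blast
  next
    fix x y assume "x \<in> \<Union>\<C>" "y \<in> \<Union>\<C>"
    then obtain X Y where "x \<in> X" "X \<in> \<C>" "y \<in> Y" "Y \<in> \<C>" by auto
    then show "x + y \<in> \<Union>\<C>" using tot[of X Y] id sub idealD(3) by blast
  next
    fix a x assume "a \<in> A" "x \<in> \<Union>\<C>"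
    then show "a * x \<in> \<Union>\<C>" using id sub idealD(4) by blast
  qed
  then obtain xs where xs: "set xs \<subseteq> \<Union>\<C>" "lin A xs = \<Union>\<C>" using finitely_generated by blast
  have "\<exists>X\<in>\<C>. set ys \<subseteq> X" if "set ys \<subseteq> \<Union>\<C>" for ys
    using that
  proof (induction ys)
    case Nil
    then show ?case using ne by auto
  next
    case (Cons y ys)
    then obtain X Y where "X \<in> \<C>" "set ys \<subseteq> X" "Y \<in> \<C>" "y \<in> Y" by auto
    then show ?case using tot[of X Y] by (metis insert_subset list.simps(15) subset_trans subsetD)
  qed
  then obtain X where X: "X \<in> \<C>" "set xs \<subseteq> X" using xs by blast
  then have "\<Union>\<C> \<subseteq> X" using lin_least[of X xs] id sub xs(2) by auto
  then have "\<Union>\<C> = X" using X by auto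
  then show "\<Union>\<C> \<in> \<F>" using X sub by auto
qed

lemma ascending_stable:
  assumes id: "\<And>n. ideal A (f n)" and asc: "\<And>n. f n \<subseteq> f (Suc n)"
  shows "\<exists>k. f (Suc k) = f k"
proof -
  obtain M where M: "M \<in> range f" "\<forall>I\<in>range f. M \<subseteq> I \<longrightarrow> I = M"
    using max_exists[of "f 0" "range f"] id by blast
  then obtain k where k: "M = f k" by auto
  have "f (Suc k) = f k" using bspec[OF M(2), of "f (Suc k)"] asc[of k] k by simp
  then show ?thesis ..
qed

text \<open>An ideal that is maximal among those containing \<open>J\<close> and no power of
  \<open>x\<close> is prime.\<close>

lemma prime_avoiding:
  assumes J: "ideal A J" and x: "x \<in> A" and no: "\<And>k. x ^ k \<notin> J"
  shows "\<exists>P. prime_ideal A P \<and> J \<subseteq> P \<and> x \<notin> P"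
proof -
  define \<F> where "\<F> = {I. ideal A I \<and> J \<subseteq> I \<and> (\<forall>k. x ^ k \<notin> I)}"
  obtain M where M: "M \<in> \<F>" and mx: "\<forall>I\<in>\<F>. M \<subseteq> I \<longrightarrow> I = M"
    using max_exists[of J \<F>] assms unfolding \<F>_def by blast
  have Mi: "ideal A M" "J \<subseteq> M" "\<And>k. x ^ k \<notin> M" using M by (auto simp: \<F>_def)
  have pw: "\<exists>k. \<exists>u\<in>M. \<exists>c\<in>A. x ^ k = u + c * a" if a: "a \<in> A" "a \<notin> M" for a
  proof (rule ccontr)
    assume "\<not> ?thesis"
    then have "M + pid A a \<in> \<F>"
      using Mi a plus_sub1[OF ideal_pid[OF a(1)], of M]
      by (auto simp: \<F>_def mem_plus mem_pid intro!: ideal_plus ideal_pid)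
    then have "M + pid A a = M" using mx plus_sub1[OF ideal_pid[OF a(1)], of M] by auto
    moreover have "a \<in> M + pid A a" using plus_sub2[OF Mi(1), of "pid A a"] by blast
    ultimately show False using a by auto
  qed
  have "prime_ideal A M"
    unfolding prime_ideal_def
  proof (intro conjI ballI impI)
    show "ideal A M" by fact
    show "M \<noteq> A" using Mi(3)[of 0] by auto
    fix a b assume ab: "a \<in> A" "b \<in> A" "a * b \<in> M"
    show "a \<in> M \<or> b \<in> M"
    proof (rule ccontr)
      assume "\<not> (a \<in> M \<or> b \<in> M)"
      then obtain k l u v c d where h: "u \<in> M" "c \<in> A" "x ^ k = u + c * a" "v \<in> M" "d \<in> A" "x ^ l = v + d * b"
        using pw ab by meson
      have "x ^ (k + l) = u * (v + d * b) + c * a * v + c * d * (a * b)"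
        by (simp add: power_add h algebra_simps)
      also have "\<dots> \<in> M"
        using h ab idealD[OF Mi(1)] by (meson add_mem mult_mem)
      finally show False using Mi by auto
    qed
  qed
  then show ?thesis using Mi(2) Mi(3)[of 1] by auto
qed

end

section \<open>Noetherian local rings\<close>

text \<open>The maximal ideal is a parameter, characterized by its complement consisting of units,
  instead of the description \<open>max_ideal A\<close>. A localization is then an instance with the
  extended prime as \<open>m\<close>.\<close>

locale noeth_local = noetherian_subring A for A :: "'a::field set" +
  fixes m :: "'a set"
  assumes m_ideal: "ideal A m" and one_notin: "1 \<notin> m"
    and unit: "a \<in> A \<Longrightarrow> a \<notin> m \<Longrightarrow> inverse a \<in> A"
begin

abbreviation mpow :: "nat \<Rightarrow> 'a set" where "mpow n \<equiv> ideal_pow A m n"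

lemma m_sub: "m \<subseteq> A"
  using idealD(1)[OF m_ideal] .

lemma mpow_ideal: "ideal A (mpow n)"
  by (rule ideal_pow_ideal[OF m_sub])

lemmas mpow_add = idealD(3)[OF mpow_ideal]
lemmas mpow_scale = idealD(4)[OF mpow_ideal]
lemmas mpow_A = idealD(6)[OF mpow_ideal]
lemmas mpow_mult = ideal_pow_mult[OF m_sub]
lemmas mpow_anti = ideal_pow_anti[OF m_ideal]
lemmas mpow_neg = ideal_neg[OF mpow_ideal]
lemma mpow_0 [simp]: "mpow 0 = A"
  by (rule ideal_pow_0[OF m_sub])

lemma mpow_1 [simp]: "mpow (Suc 0) = m"
  by (rule ideal_pow_1[OF m_ideal])

lemma proper_sub_m: "ideal A I \<Longrightarrow> I \<noteq> A \<Longrightarrow> I \<subseteq> m"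
proof
  fix a assume I: "ideal A I" "I \<noteq> A" and a: "a \<in> I"
  show "a \<in> m"
  proof (rule ccontr)
    assume am: "a \<notin> m"
    then have "a \<noteq> 0" using idealD(2)[OF m_ideal] by auto
    moreover have "inverse a * a \<in> I" by (rule idealD(4)[OF I(1) unit[OF idealD(6)[OF I(1) a] am] a])
    ultimately show False using ideal_one[OF I(1)] I(2) by simp
  qed
qed

lemma prime_m: "prime_ideal A m"
  unfolding prime_ideal_def
proof (intro conjI ballI impI)
  show "m \<noteq> A" using one_notin by auto
  fix a b assume ab: "a \<in> A" "b \<in> A" "a * b \<in> m"
  show "a \<in> m \<or> b \<in> m"
  proof (rule ccontr)
    assume n: "\<not> (a \<in> m \<or> b \<in> m)"
    then have nz: "a \<noteq> 0" "b \<noteq> 0" using idealD(2)[OF m_ideal] by auto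
    have "inverse a * inverse b * (a * b) \<in> m"
      by (rule idealD(4)[OF m_ideal _ ab(3)]) (use ab n unit in auto)
    then show False using one_notin nz by (simp add: field_simps)
  qed
qed (rule m_ideal)

lemma prime_sub_m: "prime_ideal A P \<Longrightarrow> P \<subseteq> m"
  by (rule proper_sub_m) (auto simp: prime_ideal_def)

lemma one_minus_unit: "a \<in> m \<Longrightarrow> 1 - a \<in> A - m"
  using idealD(3)[OF m_ideal, of "1 - a" a] one_notin m_sub by auto

text \<open>The hypothesis \<open>hyp\<close> says \<open>I \<subseteq> J + m I\<close> without mentioning products of ideals.\<close>

lemma Nakayama:
  assumes I: "ideal A I" and J: "ideal A J"
    and hyp: "\<And>K. ideal A K \<Longrightarrow> J \<subseteq> K \<Longrightarrow> (\<And>a y. a \<in> m \<Longrightarrow> y \<in> I \<Longrightarrow> a * y \<in> K) \<Longrightarrow> I \<subseteq> K"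
  shows "I \<subseteq> J"
proof (rule ccontr)
  assume n: "\<not> I \<subseteq> J"
  define \<F> where "\<F> = {K. ideal A K \<and> J \<subseteq> K \<and> \<not> I \<subseteq> K}"
  have "J \<in> \<F>" using n J by (simp add: \<F>_def)
  then obtain M where M: "M \<in> \<F>" and mx: "\<forall>K\<in>\<F>. M \<subseteq> K \<longrightarrow> K = M"
    using max_exists[of J \<F>] unfolding \<F>_def by blast
  have Mi: "ideal A M" "J \<subseteq> M" using M by (auto simp: \<F>_def)
  obtain y where y: "y \<in> I" "y \<notin> M" using M by (auto simp: \<F>_def)
  have yA: "y \<in> A" using idealD(6)[OF I y(1)] .
  have yM: "y \<in> M + pid A y" using plus_sub2[OF Mi(1), of "pid A y"] pid_mem[of y] by (rule subsetD)
  have MM: "M \<subseteq> M + pid A y" by (rule plus_sub1[OF ideal_pid[OF yA]])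
  have IMy: "I \<subseteq> M + pid A y"
  proof (rule ccontr)
    assume "\<not> I \<subseteq> M + pid A y"
    then have "M + pid A y \<in> \<F>"
      using Mi MM ideal_plus[OF Mi(1) ideal_pid[OF yA]] by (auto simp: \<F>_def)
    then show False using mx MM yM y(2) by auto
  qed
  \<comment> \<open>By maximality of \<open>M\<close>, \<open>I\<close> lies in M + Ay. Therefore M
    + my contains \<open>J\<close> and all products of \<open>m\<close> with \<open>I\<close>, hence
    all of \<open>I\<close>; so y lies in M + my, and cancelling the unit 1 - a puts y into
    \<open>M\<close>.\<close>
  define K where "K = M + (\<lambda>a. a * y) ` m"
  have my: "ideal A ((\<lambda>a. a * y) ` m)"
    using m_ideal yA unfolding ideal_def
    by (auto simp flip: distrib_right mult.assoc intro: mult_mem)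
  have K: "ideal A K" unfolding K_def by (rule ideal_plus[OF Mi(1) my])
  have "I \<subseteq> K"
  proof (rule hyp[OF K])
    show "J \<subseteq> K" unfolding K_def using plus_sub1[OF my, of M] Mi(2) by blast
    fix a i assume a: "a \<in> m" and i: "i \<in> I"
    then have "i \<in> M + pid A y" using IMy by auto
    then obtain u c where u: "u \<in> M" "c \<in> A" "i = u + c * y"
      by (rule plus_pidE)
    have "a * i = a * u + (a * c) * y" using u by (simp add: algebra_simps)
    moreover have "a * u \<in> M" "a * c \<in> m"
      using a u m_sub by (auto intro: idealD(4)[OF Mi(1)] idealD(5)[OF m_ideal])
    ultimately show "a * i \<in> K" unfolding K_def by (auto intro: plusI)
  qed
  then have "y \<in> K" using y(1) by auto
  then obtain u a where u: "u \<in> M" "a \<in> m" "y = u + a * y"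
    unfolding K_def by (auto elim: plusE)
  have "(1 - a) * y \<in> M" using u by (metis add_diff_cancel_right' left_diff_distrib mult_1)
  moreover have "inverse (1 - a) \<in> A" "1 - a \<noteq> 0"
    using unit one_minus_unit[OF u(2)] idealD(2)[OF m_ideal] by auto
  ultimately have "inverse (1 - a) * ((1 - a) * y) \<in> M"
    using idealD(4)[OF Mi(1), of "inverse (1 - a)" "(1 - a) * y"] by blast
  then show False using y(2) \<open>1 - a \<noteq> 0\<close> by (simp flip: mult.assoc)
qed

section \<open>Powers of the maximal ideal through monomials; ideals containing such a power\<close>

lemma Nakayama_pow:
  assumes K: "ideal A K" and h: "mpow N \<subseteq> K + mpow (Suc N)"
  shows "mpow N \<subseteq> K"
proof (rule Nakayama[OF mpow_ideal K])
  fix L assume L: "ideal A L" "K \<subseteq> L" and st: "\<And>a y. a \<in> m \<Longrightarrow> y \<in> mpow N \<Longrightarrow> a * y \<in> L"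
  have "mpow (Suc N) \<subseteq> L" by (rule ideal_pow_Suc_least[OF L(1) m_ideal st])
  then have "K + mpow (Suc N) \<subseteq> L" using plus_least L by blast
  then show "mpow N \<subseteq> L" using h by blast
qed

text \<open>The n-th power of the ideal generated by \<open>xs\<close>, sorted by the first
  generator: forms free of \<open>x\<close>, plus \<open>x\<close> times forms of degree one less.
  Inductions on forms follow this double recursion.\<close>

function pw :: "'a list \<Rightarrow> nat \<Rightarrow> 'a set" where
  "pw xs 0 = A"
| "pw [] (Suc n) = {0}"
| "pw (x # xs) (Suc n) = pw xs (Suc n) + (\<lambda>h. x * h) ` pw (x # xs) n"
  by pat_completeness auto
termination by (relation "measures [\<lambda>(xs, n). length xs, \<lambda>(xs, n). n]") auto

lemma ideal_scale: "ideal A I \<Longrightarrow> x \<in> A \<Longrightarrow> ideal A ((\<lambda>h. x * h) ` I)"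
  unfolding ideal_def
  by (auto simp flip: distrib_left simp: mult.left_commute)

lemma ideal_pw: "set xs \<subseteq> A \<Longrightarrow> ideal A (pw xs n)"
  by (induction xs n rule: pw.induct) (auto intro!: ideal_plus ideal_scale)

lemma pw_mult: "set xs \<subseteq> A \<Longrightarrow> x \<in> set xs \<Longrightarrow> u \<in> pw xs n \<Longrightarrow> x * u \<in> pw xs (Suc n)"
proof (induction xs n arbitrary: u rule: pw.induct)
  case (1 xs)
  show ?case
  proof -
    have "\<forall>u\<in>A. x * u \<in> pw ys (Suc 0)" if "set ys \<subseteq> A" "x \<in> set ys" for ys
      using that
    proof (induction ys)
      case (Cons y ys)
      show ?case
      proof (cases "x = y")
        case True
        have "(\<lambda>h. y * h) ` A \<subseteq> pw (y # ys) (Suc 0)"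
          using plus_sub2[OF ideal_pw, of ys "(\<lambda>h. y * h) ` A"] Cons.prems by auto
        then show ?thesis using True by auto
      next
        case False
        have "pw ys (Suc 0) \<subseteq> pw (y # ys) (Suc 0)"
          using plus_sub1[OF ideal_scale[OF ideal_self], of y] Cons.prems by auto
        then show ?thesis using False Cons by auto
      qed
    qed simp
    then show ?thesis using 1 by simp
  qed
next
  case (2 n)
  then show ?case by simp
next
  case (3 y xs n)
  obtain g h where gh: "g \<in> pw xs (Suc n)" "h \<in> pw (y # xs) n" "u = g + y * h"
    using 3(5) by (auto simp: mem_plus)
  have ys: "y \<in> A" "set xs \<subseteq> A" using 3(3) by auto
  show ?case
  proof (cases "x = y")
    case True
    have "(\<lambda>h. y * h) ` pw (y # xs) (Suc n) \<subseteq> pw (y # xs) (Suc (Suc n))"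
      using plus_sub2[OF ideal_pw[OF ys(2)], of "(\<lambda>h. y * h) ` pw (y # xs) (Suc n)" "Suc (Suc n)"] by simp
    then show ?thesis using True 3(5) by auto
  next
    case False
    then have xs: "x \<in> set xs" using 3(4) by auto
    have "x * g \<in> pw xs (Suc (Suc n))" using 3(1)[OF ys(2) xs gh(1)] .
    moreover have "x * h \<in> pw (y # xs) (Suc n)" using 3(2)[OF 3(3) 3(4) gh(2)] .
    moreover have "x * u = x * g + y * (x * h)" by (simp add: gh algebra_simps)
    ultimately show ?thesis unfolding pw.simps(3)[of y xs "Suc n"] by (auto intro: plusI)
  qed
qed

lemma pw_sub: "set xs \<subseteq> m \<Longrightarrow> pw xs n \<subseteq> mpow n"
proof (induction xs n rule: pw.induct)
  case (2 n)
  then show ?case using idealD(2)[OF mpow_ideal] by simp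
next
  case (3 x xs n)
  have "(\<lambda>h. x * h) ` pw (x # xs) n \<subseteq> mpow (Suc n)"
    using 3 ideal_pow_Suc_mem[OF m_ideal] by auto
  then show ?case unfolding pw.simps using 3 by (intro plus_least mpow_ideal) auto
qed simp

lemma mpow_eq_pw: "set xs \<subseteq> A \<Longrightarrow> lin A xs = m \<Longrightarrow> mpow n = pw xs n"
proof
  assume xs: "set xs \<subseteq> A" "lin A xs = m"
  show "mpow n \<subseteq> pw xs n"
  proof (induction n)
    case 0
    then show ?case by simp
  next
    case (Suc n)
    show ?case
    proof (rule ideal_pow_Suc_least[OF ideal_pw[OF xs(1)] m_ideal])
      fix a u assume a: "a \<in> m" "u \<in> mpow n"
      then have u: "u \<in> pw xs n" "u \<in> A" using Suc mpow_A by auto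
      have "lin A xs \<subseteq> {v \<in> A. u * v \<in> pw xs (Suc n)}"
        using xs pw_mult[OF xs(1) _ u(1)] u
        by (intro lin_least ideal_colon ideal_pw) (auto simp: mult.commute)
      then show "a * u \<in> pw xs (Suc n)" using a xs(2) by (auto simp: mult.commute)
    qed
  qed
  have "set xs \<subseteq> m" using lin_mem[OF xs(1)] xs(2) by auto
  then show "pw xs n \<subseteq> mpow n" by (rule pw_sub)
qed

lemma plus_mult: 
  assumes K: "ideal A K" and "u \<in> K + mpow i" and "v \<in> mpow j"
  shows "u * v \<in> K + mpow (i + j)" "v * u \<in> K + mpow (i + j)"
proof -
  obtain k w where h: "k \<in> K" "w \<in> mpow i" "u = k + w" using assms(2) by (rule plusE)
  have "u * v = k * v + w * v" using h by (simp add: distrib_right)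
  moreover have "k * v \<in> K" by (rule idealD(5)[OF K mpow_A[OF assms(3)] h(1)])
  moreover have "w * v \<in> mpow (i + j)" by (rule mpow_mult[OF h(2) assms(3)])
  ultimately show "u * v \<in> K + mpow (i + j)" by (simp add: plusI)
  then show "v * u \<in> K + mpow (i + j)" by (simp add: mult.commute)
qed

text \<open>In the graded ring of A/K the generators of the maximal ideal are nilpotent, so all
  forms of large degree vanish there. This gives m^N inside K + m^(N+1), and Nakayama removes the
  error. The generators are treated one at a time: in degree at least \<open>N + k\<close>, either
  at most k - 1 factors x are split off and a form of degree at least \<open>N\<close> in the others
  remains, or x^k appears.\<close>

lemma nilpotent_gens:
  assumes K: "ideal A K" and xs: "set xs \<subseteq> A" "lin A xs = m"
    and nil: "\<And>x. x \<in> set xs \<Longrightarrow> \<exists>k. x ^ k \<in> K + mpow (Suc k)"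
  shows "\<exists>N. mpow N \<subseteq> K"
proof -
  have xm: "set xs \<subseteq> m" using lin_mem[OF xs(1)] xs(2) by auto
  have idK: "ideal A (K + mpow n)" for n by (rule ideal_plus[OF K mpow_ideal])
  have "\<exists>N. \<forall>n\<ge>N. pw ys n \<subseteq> K + mpow (Suc n)" if "set ys \<subseteq> set xs" for ys
    using that
  proof (induction ys)
    case Nil
    have "pw [] n \<subseteq> K + mpow (Suc n)" if "n \<ge> 1" for n
      using that idealD(2)[OF idK] by (cases n) auto
    then show ?case by blast
  next
    case (Cons x ys)
    then obtain N where N: "\<And>n. n \<ge> N \<Longrightarrow> pw ys n \<subseteq> K + mpow (Suc n)" by auto
    obtain k where k: "x ^ k \<in> K + mpow (Suc k)" using nil Cons.prems by auto
    have xm': "x \<in> m" "set (x # ys) \<subseteq> m" using Cons.prems xm by auto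
    have "pw (x # ys) n \<subseteq> K + mpow (Suc n)" if n: "n \<ge> N + k" for n
    proof -
      have sub: "pw (x # ys) j \<subseteq> mpow j" for j by (rule pw_sub[OF xm'(2)])
      \<comment> \<open>Descending induction on the number \<open>i\<close> of factors x already
        split off, starting at \<open>i = k\<close>, where the hypothesis on x^k takes
        effect.\<close>
      have "\<forall>u\<in>pw (x # ys) (n - i). x ^ i * u \<in> K + mpow (Suc n)" if "i \<le> k" for i
        using that
      proof (induction "k - i" arbitrary: i)
        case 0
        then have i: "i = k" by simp
        show ?case
        proof
          fix u assume "u \<in> pw (x # ys) (n - i)"
          then have "u \<in> mpow (n - k)" using sub i by blast
          then have "x ^ k * u \<in> K + mpow (Suc k + (n - k))" by (rule plus_mult(1)[OF K k])
          then show "x ^ i * u \<in> K + mpow (Suc n)" using n i by simp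
        qed
      next
        case (Suc j)
        show ?case
        proof
          fix u assume u: "u \<in> pw (x # ys) (n - i)"
          have "n - i = Suc (n - Suc i)" using Suc n by auto
          then obtain g h where gh: "g \<in> pw ys (n - i)" "h \<in> pw (x # ys) (n - Suc i)" "u = g + x * h"
            using u by (auto simp: mem_plus)
          have "N \<le> n - i" using n Suc.prems by simp
          then have "g \<in> K + mpow (Suc (n - i))" using N gh(1) by blast
          then have "x ^ i * g \<in> K + mpow (Suc (n - i) + i)"
            by (rule plus_mult(2)[OF K _ power_pow[OF m_ideal xm'(1)]])
          then have 1: "x ^ i * g \<in> K + mpow (Suc n)" using n Suc by simp
          have "x ^ Suc i * h \<in> K + mpow (Suc n)" 
            using Suc.hyps(1)[of "Suc i"] Suc.hyps(2) Suc.prems gh(2) by auto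
          then have "x ^ i * g + x ^ Suc i * h \<in> K + mpow (Suc n)" by (rule idealD(3)[OF idK 1])
          then show "x ^ i * u \<in> K + mpow (Suc n)" by (simp add: gh algebra_simps)
        qed
      qed
      from this[of 0] show ?thesis by auto
    qed
    then show ?case by blast
  qed
  then obtain N where "pw xs N \<subseteq> K + mpow (Suc N)" by blast
  then show ?thesis using Nakayama_pow[OF K] mpow_eq_pw[OF xs] by blast
qed

lemma nilpotent_m:
  assumes K: "ideal A K" and nil: "\<And>x. x \<in> m \<Longrightarrow> \<exists>k. x ^ k \<in> K"
  shows "\<exists>N. mpow N \<subseteq> K"
proof -
  obtain xs where xs: "set xs \<subseteq> m" "lin A xs = m" using finitely_generated[OF m_ideal] by auto
  show ?thesis
  proof (rule nilpotent_gens[OF K _ xs(2)])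
    show "set xs \<subseteq> A" using xs m_sub by auto
    fix x assume "x \<in> set xs"
    then obtain k where "x ^ k \<in> K" using nil xs by auto
    then show "\<exists>k. x ^ k \<in> K + mpow (Suc k)" using plus_sub1[OF mpow_ideal, of K] by blast
  qed
qed

text \<open>An element of \<open>m\<close> with no power in \<open>K\<close> would be avoided by a
  prime over \<open>K\<close>. So every element of \<open>m\<close> has a power in \<open>K\<close>,
  and finite generation makes the exponent uniform.\<close>

lemma only_prime_m:
  assumes K: "ideal A K" and only: "\<And>P. prime_ideal A P \<Longrightarrow> K \<subseteq> P \<Longrightarrow> m \<subseteq> P"
  shows "\<exists>N. mpow N \<subseteq> K"
proof (rule nilpotent_m[OF K])
  fix x assume x: "x \<in> m"
  show "\<exists>k. x ^ k \<in> K"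
  proof (rule ccontr)
    assume "\<not> ?thesis"
    then obtain P where "prime_ideal A P" "K \<subseteq> P" "x \<notin> P"
      using prime_avoiding[OF K, of x] x m_sub by auto
    then show False using only x by blast
  qed
qed

text \<open>Nakayama is applied to the intersection J of all I + m^n. Given K0 containing I and mJ,
  choose K maximal with K meeting J inside K0. If K contains a power of m, then it contains J, so J
  lies in K0.\<close>

lemma Krull_intersection:
  assumes I: "ideal A I" and u: "\<And>n. u \<in> I + mpow n"
  shows "u \<in> I"
proof -
  define J where "J = (\<Inter>n. I + mpow n)"
  have J: "ideal A J" unfolding J_def by (rule ideal_Inter) (auto intro: ideal_plus I mpow_ideal)
  have "J \<subseteq> I"
  proof (rule Nakayama[OF J I])
    fix K0 assume K0: "ideal A K0" "I \<subseteq> K0" and st: "\<And>a y. a \<in> m \<Longrightarrow> y \<in> J \<Longrightarrow> a * y \<in> K0"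
    define \<F> where "\<F> = {K. ideal A K \<and> K0 \<subseteq> K \<and> K \<inter> J \<subseteq> K0}"
    have "K0 \<in> \<F>" using K0 by (simp add: \<F>_def)
    then obtain K where K: "K \<in> \<F>" and mx: "\<forall>L\<in>\<F>. K \<subseteq> L \<longrightarrow> L = K"
      using max_exists[of K0 \<F>] unfolding \<F>_def by blast
    have Ki: "ideal A K" "K0 \<subseteq> K" "K \<inter> J \<subseteq> K0" using K by (auto simp: \<F>_def)
    have "\<exists>i. x ^ i \<in> K" if x: "x \<in> m" for x
    proof -
      have xA: "x \<in> A" using x m_sub by auto
      \<comment> \<open>The ideals K : x^i ascend, hence stabilize. At a stable index, adding x^i to
        K does not enlarge the intersection with J beyond K0, because xJ lies in K0; maximality then
        puts x^i into K.\<close>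
      define f where "f i = {a \<in> A. x ^ i * a \<in> K}" for i
      have "\<exists>i. f (Suc i) = f i"
      proof (rule ascending_stable)
        show "ideal A (f n)" for n unfolding f_def by (rule ideal_colon[OF Ki(1)]) (use xA in auto)
        show "f n \<subseteq> f (Suc n)" for n
          unfolding f_def using idealD(4)[OF Ki(1) xA] by (auto simp: mult.assoc)
      qed
      then obtain i where i: "f (Suc i) = f i" by blast
      have xi: "x ^ i \<in> A" using xA by auto
      have "K + pid A (x ^ i) \<in> \<F>"
      proof -
        have "u \<in> K0" if u: "u \<in> K + pid A (x ^ i)" "u \<in> J" for u
        proof -
          obtain k a where k: "k \<in> K" "a \<in> A" "u = k + a * x ^ i"
            using u(1) by (rule plus_pidE)
          have "x * u \<in> K" using st[OF x u(2)] Ki(2) by blast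
          moreover have "x * k \<in> K" using idealD(4)[OF Ki(1) xA k(1)] .
          ultimately have "x * u - x * k \<in> K" by (rule ideal_diff[OF Ki(1)])
          then have "x ^ Suc i * a \<in> K" using k(3) by (simp add: algebra_simps)
          then have "a \<in> f i" using i k(2) unfolding f_def by blast
          then have "a * x ^ i \<in> K" by (simp add: f_def mult.commute)
          then have "u \<in> K" using idealD(3)[OF Ki(1) k(1)] k(3) by simp
          then show ?thesis using Ki(3) u(2) by blast
        qed
        moreover have "K0 \<subseteq> K + pid A (x ^ i)"
          using Ki(2) plus_sub1[OF ideal_pid[OF xi], of K] by blast
        ultimately show ?thesis using ideal_plus[OF Ki(1) ideal_pid[OF xi]] unfolding \<F>_def by blast
      qed
      then have "K + pid A (x ^ i) = K" using mx plus_sub1[OF ideal_pid[OF xi], of K] by blast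
      moreover have "x ^ i \<in> K + pid A (x ^ i)" using plus_sub2[OF Ki(1), of "pid A (x ^ i)"] by blast
      ultimately show ?thesis by blast
    qed
    then obtain N where N: "mpow N \<subseteq> K" using nilpotent_m[OF Ki(1)] by blast
    have "I + mpow N \<subseteq> K" using plus_least[OF Ki(1) _ N] K0(2) Ki(2) by blast
    then have "J \<subseteq> K" unfolding J_def by blast
    then show "J \<subseteq> K0" using Ki(3) by blast
  qed
  then show ?thesis using u unfolding J_def by blast
qed

lemma Krull_zero: "(\<And>n. u \<in> mpow n) \<Longrightarrow> u = 0"
  using Krull_intersection[OF ideal_zero, of u] by auto

end

section \<open>Localization and the height theorem\<close>

context field_subring
begin

text \<open>The set is the contraction to \<open>A\<close> of the extension of \<open>K\<close> to
  the localization at \<open>Q\<close>; working with it keeps localized arguments inside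
  \<open>A\<close>.\<close>

lemma ideal_saturate:
  assumes K: "ideal A K" and Q: "prime_ideal A Q"
  shows "ideal A {r \<in> A. \<exists>s\<in>A. s \<notin> Q \<and> s * r \<in> K}"
  unfolding ideal_def
proof (intro conjI ballI)
  show "0 \<in> {r \<in> A. \<exists>s\<in>A. s \<notin> Q \<and> s * r \<in> K}"
    using prime_ideal_one[OF Q] idealD(2)[OF K] by force
next
  fix x y assume "x \<in> {r \<in> A. \<exists>s\<in>A. s \<notin> Q \<and> s * r \<in> K}" "y \<in> {r \<in> A. \<exists>s\<in>A. s \<notin> Q \<and> s * r \<in> K}"
  then obtain s t where h: "x \<in> A" "y \<in> A" "s \<in> A" "s \<notin> Q" "s * x \<in> K" "t \<in> A" "t \<notin> Q" "t * y \<in> K" by blast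
  have "t * (s * x) + s * (t * y) \<in> K"
    by (rule idealD(3)[OF K idealD(4)[OF K h(6,5)] idealD(4)[OF K h(3,8)]])
  then have "(s * t) * (x + y) \<in> K" by (simp add: algebra_simps)
  moreover have "s * t \<in> A - Q" using h prime_idealD(3)[OF Q] by blast
  ultimately show "x + y \<in> {r \<in> A. \<exists>s\<in>A. s \<notin> Q \<and> s * r \<in> K}" using h by blast
next
  fix a x assume "a \<in> A" "x \<in> {r \<in> A. \<exists>s\<in>A. s \<notin> Q \<and> s * r \<in> K}"
  then obtain s where h: "x \<in> A" "a \<in> A" "s \<in> A" "s \<notin> Q" "s * x \<in> K" by blast
  have "a * (s * x) \<in> K" by (rule idealD(4)[OF K h(2,5)])
  then have "s * (a * x) \<in> K" by (simp add: algebra_simps)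
  then show "a * x \<in> {r \<in> A. \<exists>s\<in>A. s \<notin> Q \<and> s * r \<in> K}" using h by blast
qed blast

lemma prime_mult_notin: "prime_ideal A Q \<Longrightarrow> a \<in> A \<Longrightarrow> b \<in> A \<Longrightarrow> a \<notin> Q \<Longrightarrow> b \<notin> Q \<Longrightarrow> a * b \<notin> Q"
  using prime_idealD(3) by blast

end

text \<open>\<open>C\<close> is a ring of fractions of \<open>A\<close>. The denominators are
  whatever elements of \<open>A\<close> become units in \<open>C\<close>, so that localizations at
  primes and the rings S[1/x_n] are covered alike.\<close>

definition frac_over :: "'a::field set \<Rightarrow> 'a set \<Rightarrow> bool" where
  "frac_over A C \<longleftrightarrow> subring C \<and> A \<subseteq> C \<and>
     (\<forall>c\<in>C. \<exists>a\<in>A. \<exists>s\<in>A. s \<noteq> 0 \<and> inverse s \<in> C \<and> c = a / s)"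

text \<open>Clearing denominators shows that an ideal J of \<open>C\<close> is generated by its
  contraction to \<open>A\<close>, which has finitely many generators.\<close>

lemma noetherian_frac_over:
  assumes A: "noetherian A" and C: "frac_over A C"
  shows "noetherian C"
proof -
  have sA: "subring A" using A by (simp add: noetherian_def)
  have sC: "subring C" "A \<subseteq> C" using C by (auto simp: frac_over_def)
  interpret A: noetherian_subring A by standard (use sA A in auto)
  interpret C: field_subring C by standard (use sC in auto)
  have "\<exists>X. finite X \<and> X \<subseteq> J \<and> ideal_gen C X = J" if J: "ideal C J" for J
  proof -
    have "ideal A (J \<inter> A)"
      using J sC unfolding ideal_def by (auto simp: subset_iff)
    then obtain xs where xs: "set xs \<subseteq> J \<inter> A" "lin A xs = J \<inter> A" using A.finitely_generated by blast
    have idl: "ideal C (lin C xs)" using xs sC by (intro C.ideal_lin) auto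
    have AC: "lin A xs \<subseteq> lin C xs"
    proof -
      have "ideal A (lin C xs \<inter> A)"
        using idl sC unfolding ideal_def by (auto simp: subset_iff)
      moreover have "set xs \<subseteq> lin C xs \<inter> A" using xs sC C.lin_mem[of xs] by auto
      ultimately show ?thesis using A.lin_least by blast
    qed
    have "J \<subseteq> lin C xs"
    proof
      fix c assume c: "c \<in> J"
      then have "c \<in> C" using idealD(6)[OF J] by blast
      then obtain a s where as: "a \<in> A" "s \<in> A" "s \<noteq> 0" "inverse s \<in> C" "c = a / s"
        using C unfolding frac_over_def by blast
      have "s * c \<in> J" using idealD(4)[OF J _ c] as sC by blast
      then have "a \<in> J \<inter> A" using as by simp
      then have "a \<in> lin C xs" using AC xs by blast
      then have "inverse s * a \<in> lin C xs" by (rule idealD(4)[OF idl as(4)])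
      then show "c \<in> lin C xs" using as(5) by (simp add: divide_inverse mult.commute)
    qed
    moreover have "lin C xs \<subseteq> J" using C.lin_least[OF J] xs by auto
    moreover have "ideal_gen C (set xs) = lin C xs" using C.lin_gen xs sC by auto
    ultimately show ?thesis using xs by (intro exI[of _ "set xs"]) auto
  qed
  then show ?thesis using sC by (simp add: noetherian_def)
qed

definition loc_ext :: "'a::field set \<Rightarrow> 'a set \<Rightarrow> 'a set \<Rightarrow> 'a set" where
  "loc_ext A Q P = {a / b | a b. a \<in> P \<and> b \<in> A \<and> b \<notin> Q}"

context field_subring
begin

context
  fixes Q assumes Q: "prime_ideal A Q"
begin

lemma notin_prime_nonzero: "b \<notin> Q \<Longrightarrow> b \<noteq> 0"
  using idealD(2)[OF prime_idealD(1)[OF Q]] by auto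

lemma localization_sub: "A \<subseteq> localization A Q"
proof
  fix a assume "a \<in> A"
  then show "a \<in> localization A Q"
    unfolding localization_def using prime_ideal_one[OF Q]
    by (intro CollectI, rule_tac exI[of _ a], rule_tac exI[of _ 1]) auto
qed

lemma localization_inverse: "b \<in> A \<Longrightarrow> b \<notin> Q \<Longrightarrow> inverse b \<in> localization A Q"
  unfolding localization_def by (auto simp: inverse_eq_divide)

lemma ideal_loc_ext:
  assumes P: "ideal A P" shows "ideal (localization A Q) (loc_ext A Q P)"
  unfolding ideal_def
proof (intro conjI ballI)
  show "loc_ext A Q P \<subseteq> localization A Q"
    unfolding loc_ext_def localization_def using idealD(6)[OF P] by blast
  show "0 \<in> loc_ext A Q P"
    unfolding loc_ext_def using idealD(2)[OF P] prime_ideal_one[OF Q] by force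
next
  fix x y assume "x \<in> loc_ext A Q P" "y \<in> loc_ext A Q P"
  then obtain a b c d where h: "a \<in> P" "b \<in> A" "b \<notin> Q" "x = a / b" "c \<in> P" "d \<in> A" "d \<notin> Q" "y = c / d"
    unfolding loc_ext_def by blast
  have "x + y = (d * a + b * c) / (b * d)" using h notin_prime_nonzero by (simp add: field_simps)
  moreover have "d * a + b * c \<in> P" using h by (intro idealD(3,4)[OF P])
  moreover have "b * d \<in> A" "b * d \<notin> Q" using h prime_mult_notin[OF Q] by auto
  ultimately show "x + y \<in> loc_ext A Q P" unfolding loc_ext_def by blast
next
  fix x y assume "x \<in> localization A Q" "y \<in> loc_ext A Q P"
  then obtain a b c d where h: "a \<in> A" "b \<in> A" "b \<notin> Q" "x = a / b" "c \<in> P" "d \<in> A" "d \<notin> Q" "y = c / d"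
    unfolding loc_ext_def localization_def by blast
  have "x * y = (a * c) / (b * d)" using h by simp
  moreover have "a * c \<in> P" using h by (intro idealD(4)[OF P])
  moreover have "b * d \<in> A" "b * d \<notin> Q" using h prime_mult_notin[OF Q] by auto
  ultimately show "x * y \<in> loc_ext A Q P" unfolding loc_ext_def by blast
qed

lemma localization_eq_ext: "localization A Q = loc_ext A Q A"
  by (simp add: localization_def loc_ext_def)

lemma subring_localization: "subring (localization A Q)"
proof -
  have id: "ideal (localization A Q) (localization A Q)"
    unfolding localization_eq_ext using ideal_loc_ext[OF ideal_self] unfolding localization_eq_ext .
  have "-1 \<in> localization A Q" "1 \<in> localization A Q" using localization_sub by auto
  then show ?thesis
    unfolding subring_def using idealD(2-4)[OF id] by (metis mult_minus1)
qed

lemma frac_over_localization: "frac_over A (localization A Q)"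
  unfolding frac_over_def
proof (intro conjI ballI subring_localization localization_sub)
  fix c assume "c \<in> localization A Q"
  then obtain a b where "a \<in> A" "b \<in> A" "b \<notin> Q" "c = a / b" unfolding localization_def by blast
  then show "\<exists>a\<in>A. \<exists>s\<in>A. s \<noteq> 0 \<and> inverse s \<in> localization A Q \<and> c = a / s"
    using notin_prime_nonzero localization_inverse by blast
qed

lemma loc_ext_contract:
  assumes P: "prime_ideal A P" "P \<subseteq> Q" and u: "u \<in> A" "u \<in> loc_ext A Q P"
  shows "u \<in> P"
proof -
  obtain a b where h: "a \<in> P" "b \<in> A" "b \<notin> Q" "u = a / b" using u unfolding loc_ext_def by blast
  then have "b * u \<in> P" using notin_prime_nonzero by simp
  then show ?thesis using prime_idealD(3)[OF P(1) h(2) u(1)] P(2) h(3) by blast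
qed

lemma loc_ext_sub: "P \<subseteq> loc_ext A Q P"
proof
  fix a assume "a \<in> P"
  then show "a \<in> loc_ext A Q P"
    unfolding loc_ext_def using prime_ideal_one[OF Q]
    by (intro CollectI, rule_tac exI[of _ a], rule_tac exI[of _ 1]) auto
qed

lemma prime_loc_ext:
  assumes P: "prime_ideal A P" "P \<subseteq> Q"
  shows "prime_ideal (localization A Q) (loc_ext A Q P)"
  unfolding prime_ideal_def
proof (intro conjI ballI impI)
  show "ideal (localization A Q) (loc_ext A Q P)" by (rule ideal_loc_ext[OF prime_idealD(1)[OF P(1)]])
  have "1 \<notin> loc_ext A Q P" using loc_ext_contract[OF P] prime_ideal_one[OF P(1)] by blast
  then show "loc_ext A Q P \<noteq> localization A Q" using localization_sub by auto
  fix x y assume "x \<in> localization A Q" "y \<in> localization A Q" and xy: "x * y \<in> loc_ext A Q P"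
  then obtain a b c d where h: "a \<in> A" "b \<in> A" "b \<notin> Q" "x = a / b" "c \<in> A" "d \<in> A" "d \<notin> Q" "y = c / d"
    unfolding localization_def by blast
  have "b * d * (x * y) \<in> loc_ext A Q P"
    using h localization_sub by (intro idealD(4)[OF ideal_loc_ext[OF prime_idealD(1)[OF P(1)]] _ xy]) auto
  then have "a * c \<in> loc_ext A Q P" using h notin_prime_nonzero by (simp add: field_simps)
  then have "a * c \<in> P" using loc_ext_contract[OF P] h by blast
  then have "a \<in> P \<or> c \<in> P" using prime_idealD(3)[OF P(1)] h by blast
  then show "x \<in> loc_ext A Q P \<or> y \<in> loc_ext A Q P" unfolding loc_ext_def using h by blast
qed

end

end

lemma (in noetherian_subring) noeth_local_localization:
  assumes Q: "prime_ideal A Q"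
  shows "noeth_local (localization A Q) (loc_ext A Q Q)"
proof
  show "subring (localization A Q)" by (rule subring_localization[OF Q])
  show "noetherian (localization A Q)" by (rule noetherian_frac_over[OF noetherian frac_over_localization[OF Q]])
  show "ideal (localization A Q) (loc_ext A Q Q)" by (rule ideal_loc_ext[OF Q prime_idealD(1)[OF Q]])
  show "1 \<notin> loc_ext A Q Q" using loc_ext_contract[OF Q Q] prime_ideal_one[OF Q] by blast
  fix a assume "a \<in> localization A Q" and n: "a \<notin> loc_ext A Q Q"
  then obtain x y where h: "x \<in> A" "y \<in> A" "y \<notin> Q" "a = x / y" unfolding localization_def by blast
  then have "x \<notin> Q" using n unfolding loc_ext_def by blast
  then show "inverse a \<in> localization A Q" unfolding localization_def using h by (auto simp: inverse_eq_divide)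
qed

section \<open>Artinian quotients and Krull's principal ideal theorem\<close>

context noeth_local
begin

text \<open>The ring A/J is artinian, expressed through the ideals of \<open>A\<close> that contain
  \<open>J\<close>.\<close>

definition dcc :: "'a set \<Rightarrow> bool" where
  "dcc J \<longleftrightarrow> (\<forall>f. (\<forall>n. ideal A (f n) \<and> J \<subseteq> f n \<and> f (Suc n) \<subseteq> f n) \<longrightarrow> (\<exists>k. \<forall>n\<ge>k. f n = f k))"

text \<open>The quotient of J + Ax by J is killed by \<open>m\<close>, so it has length at most one.
  Once \<open>x\<close> has left the chain, two members with the same sum with Ax must agree: their
  elements differ by some c x in the larger member, where c cannot be a unit, and for c in
  \<open>m\<close> the product lies in J.\<close>

lemma dcc_step:
  assumes J: "ideal A J" and x: "x \<in> A" and D: "dcc (J + pid A x)" and mx: "\<And>a. a \<in> m \<Longrightarrow> a * x \<in> J"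
  shows "dcc J"
  unfolding dcc_def
proof (intro allI impI)
  fix f assume f: "\<forall>n. ideal A (f n) \<and> J \<subseteq> f n \<and> f (Suc n) \<subseteq> f n"
  then have id: "\<And>n. ideal A (f n)" and sub: "\<And>n. J \<subseteq> f n" and dec: "\<And>n. f (Suc n) \<subseteq> f n" by auto
  have anti: "f n \<subseteq> f k" if "k \<le> n" for k n using lift_Suc_antimono_le[of f k n] dec that by blast
  have px: "ideal A (pid A x)" by (rule ideal_pid[OF x])
  show "\<exists>k. \<forall>n\<ge>k. f n = f k"
  proof (cases "\<forall>n. x \<in> f n")
    case True
    then have "J + pid A x \<subseteq> f n" for n using plus_least[OF id sub pid_least[OF id]] by blast
    then show ?thesis using D id dec unfolding dcc_def by blast
  next
    case False
    then obtain k2 where k2: "x \<notin> f k2" by blast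
    have "\<exists>k. \<forall>n\<ge>k. f n + pid A x = f k + pid A x"
    proof -
      have "ideal A (f n + pid A x) \<and> J + pid A x \<subseteq> f n + pid A x \<and> f (Suc n) + pid A x \<subseteq> f n + pid A x" for n
        by (intro conjI ideal_plus id px set_plus_mono2 sub dec order_refl)
      then show ?thesis using D unfolding dcc_def by (elim allE[of _ "\<lambda>n. f n + pid A x"]) blast
    qed
    then obtain k1 where k1: "\<And>n. n \<ge> k1 \<Longrightarrow> f n + pid A x = f k1 + pid A x" by blast
    define k where "k = max k1 k2"
    have xk: "x \<notin> f k" using k2 anti[of k2 k] by (auto simp: k_def)
    have "f n = f k" if n: "n \<ge> k" for n
    proof
      show "f n \<subseteq> f k" by (rule anti[OF n])
      show "f k \<subseteq> f n"
      proof
        fix u assume u: "u \<in> f k"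
        have "u \<in> f k + pid A x" using plus_sub1[OF px, of "f k"] u by blast
        also have "f k + pid A x = f n + pid A x" using k1[of k] k1[of n] n by (simp add: k_def)
        finally obtain w c where w: "w \<in> f n" "c \<in> A" "u = w + c * x" by (rule plus_pidE)
        have "u - w \<in> f k" by (rule ideal_diff[OF id u subsetD[OF anti[OF n] w(1)]])
        then have cx: "c * x \<in> f k" using w by simp
        have "c \<in> m"
        proof (rule ccontr)
          assume cm: "c \<notin> m"
          then have "inverse c * (c * x) \<in> f k" by (intro idealD(4)[OF id unit[OF w(2) cm] cx])
          moreover have "c \<noteq> 0" using cm idealD(2)[OF m_ideal] by auto
          ultimately show False using xk by (simp flip: mult.assoc)
        qed
        then have "c * x \<in> f n" using mx sub by blast
        then show "u \<in> f n" unfolding w(3) by (rule idealD(3)[OF id w(1)])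
      qed
    qed
    then show ?thesis by blast
  qed
qed

text \<open>From m^(n+1) to m^n one passes by adding finitely many generators, each a step of length
  at most one.\<close>

lemma dcc_mpow: "dcc (mpow N)"
proof (induction N)
  case 0
  have "f n = A" if "ideal A (f n) \<and> A \<subseteq> f n \<and> f (Suc n) \<subseteq> f n" for f :: "nat \<Rightarrow> 'a set" and n
    using that idealD(1)[of A "f n"] by blast
  then show ?case unfolding dcc_def by (metis mpow_0)
next
  case (Suc n)
  obtain ys where ys: "set ys \<subseteq> mpow n" "lin A ys = mpow n" using finitely_generated[OF mpow_ideal] by blast
  have "dcc (mpow (Suc n))" if "set zs \<subseteq> mpow n" "dcc (mpow (Suc n) + lin A zs)" for zs
    using that
  proof (induction zs)
    case (Cons z zs)
    have zA: "z \<in> A" "set zs \<subseteq> A" using Cons.prems mpow_A by auto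
    have id: "ideal A (mpow (Suc n) + lin A zs)" by (intro ideal_plus mpow_ideal ideal_lin zA)
    have "dcc (mpow (Suc n) + lin A zs)"
    proof (rule dcc_step[OF id zA(1)])
      show "dcc (mpow (Suc n) + lin A zs + pid A z)" using Cons.prems(2) by (simp add: ac_simps)
      fix a assume "a \<in> m"
      then have "a * z \<in> mpow (Suc n)" using ideal_pow_Suc_mem[OF m_ideal] Cons.prems by auto
      then show "a * z \<in> mpow (Suc n) + lin A zs" using plus_sub1[OF ideal_lin[OF zA(2)], of "mpow (Suc n)"] by blast
    qed
    then show ?case using Cons by simp
  qed simp
  moreover have "mpow (Suc n) + lin A ys = mpow n"
    using plus_least[OF mpow_ideal, of "mpow (Suc n)" n "lin A ys"] mpow_anti[of n "Suc n"] ys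
      plus_sub2[OF mpow_ideal, of "lin A ys" "Suc n"] by auto
  ultimately show ?case using ys Suc by auto
qed

text \<open>Krull's argument in the domain A/Q'. Hypothesis \<open>N\<close> makes \<open>m\<close>
  minimal over Q' + (a), and a prime \<open>Q\<close> strictly between is refuted: the symbolic
  powers of Q/Q' become stationary, first modulo \<open>a\<close> by the artinian property and then
  outright by Nakayama, which forces a power of \<open>Q\<close> into \<open>Q'\<close>.\<close>

lemma principal_ideal_theorem:
  assumes Q': "prime_ideal A Q'" and Q: "prime_ideal A Q" and QQ: "Q' \<subset> Q" and Qm: "Q \<noteq> m"
    and a: "a \<in> m" and N: "mpow N \<subseteq> Q' + pid A a"
  shows False
proof -
  note Qi = prime_idealD(1)[OF Q] and Q'i = prime_idealD(1)[OF Q']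
  have aA: "a \<in> A" using a m_sub by blast
  have pa: "ideal A (pid A a)" by (rule ideal_pid[OF aA])
  have aQ: "a \<notin> Q"
  proof
    assume "a \<in> Q"
    then have "mpow N \<subseteq> Q" using N plus_least[OF Qi, of Q' "pid A a"] QQ pid_least[OF Qi] by blast
    then show False using prime_ideal_pow_sub[OF Q m_ideal] prime_sub_m[OF Q] Qm by blast
  qed
  let ?Qp = "\<lambda>n. ideal_pow A Q n"
  have Qp: "ideal A (?Qp n)" for n by (rule ideal_pow_ideal[OF idealD(1)[OF Qi]])
  \<comment> \<open>the symbolic powers of \<open>Q / Q'\<close>\<close>
  define S where "S n = {r \<in> A. \<exists>s\<in>A. s \<notin> Q \<and> s * r \<in> ?Qp n + Q'}" for n
  have Si: "ideal A (S n)" for n unfolding S_def by (intro ideal_saturate ideal_plus Qp Q'i Q)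
  have "?Qp (Suc n) + Q' \<subseteq> ?Qp n + Q'" for n
    by (intro set_plus_mono2 ideal_pow_Suc_sub Qi order_refl)
  then have Sdec: "S (Suc n) \<subseteq> S n" for n unfolding S_def by blast
  have sat: "K \<subseteq> S n" if "K \<subseteq> A" "K \<subseteq> ?Qp n + Q'" for K n
    unfolding S_def using that prime_ideal_one[OF Q] by force
  have Q'S: "Q' \<subseteq> S n" for n by (rule sat[OF idealD(1)[OF Q'i] plus_sub2[OF Qp]])
  obtain k where k: "S (Suc k) + pid A a = S k + pid A a"
  proof -
    have "ideal A (S n + pid A a) \<and> mpow N \<subseteq> S n + pid A a \<and> S (Suc n) + pid A a \<subseteq> S n + pid A a" for n
    proof (intro conjI ideal_plus Si pa set_plus_mono2 Sdec order_refl)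
      show "mpow N \<subseteq> S n + pid A a"
        using N set_plus_mono2[OF Q'S order_refl, of "pid A a" n] by blast
    qed
    then have "\<exists>k. \<forall>n\<ge>k. S n + pid A a = S k + pid A a"
      using dcc_mpow[of N] unfolding dcc_def by (elim allE[of _ "\<lambda>n. S n + pid A a"]) blast
    then show ?thesis using that by (meson le_Suc_eq order_refl)
  qed
  \<comment> \<open>An element r of \<open>S k\<close> is u + t a with u in
    \<open>S (Suc k)\<close>. Then t a lies in \<open>S k\<close>, and since a is outside
    \<open>Q\<close>, so does t; thus r is in \<open>S (Suc k)\<close> plus \<open>m\<close> times
    \<open>S k\<close>.\<close>
  have SS: "S k \<subseteq> S (Suc k)"
  proof (rule Nakayama[OF Si Si])
    fix K assume K: "ideal A K" "S (Suc k) \<subseteq> K" and mK: "\<And>b y. b \<in> m \<Longrightarrow> y \<in> S k \<Longrightarrow> b * y \<in> K"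
    show "S k \<subseteq> K"
    proof
      fix r assume r: "r \<in> S k"
      then have "r \<in> S (Suc k) + pid A a" using plus_sub1[OF pa, of "S k"] k by blast
      then obtain u t where u: "u \<in> S (Suc k)" "t \<in> A" "r = u + t * a" by (rule plus_pidE)
      have "r - u \<in> S k" by (rule ideal_diff[OF Si r subsetD[OF Sdec u(1)]])
      then obtain s where s: "s \<in> A" "s \<notin> Q" "s * (t * a) \<in> ?Qp k + Q'" using u unfolding S_def by auto
      then have "(s * a) * t \<in> ?Qp k + Q'" by (simp add: ac_simps)
      moreover have "s * a \<in> A" "s * a \<notin> Q" using s aA aQ prime_mult_notin[OF Q] by auto
      ultimately have "t \<in> S k" using u(2) unfolding S_def by blast
      then have "a * t \<in> K" by (rule mK[OF a])
      then have "t * a \<in> K" by (simp add: mult.commute)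
      then show "r \<in> K" using idealD(3)[OF K(1)] K(2) u by blast
    qed
  qed
  have "?Qp k \<subseteq> Q'"
  proof (rule ccontr)
    assume nsub: "\<not> ?Qp k \<subseteq> Q'"
    \<comment> \<open>Nakayama in the localization of A/Q' at \<open>Q\<close>, carried out in
      \<open>A\<close>: the members of the family are saturated with respect to the complement of
      \<open>Q\<close>, that is, contracted from the localization.\<close>
    define \<F> where "\<F> = {M. ideal A M \<and> Q' \<subseteq> M \<and> (\<forall>s\<in>A. s \<notin> Q \<longrightarrow> (\<forall>r\<in>A. s * r \<in> M \<longrightarrow> r \<in> M)) \<and> \<not> ?Qp k \<subseteq> M}"
    have "Q' \<in> \<F>" unfolding \<F>_def using nsub Q'i QQ prime_idealD(3)[OF Q'] by blast
    moreover have "ideal A I" if "I \<in> \<F>" for I using that by (simp add: \<F>_def)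
    ultimately obtain M where M: "M \<in> \<F>" and mx: "\<forall>L\<in>\<F>. M \<subseteq> L \<longrightarrow> L = M"
      using max_exists[of Q' \<F>] by blast
    have Mi: "ideal A M" "Q' \<subseteq> M" and Msat: "\<And>s r. s \<in> A \<Longrightarrow> s \<notin> Q \<Longrightarrow> r \<in> A \<Longrightarrow> s * r \<in> M \<Longrightarrow> r \<in> M"
      using M by (auto simp: \<F>_def)
    obtain y where y: "y \<in> ?Qp k" "y \<notin> M" using M by (auto simp: \<F>_def)
    have yA: "y \<in> A" by (rule idealD(6)[OF Qp y(1)])
    define L where "L = {r \<in> A. \<exists>s\<in>A. s \<notin> Q \<and> s * r \<in> M + pid A y}"
    have Li: "ideal A L" unfolding L_def by (intro ideal_saturate ideal_plus Mi ideal_pid yA Q)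
    have one: "1 \<in> A" "1 \<notin> Q" using prime_ideal_one[OF Q] by auto
    have M_sub_L: "M \<subseteq> L"
    proof
      fix u assume u: "u \<in> M"
      then have "1 * u \<in> M + pid A y" using plus_sub1[OF ideal_pid[OF yA], of M] by auto
      then show "u \<in> L" unfolding L_def using one idealD(6)[OF Mi(1) u] by blast
    qed
    have "1 * y \<in> M + pid A y" using plus_sub2[OF Mi(1), of "pid A y"] by auto
    then have yL: "y \<in> L" unfolding L_def using one yA by blast
    have Lsat: "r \<in> L" if r: "s \<in> A" "s \<notin> Q" "r \<in> A" "s * r \<in> L" for s r
    proof -
      obtain t where "t \<in> A" "t \<notin> Q" "t * (s * r) \<in> M + pid A y" using r(4) unfolding L_def by blast
      then have "t * s \<in> A" "t * s \<notin> Q" "(t * s) * r \<in> M + pid A y"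
        using r prime_mult_notin[OF Q] by (auto simp: mult.assoc)
      then show ?thesis unfolding L_def using r(3) by blast
    qed
    have QL: "?Qp k \<subseteq> L"
    proof (rule ccontr)
      assume "\<not> ?Qp k \<subseteq> L"
      then have "L \<in> \<F>" unfolding \<F>_def using Li Mi(2) M_sub_L Lsat by blast
      then have "L = M" using mx M_sub_L by blast
      then show False using yL y(2) by blast
    qed
    \<comment> \<open>The saturation of M + yQ. It contains the power \<open>Suc k\<close> of
      \<open>Q\<close> because \<open>L\<close>, the saturation of M + Ay, contains the power
      \<open>k\<close> by maximality of \<open>M\<close>. As y lies in \<open>S (Suc k)\<close>,
      some element outside \<open>Q\<close> multiplies y into \<open>M\<close>, contradicting
      saturation.\<close>
    define W where "W = {r \<in> A. \<exists>s\<in>A. s \<notin> Q \<and> s * r \<in> M + (\<lambda>h. y * h) ` Q}"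
    have yQ: "ideal A ((\<lambda>h. y * h) ` Q)" by (rule ideal_scale[OF Qi yA])
    have Wi: "ideal A W" unfolding W_def by (intro ideal_saturate ideal_plus Mi yQ Q)
    have "?Qp (Suc k) \<subseteq> W"
    proof (rule ideal_pow_Suc_least[OF Wi Qi])
      fix b u assume b: "b \<in> Q" and u: "u \<in> ?Qp k"
      then obtain s where s: "s \<in> A" "s \<notin> Q" "s * u \<in> M + pid A y" using QL unfolding L_def by blast
      then obtain \<mu> c where c: "\<mu> \<in> M" "c \<in> A" "s * u = \<mu> + c * y" by (auto elim: plus_pidE)
      have bA: "b \<in> A" by (rule idealD(6)[OF Qi b])
      have "s * (b * u) = b * (s * u)" by simp
      also have "\<dots> = b * \<mu> + y * (c * b)" using c by (simp add: algebra_simps)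
      also have "\<dots> \<in> M + (\<lambda>h. y * h) ` Q"
        using idealD(4)[OF Mi(1) bA c(1)] idealD(4)[OF Qi c(2) b] by (intro plusI) auto
      finally show "b * u \<in> W" unfolding W_def using s bA idealD(6)[OF Qp u] by blast
    qed
    moreover have "Q' \<subseteq> W"
    proof
      fix u assume u: "u \<in> Q'"
      then have "1 * u \<in> M + (\<lambda>h. y * h) ` Q" using Mi(2) plus_sub1[OF yQ, of M] by auto
      then show "u \<in> W" unfolding W_def using one idealD(6)[OF Q'i u] by blast
    qed
    ultimately have sub: "?Qp (Suc k) + Q' \<subseteq> W" by (rule plus_least[OF Wi])
    have "y \<in> S (Suc k)"
      using SS sat[OF idealD(1)[OF Qp] plus_sub1[OF Q'i], of k] y(1) by blast
    then obtain s where s: "s \<in> A" "s \<notin> Q" "s * y \<in> W" using sub unfolding S_def by blast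
    then obtain t where t: "t \<in> A" "t \<notin> Q" "t * (s * y) \<in> M + (\<lambda>h. y * h) ` Q" unfolding W_def by blast
    then obtain \<mu> q where q: "\<mu> \<in> M" "q \<in> Q" "t * (s * y) = \<mu> + y * q" by (auto elim: plusE)
    then have "(t * s - q) * y \<in> M" by (simp add: algebra_simps)
    moreover have qA: "q \<in> A" by (rule idealD(6)[OF Qi q(2)])
    moreover have "t * s - q \<notin> Q"
    proof
      assume "t * s - q \<in> Q"
      then have "t * s \<in> Q" using idealD(3)[OF Qi _ q(2)] by fastforce
      then show False using prime_mult_notin[OF Q] s t by blast
    qed
    ultimately have "y \<in> M" using Msat[of "t * s - q" y] s t yA by blast
    then show False using y(2) by blast
  qed
  then show False using prime_ideal_pow_sub[OF Q' Qi] QQ by blast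
qed

end

text \<open>Induction on the number of generators; it stands outside the locale because the ring
  changes to the localization at a prime Q just below m. Some generator g lies outside Q. Modulo g,
  powers of the other generators agree with elements of Q, which generate a primary ideal after
  localization: one generator and one prime are removed together.\<close>

theorem height_theorem:
  assumes "noeth_local A m" "set gs \<subseteq> m" "length gs = n" "ideal_pow A m N \<subseteq> lin A gs"
    "\<And>i. i \<le> Suc n \<Longrightarrow> prime_ideal A (P i)" "\<And>i. i \<le> n \<Longrightarrow> P i \<subset> P (Suc i)"
  shows False
  using assms
proof (induction n arbitrary: A m gs P N)
  case 0
  interpret noeth_local A m by fact
  have "mpow N \<subseteq> P 0" using 0 idealD(2)[OF prime_idealD(1)[of A "P 0"]] by auto
  then have "m \<subseteq> P 0" using prime_ideal_pow_sub[OF _ m_ideal] 0 by blast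
  moreover have "P (Suc 0) \<subseteq> m" "P 0 \<subset> P (Suc 0)" using prime_sub_m 0 by auto
  ultimately show ?case by blast
next
  case (Suc n)
  interpret noeth_local A m by fact
  have gsA: "set gs \<subseteq> A" using Suc.prems m_sub by blast
  define \<F> where "\<F> = {Q. prime_ideal A Q \<and> P (Suc n) \<subseteq> Q \<and> Q \<noteq> m}"
  have "P (Suc n) \<in> \<F>"
    unfolding \<F>_def using Suc.prems(5)[of "Suc n"] Suc.prems(6)[of "Suc n"] prime_sub_m[OF Suc.prems(5)[of "Suc (Suc n)"]] by auto
  moreover have "ideal A I" if "I \<in> \<F>" for I using that by (simp add: \<F>_def prime_ideal_def)
  ultimately obtain Q where Q: "Q \<in> \<F>" and mx: "\<forall>L\<in>\<F>. Q \<subseteq> L \<longrightarrow> L = Q"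
    using max_exists[of "P (Suc n)" \<F>] by blast
  have Qp: "prime_ideal A Q" "P (Suc n) \<subseteq> Q" "Q \<noteq> m" using Q by (auto simp: \<F>_def)
  have above: "P' = m" if "prime_ideal A P'" "Q \<subseteq> P'" "Q \<noteq> P'" for P'
    using mx that Qp(2) unfolding \<F>_def by blast
  note Qi = prime_idealD(1)[OF Qp(1)]
  obtain g where g: "g \<in> set gs" "g \<notin> Q"
  proof (rule ccontr)
    assume "\<not> thesis"
    then have "set gs \<subseteq> Q" using that by blast
    then have "mpow N \<subseteq> Q" using Suc.prems(4) lin_least[OF Qi] by blast
    then show False using prime_ideal_pow_sub[OF Qp(1) m_ideal] prime_sub_m[OF Qp(1)] Qp(3) by blast
  qed
  have gm: "g \<in> m" "g \<in> A" using g Suc.prems(2) m_sub by auto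
  have pg: "ideal A (pid A g)" by (rule ideal_pid[OF gm(2)])
  define hs where "hs = remove1 g gs"
  have hs: "length hs = n" "set hs \<subseteq> m"
    using g Suc.prems(2,3) set_remove1_subset[of g gs] by (auto simp: hs_def length_remove1)
  have gs_sub: "set gs \<subseteq> insert g (set hs)" 
  proof
    fix x assume "x \<in> set gs"
    then show "x \<in> insert g (set hs)" unfolding hs_def by (cases "x = g") simp_all
  qed
  obtain M where M: "mpow M \<subseteq> Q + pid A g"
  proof -
    have "\<exists>M. mpow M \<subseteq> Q + pid A g"
    proof (rule only_prime_m[OF ideal_plus[OF Qi pg]])
      fix P' assume P': "prime_ideal A P'" "Q + pid A g \<subseteq> P'"
      then have "Q \<subseteq> P'" "g \<in> P'"
        using plus_sub1[OF pg, of Q] plus_sub2[OF Qi, of "pid A g"] by blast+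
      then show "m \<subseteq> P'" using above[OF P'(1)] g by auto
    qed
    then show ?thesis using that by blast
  qed
  have "\<exists>b\<in>Q. \<exists>c\<in>A. h ^ M = b + c * g" if h: "h \<in> set hs" for h
  proof -
    have "h ^ M \<in> Q + pid A g" using power_pow[OF m_ideal, of h M] h hs(2) M by blast
    then show ?thesis by (rule plus_pidE) blast
  qed
  then obtain b c where bc: "\<And>h. h \<in> set hs \<Longrightarrow> b h \<in> Q \<and> c h \<in> A \<and> h ^ M = b h + c h * g"
    by metis
  define bs where "bs = map b hs"
  define L where "L = localization A Q"
  define E where "E = loc_ext A Q"
  interpret L: noeth_local L "E Q" unfolding L_def E_def by (rule noeth_local_localization[OF Qp(1)])
  have AL: "A \<subseteq> L" unfolding L_def by (rule localization_sub[OF Qp(1)])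
  have QE: "Q \<subseteq> E Q" unfolding E_def by (rule loc_ext_sub[OF Qp(1)])
  have bsQ: "set bs \<subseteq> Q" using bc by (auto simp: bs_def)
  have bsL: "set bs \<subseteq> L" using bsQ QE L.m_sub by blast
  have "\<exists>N. L.mpow N \<subseteq> lin L bs"
  proof (rule L.only_prime_m[OF L.ideal_lin[OF bsL]])
    fix P' assume P': "prime_ideal L P'" "lin L bs \<subseteq> P'"
    note P'i = prime_idealD(1)[OF P'(1)]
    define Q' where "Q' = P' \<inter> A"
    have Q': "prime_ideal A Q'"
      unfolding prime_ideal_def
    proof (intro conjI ballI impI)
      show "ideal A Q'" using P'i AL unfolding Q'_def ideal_def by (auto simp: subset_iff)
      show "Q' \<noteq> A" using L.prime_ideal_one[OF P'(1)] by (auto simp: Q'_def)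
      fix a b assume "a \<in> A" "b \<in> A" "a * b \<in> Q'"
      then show "a \<in> Q' \<or> b \<in> Q'" using prime_idealD(3)[OF P'(1), of a b] AL by (auto simp: Q'_def)
    qed
    have Q'Q: "Q' \<subseteq> Q"
    proof
      fix u assume u: "u \<in> Q'"
      show "u \<in> Q"
      proof (rule ccontr)
        assume n: "u \<notin> Q"
        have uA: "u \<in> A" using u by (auto simp: Q'_def)
        have "inverse u \<in> L" unfolding L_def by (rule localization_inverse[OF Qp(1) uA n])
        then have "inverse u * u \<in> P'" using u by (intro idealD(4)[OF P'i]) (auto simp: Q'_def)
        moreover have "u \<noteq> 0" using notin_prime_nonzero[OF Qp(1) n] .
        ultimately show False using L.prime_ideal_one[OF P'(1)] by simp
      qed
    qed
    have bsQ': "set bs \<subseteq> Q'"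
    proof
      fix u assume u: "u \<in> set bs"
      then have "u \<in> P'" using L.lin_mem[OF bsL u] P'(2) by auto
      moreover have "u \<in> A" using idealD(1)[OF Qi] bsQ u by auto
      ultimately show "u \<in> Q'" by (simp add: Q'_def)
    qed
    \<comment> \<open>If Q' were smaller, every prime over Q' + (g) would contain all of
      \<open>gs\<close> and so be m. Then m is minimal over Q' + (g), while Q lies strictly between
      Q' and m, against the principal ideal theorem.\<close>
    have "Q' = Q"
    proof (rule ccontr)
      assume ne: "Q' \<noteq> Q"
      note Q'i = prime_idealD(1)[OF Q']
      have "\<exists>K. mpow K \<subseteq> Q' + pid A g"
      proof (rule only_prime_m[OF ideal_plus[OF Q'i pg]])
        fix P'' assume P'': "prime_ideal A P''" "Q' + pid A g \<subseteq> P''"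
        note P''i = prime_idealD(1)[OF P''(1)]
        have Q'P: "Q' \<subseteq> P''" "g \<in> P''"
          using P''(2) plus_sub1[OF pg, of Q'] plus_sub2[OF Q'i, of "pid A g"] by blast+
        have "h \<in> P''" if h: "h \<in> set hs" for h
        proof -
          have "b h \<in> P''" using h bsQ' Q'P by (auto simp: bs_def)
          moreover have "c h * g \<in> P''" using idealD(4)[OF P''i _ Q'P(2)] bc[OF h] by blast
          ultimately have "h ^ M \<in> P''" using bc[OF h] idealD(3)[OF P''i] by auto
          then show ?thesis by (rule prime_ideal_power[OF P''(1), rotated]) (use h hs(2) m_sub in auto)
        qed
        then have "set gs \<subseteq> P''" using gs_sub Q'P(2) by auto
        then have "lin A gs \<subseteq> P''" by (rule lin_least[OF P''i])
        then show "m \<subseteq> P''" by (intro prime_ideal_pow_sub[OF P''(1) m_ideal, of N]) (use Suc.prems(4) in auto)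
      qed
      then show False using principal_ideal_theorem[OF Q' Qp(1) _ Qp(3) gm(1)] Q'Q ne by blast
    qed
    show "E Q \<subseteq> P'"
    proof
      fix u assume "u \<in> E Q"
      then obtain a s where h: "a \<in> Q" "s \<in> A" "s \<notin> Q" "u = a / s" unfolding E_def loc_ext_def by blast
      have "inverse s * a \<in> P'"
        using h \<open>Q' = Q\<close> localization_inverse[OF Qp(1) h(2,3)] by (intro idealD(4)[OF P'i]) (auto simp: Q'_def L_def)
      then show "u \<in> P'" using h(4) by (simp add: divide_inverse mult.commute)
    qed
  qed
  then obtain K where K: "L.mpow K \<subseteq> lin L bs" by blast
  have PQ: "P i \<subseteq> Q" if "i \<le> Suc n" for i
  proof -
    have "P i \<subseteq> P (Suc n)" using that
    proof (induction "Suc n - i" arbitrary: i)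
      case (Suc j)
      then have "P (Suc i) \<subseteq> P (Suc n)" "P i \<subset> P (Suc i)" using Suc.prems(1) Suc.hyps \<open>\<And>i. i \<le> Suc n \<Longrightarrow> P i \<subset> P (Suc i)\<close> by auto
      then show ?case by blast
    qed auto
    then show ?thesis using Qp(2) by blast
  qed
  show False
  proof (rule Suc.IH[OF L.noeth_local_axioms _ _ K, of "\<lambda>i. E (P i)"])
    show "set bs \<subseteq> E Q" using bsQ QE by blast
    show "length bs = n" by (simp add: bs_def hs)
    show "prime_ideal L (E (P i))" if "i \<le> Suc n" for i
      unfolding L_def E_def using Suc.prems(5) that by (intro prime_loc_ext Qp PQ) auto
    show "E (P i) \<subset> E (P (Suc i))" if i: "i \<le> n" for i
    proof -
      have "P i \<subset> P (Suc i)" using Suc.prems(6) i by auto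
      moreover from this obtain u where u: "u \<in> P (Suc i)" "u \<notin> P i" by blast
      moreover have "u \<in> A" using u idealD(6)[OF prime_idealD(1)[OF Suc.prems(5)[of "Suc i"]]] i by auto
      moreover have "prime_ideal A (P i)" "P i \<subseteq> Q" using Suc.prems(5) PQ i by auto
      ultimately have "u \<in> E (P (Suc i)) - E (P i)"
        using loc_ext_contract[OF Qp(1), of "P i" u] loc_ext_sub[OF Qp(1)] unfolding E_def by blast
      moreover have "E (P i) \<subseteq> E (P (Suc i))" using \<open>P i \<subset> P (Suc i)\<close> unfolding E_def loc_ext_def by blast
      ultimately show ?thesis by blast
    qed
  qed
qed

section \<open>Leading forms\<close>

context field_subring
begin

lemma power_cong_mod:
  assumes K: "ideal A K" and "a \<in> A" "b \<in> A" "a - b \<in> K"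
  shows "a ^ t - b ^ t \<in> K"
proof (induction t)
  case 0
  then show ?case using idealD(2)[OF K] by simp
next
  case (Suc t)
  have "a * (a ^ t - b ^ t) + b ^ t * (a - b) \<in> K"
    by (rule idealD(3)[OF K idealD(4)[OF K assms(2) Suc] idealD(4)[OF K power_mem[OF assms(3)] assms(4)]])
  then show ?case by (simp add: algebra_simps)
qed

lemma plus_memI: "ideal A K \<Longrightarrow> a - b \<in> K \<Longrightarrow> b \<in> K \<Longrightarrow> a \<in> K"
  using idealD(3)[of A K "a - b" b] by simp

lemma pid_cong_mod:
  assumes I: "ideal A I" and b: "b - b' \<in> I"
  shows "I + pid A b \<subseteq> I + pid A b'"
proof
  fix u assume "u \<in> I + pid A b"
  then obtain i a where h: "i \<in> I" "a \<in> A" "u = i + a * b" by (rule plus_pidE)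
  have "u = (i + a * (b - b')) + a * b'" using h by (simp add: algebra_simps)
  also have "\<dots> \<in> I + pid A b'"
    by (rule plus_pidI[OF idealD(3)[OF I h(1) idealD(4)[OF I h(2) b]] h(2)])
  finally show "u \<in> I + pid A b'" .
qed

end

context noeth_local
begin

lemma mpow_zero [simp, intro]: "0 \<in> mpow n"
  using idealD(2)[OF mpow_ideal] .

lemma m_zero [simp, intro]: "0 \<in> m"
  using idealD(2)[OF m_ideal] .

lemma mpow_le: "u \<in> mpow n \<Longrightarrow> k \<le> n \<Longrightarrow> u \<in> mpow k"
  using mpow_anti by blast

lemma mpow_mult_le: "u \<in> mpow i \<Longrightarrow> v \<in> mpow j \<Longrightarrow> k \<le> i + j \<Longrightarrow> u * v \<in> mpow k"
  using mpow_mult mpow_le by blast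

lemma m_mem_pow: "x \<in> m \<Longrightarrow> x ^ n \<in> mpow n"
  by (rule power_pow[OF m_ideal])

text \<open>\<open>uform xs n u\<close>: modulo \<open>mpow (n + 1)\<close>, the element \<open>u\<close> is a form of degree \<open>n\<close> in \<open>xs\<close> with some
  coefficient outside \<open>m\<close>. The exponents \<open>e\<close> read off successively are those of the lexicographically least
  such monomial, which makes the notion multiplicative. For \<open>s = 0\<close> the truncated \<open>s - 1\<close> is
  harmless, since then \<open>x * h\<close> lies in the error term.\<close>

inductive uform :: "'a list \<Rightarrow> nat \<Rightarrow> 'a \<Rightarrow> bool" where
  uform_Nil: "u \<in> A \<Longrightarrow> u \<notin> m \<Longrightarrow> uform [] 0 u"
| uform_Cons: "uform xs s g \<Longrightarrow> h \<in> mpow (s - 1) \<Longrightarrow> r \<in> mpow (Suc (e + s)) \<Longrightarrow>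
    uform (x # xs) (e + s) (x ^ e * (g + x * h) + r)"

lemma uform_mem: "uform xs n u \<Longrightarrow> set xs \<subseteq> m \<Longrightarrow> u \<in> mpow n"
proof (induction rule: uform.induct)
  case (uform_Nil u)
  then show ?case by simp
next
  case (uform_Cons xs s g h r e x)
  have x: "x \<in> m" using uform_Cons by simp
  have "x * h \<in> mpow s" by (rule mpow_mult_le[of x 1 h "s - 1"]) (use x uform_Cons in auto)
  moreover have "g \<in> mpow s" using uform_Cons by simp
  ultimately have "x ^ e * (g + x * h) \<in> mpow (e + s)"
    by (intro mpow_mult m_mem_pow x mpow_add)
  moreover have "r \<in> mpow (e + s)" using uform_Cons mpow_le by (meson le_SucI order_refl)
  ultimately show ?case by (rule mpow_add)
qed

text \<open>Leading monomials multiply: (g + x h)(g' + x h') is g g' plus a multiple of x, and g g'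
  is covered by induction. At the bottom, a product of elements outside \<open>m\<close> is outside
  \<open>m\<close>, as \<open>m\<close> is prime.\<close>

lemma uform_mult:
  "uform xs n u \<Longrightarrow> set xs \<subseteq> m \<Longrightarrow> uform xs k v \<Longrightarrow> uform xs (n + k) (u * v)"
proof (induction arbitrary: k v rule: uform.induct)
  case (uform_Nil u)
  from uform_Nil(4) have "k = 0" "v \<in> A" "v \<notin> m" by (cases; simp)+
  then show ?case using uform_Nil(1,2) prime_mult_notin[OF prime_m] uform.uform_Nil[of "u * v"] by auto
next
  case (uform_Cons xs s g h r e x)
  from uform_Cons(6) obtain s' g' h' r' e' where
    v: "k = e' + s'" "v = x ^ e' * (g' + x * h') + r'" and u': "uform xs s' g'"
      "h' \<in> mpow (s' - 1)" "r' \<in> mpow (Suc (e' + s'))" by (cases) blast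
  have x: "x \<in> m" and xs: "set xs \<subseteq> m" using uform_Cons.prems by auto
  have g: "g \<in> mpow s" "g' \<in> mpow s'" using uform_mem uform_Cons u' xs by auto
  have xh: "x * h \<in> mpow s" by (rule mpow_mult_le[of x 1 h "s - 1"]) (use x uform_Cons in auto)
  have vm: "v \<in> mpow (e' + s')" using uform_mem[OF uform_Cons(6) uform_Cons(5)] v by simp
  define H where "H = h * g' + g * h' + x * (h * h')"
  define R where "R = x ^ e * (g + x * h) * r' + r * v"
  have "h * g' \<in> mpow (s + s' - 1)" by (rule mpow_mult_le[of h "s - 1" g' s']) (use uform_Cons g in auto)
  moreover have "g * h' \<in> mpow (s + s' - 1)" by (rule mpow_mult_le[of g s h' "s' - 1"]) (use u' g in auto)
  moreover have "x * (h * h') \<in> mpow (s + s' - 1)"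
    by (rule mpow_mult_le[of x 1 _ "(s - 1) + (s' - 1)"]) (use x uform_Cons u' in \<open>auto intro: mpow_mult\<close>)
  ultimately have H: "H \<in> mpow (s + s' - 1)" unfolding H_def by (intro mpow_add)
  have "x ^ e * (g + x * h) \<in> mpow (e + s)" by (intro mpow_mult m_mem_pow x mpow_add g xh)
  then have "x ^ e * (g + x * h) * r' \<in> mpow (Suc ((e + e') + (s + s')))"
    by (rule mpow_mult_le[OF _ u'(3)]) simp
  moreover have "r * v \<in> mpow (Suc ((e + e') + (s + s')))"
    by (rule mpow_mult_le[OF uform_Cons(3) vm]) simp
  ultimately have R: "R \<in> mpow (Suc ((e + e') + (s + s')))" unfolding R_def by (rule mpow_add)
  have "uform (x # xs) ((e + e') + (s + s')) (x ^ (e + e') * (g * g' + x * H) + R)"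
    by (rule uform.uform_Cons[OF _ H R]) (rule uform_Cons(4)[OF xs u'(1)])
  moreover have "(x ^ e * (g + x * h) + r) * v = x ^ (e + e') * (g * g' + x * H) + R"
    unfolding R_def H_def v(2) by (simp add: algebra_simps power_add)
  moreover have "(e + e') + (s + s') = e + s + k" using v by simp
  ultimately show ?case by simp
qed

lemma uform_unit: "u \<in> A \<Longrightarrow> u \<notin> m \<Longrightarrow> uform xs 0 u"
proof (induction xs)
  case (Cons x xs)
  then show ?case using uform_Cons[of xs 0 u 0 0 0 x] by simp
qed (simp add: uform_Nil)

lemma uform_0: "uform xs n u \<Longrightarrow> n = 0 \<Longrightarrow> set xs \<subseteq> m \<Longrightarrow> u \<in> A \<and> u \<notin> m"
proof (induction rule: uform.induct)
  case (uform_Cons xs s g h r e x)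
  have g: "g \<in> A" "g \<notin> m" using uform_Cons by auto
  have r: "x * h + r \<in> m"
    using uform_Cons by (intro idealD(3)[OF m_ideal] idealD(5)[OF m_ideal]) auto
  have "g + (x * h + r) \<notin> m"
  proof
    assume "g + (x * h + r) \<in> m"
    then have "g \<in> m" using ideal_diff[OF m_ideal _ r] by fastforce
    then show False using g by simp
  qed
  moreover have "g + (x * h + r) \<in> A" using g r m_sub by auto
  ultimately show ?case using uform_Cons by (simp add: add.assoc)
qed simp

text \<open>Either all coefficients of a form lie in \<open>m\<close>, and the form drops into the
  next power, or some coefficient does not. If the part free of \<open>x\<close> has no such
  coefficient it joins the error term, and one factor \<open>x\<close> is moved into the
  exponent.\<close>

lemma uform_pw: "set xs \<subseteq> m \<Longrightarrow> u \<in> pw xs n \<Longrightarrow> u \<in> mpow (Suc n) \<or> uform xs n u"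
proof (induction xs n arbitrary: u rule: pw.induct)
  case (1 xs)
  then show ?case using uform_unit[of u xs] by auto
next
  case (2 n)
  then show ?case by auto
next
  case (3 x xs n)
  obtain g h where gh: "g \<in> pw xs (Suc n)" "h \<in> pw (x # xs) n" "u = g + x * h"
    using 3(4) by (auto elim: plusE)
  have x: "x \<in> m" and xs: "set xs \<subseteq> m" using 3(3) by auto
  show ?case
  proof (cases "uform xs (Suc n) g")
    case True
    have "h \<in> mpow n" using pw_sub[OF 3(3)] gh(2) by blast
    then show ?thesis using uform_Cons[OF True, of h 0 0 x] gh(3) by simp
  next
    case False
    then have g: "g \<in> mpow (Suc (Suc n))" using 3(1)[OF xs gh(1)] by simp
    from 3(2)[OF 3(3) gh(2)] show ?thesis
    proof
      assume "h \<in> mpow (Suc n)"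
      then have "x * h \<in> mpow (Suc (Suc n))" by (rule ideal_pow_Suc_mem[OF m_ideal x])
      then show ?thesis using mpow_add[OF g] gh(3) by simp
    next
      assume "uform (x # xs) n h"
      then obtain e s g' h' r' where h: "n = e + s" "h = x ^ e * (g' + x * h') + r'" "uform xs s g'"
        "h' \<in> mpow (s - 1)" "r' \<in> mpow (Suc (e + s))" by cases blast
      have "x * r' + g \<in> mpow (Suc (Suc e + s))"
        using mpow_add[OF ideal_pow_Suc_mem[OF m_ideal x h(5)]] g h(1) by simp
      then have "uform (x # xs) (Suc e + s) (x ^ Suc e * (g' + x * h') + (x * r' + g))"
        by (rule uform_Cons[OF h(3,4)])
      moreover have "x ^ Suc e * (g' + x * h') + (x * r' + g) = u"
        unfolding gh(3) h(2) by (simp add: algebra_simps)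
      ultimately show ?thesis using h(1) by simp
    qed
  qed
qed

lemma power_cong_mpow:
  assumes "w \<in> mpow n" "r \<in> mpow (Suc n)"
  shows "(w + r) ^ t - w ^ t \<in> mpow (Suc (n * t))"
proof (induction t)
  case (Suc t)
  have "w + r \<in> mpow n" using mpow_add[OF assms(1) mpow_le[OF assms(2)]] by simp
  then have "(w + r) * ((w + r) ^ t - w ^ t) \<in> mpow (Suc (n * Suc t))"
    by (rule mpow_mult_le[OF _ Suc]) simp
  moreover have "r * w ^ t \<in> mpow (Suc (n * Suc t))"
    by (rule mpow_mult_le[OF assms(2) power_pow_mult[OF m_sub assms(1)]]) simp
  ultimately have "(w + r) * ((w + r) ^ t - w ^ t) + r * w ^ t \<in> mpow (Suc (n * Suc t))" by (rule mpow_add)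
  then show ?case by (simp add: algebra_simps)
qed simp

text \<open>The element \<open>x ^ s + g + x * h\<close> adjoined below meets both factors of the form
  \<open>x ^ e * (g + x * h)\<close> properly, so no infinite residue field is needed.\<close>

lemma uform_nilpotent:
  "uform ys n u \<Longrightarrow> ys \<noteq> [] \<Longrightarrow> set ys \<subseteq> m \<Longrightarrow>
    \<exists>gs. length gs = length ys - 1 \<and> set gs \<subseteq> m \<and>
      (\<forall>J t. ideal A J \<longrightarrow> set gs \<subseteq> J \<longrightarrow> u ^ t \<in> J + mpow (Suc (n * t)) \<longrightarrow>
        (\<forall>y\<in>set ys. \<exists>k. y ^ k \<in> J + mpow (Suc k)))"
proof (induction rule: uform.induct)
  case (uform_Cons xs s g h r e x)
  have x: "x \<in> m" and xs: "set xs \<subseteq> m" and xA: "x \<in> A" using uform_Cons.prems m_sub by auto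
  have g: "g \<in> mpow s" by (rule uform_mem[OF uform_Cons(1) xs])
  have xh: "x * h \<in> mpow s" by (rule mpow_mult_le[of x 1 h "s - 1"]) (use x uform_Cons in auto)
  define F where "F = g + x * h"
  have F: "F \<in> mpow s" unfolding F_def by (rule mpow_add[OF g xh])
  have w: "x ^ e * F \<in> mpow (e + s)" by (rule mpow_mult[OF m_mem_pow[OF x] F])
  have red: "(x ^ e * F) ^ t \<in> J + mpow (Suc ((e + s) * t))"
    if J: "ideal A J" and t: "(x ^ e * (g + x * h) + r) ^ t \<in> J + mpow (Suc ((e + s) * t))" for J t
  proof -
    have idJ: "ideal A (J + mpow (Suc ((e + s) * t)))" by (rule ideal_plus[OF J mpow_ideal])
    have "(x ^ e * F + r) ^ t - (x ^ e * F) ^ t \<in> mpow (Suc ((e + s) * t))"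
      by (rule power_cong_mpow[OF w uform_Cons(3)])
    then have "(x ^ e * F + r) ^ t - (x ^ e * F) ^ t \<in> J + mpow (Suc ((e + s) * t))"
      using plus_sub2[OF J] by blast
    then show ?thesis using ideal_diff[OF idJ t] unfolding F_def by fastforce
  qed
  show ?case
  proof (cases s)
    \<comment> \<open>Here \<open>F\<close> is a unit, so a power of u is a unit times a power of x
      up to the error. The remaining parameters \<open>xs\<close> serve as
      \<open>gs\<close>.\<close>
    case 0
    have gu: "g \<in> A" "g \<notin> m" using uform_0[OF uform_Cons(1) 0 xs] by auto
    have "x * h \<in> m" using x uform_Cons(2) by (intro idealD(5)[OF m_ideal]) (auto simp: 0)
    then have Fu: "F \<in> A" "F \<notin> m" using F gu ideal_diff[OF m_ideal, of F "x * h"] by (auto simp: F_def 0)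
    have F0: "F \<noteq> 0" using Fu idealD(2)[OF m_ideal] by auto
    have "\<exists>k. y ^ k \<in> J + mpow (Suc k)" if J: "ideal A J" "set xs \<subseteq> J"
        and t: "(x ^ e * (g + x * h) + r) ^ t \<in> J + mpow (Suc ((e + s) * t))" and y: "y \<in> set (x # xs)" for J t y
    proof (cases "y = x")
      case True
      have "inverse F ^ t * (x ^ e * F) ^ t \<in> J + mpow (Suc ((e + s) * t))"
        by (rule idealD(4)[OF ideal_plus[OF J(1) mpow_ideal] power_mem[OF unit[OF Fu]] red[OF J(1) t]])
      moreover have "inverse F ^ t * (x ^ e * F) ^ t = x ^ (e * t)"
      proof -
        have "inverse F * (x ^ e * F) = x ^ e" using F0 by simp
        then show ?thesis by (metis power_mult power_mult_distrib)
      qed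
      ultimately show ?thesis using True 0 by auto
    next
      case False
      then have "y ^ 1 \<in> J" using y J by auto
      then show ?thesis using plus_sub1[OF mpow_ideal, of J] by blast
    qed
    then show ?thesis using xs by (intro exI[of _ xs]) auto
  next
    case (Suc s')
    have ne: "xs \<noteq> []" using uform_Cons(1) Suc by (auto elim: uform.cases)
    from uform_Cons(4)[OF ne xs] obtain gs where gs: "length gs = length xs - 1" "set gs \<subseteq> m" and
      IH: "\<forall>J t. ideal A J \<longrightarrow> set gs \<subseteq> J \<longrightarrow> g ^ t \<in> J + mpow (Suc (s * t)) \<longrightarrow>
        (\<forall>y\<in>set xs. \<exists>k. y ^ k \<in> J + mpow (Suc k))" by (elim exE conjE) (rule that)
    have "mpow s \<subseteq> m" using mpow_anti[of 1 s] Suc by simp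
    then have newm: "x ^ s + F \<in> m" by (intro idealD(3)[OF m_ideal]) (use m_mem_pow[OF x, of s] F in auto)
    have "\<exists>k. y ^ k \<in> J + mpow (Suc k)" if J: "ideal A J" "set ((x ^ s + F) # gs) \<subseteq> J"
        and t: "(x ^ e * (g + x * h) + r) ^ t \<in> J + mpow (Suc ((e + s) * t))" and y: "y \<in> set (x # xs)" for J t y
    proof -
      define T where "T = (e + s) * t"
      have idJ: "ideal A (J + mpow i)" for i by (rule ideal_plus[OF J(1) mpow_ideal])
      have JJ: "J \<subseteq> J + mpow i" for i by (rule plus_sub1[OF mpow_ideal])
      have xsF: "x ^ s + F \<in> J" using J(2) by simp
      have FA: "F \<in> A" "g \<in> A" "h \<in> A" using F g uform_Cons(2) mpow_A by auto
      \<comment> \<open>Modulo \<open>J\<close> the adjoined generator turns F into -x^s, hence x^e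
        F into -x^(e+s). The hypothesis on u thus becomes smallness of the power x^T.\<close>
      have "x ^ e * F - (- (x ^ (e + s))) = x ^ e * (x ^ s + F)" by (simp add: algebra_simps power_add)
      also have "\<dots> \<in> J" by (rule idealD(4)[OF J(1) power_mem[OF xA] xsF])
      finally have "(x ^ e * F) ^ t - (- (x ^ (e + s))) ^ t \<in> J"
        by (intro power_cong_mod[OF J(1)]) (use xA FA in auto)
      then have "(- (x ^ (e + s))) ^ t \<in> J + mpow (Suc T)"
        using ideal_diff[OF idJ red[OF J(1) t]] JJ unfolding T_def by fastforce
      then have "(- 1) ^ t * (- (x ^ (e + s))) ^ t \<in> J + mpow (Suc T)"
        by (intro idealD(4)[OF idJ]) auto
      then have xT: "x ^ T \<in> J + mpow (Suc T)"
        by (simp add: T_def power_mult flip: power_mult_distrib)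
      \<comment> \<open>The same congruence reads g = -x c modulo \<open>J\<close>, with c in
        m^(s-1). Smallness therefore passes from x^T to g^T, and the induction hypothesis treats the
        parameters in \<open>xs\<close>.\<close>
      define c where "c = x ^ s' + h"
      have c: "c \<in> mpow s'" unfolding c_def using mpow_add[OF m_mem_pow[OF x]] uform_Cons(2) Suc by auto
      have "x ^ T * c ^ T \<in> J + mpow (Suc T + s' * T)"
        by (rule plus_mult(1)[OF J(1) xT power_pow_mult[OF m_sub c]])
      then have "(- 1) ^ T * (x ^ T * c ^ T) \<in> J + mpow (Suc (s * T))"
        by (intro idealD(4)[OF idJ, of "(- 1) ^ T" "x ^ T * c ^ T"]) (use Suc in auto)
      then have m1: "(- (x * c)) ^ T \<in> J + mpow (Suc (s * T))"
        by (metis mult_minus1 power_mult_distrib)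
      have "g - (- (x * c)) = x ^ s + F" using Suc by (simp add: c_def F_def algebra_simps)
      then have "g ^ T - (- (x * c)) ^ T \<in> J"
        using xsF by (intro power_cong_mod[OF J(1)]) (use FA xA mpow_A[OF c] in auto)
      then have "g ^ T \<in> J + mpow (Suc (s * T))"
        using JJ plus_memI[OF idJ _ m1] by blast
      then show ?thesis
        using IH[rule_format, OF J(1), of T y] J(2) xT y by auto
    qed
    then show ?thesis
      using gs newm ne by (intro exI[of _ "(x ^ s + F) # gs"]) auto
  qed
qed simp

lemma pw_append: "set (js @ ys) \<subseteq> A \<Longrightarrow> pw (js @ ys) n \<subseteq> lin A js + pw ys n"
proof (induction js arbitrary: n)
  case (Cons x js)
  have x: "x \<in> A" "set js \<subseteq> A" "set (js @ ys) \<subseteq> A" using Cons.prems by auto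
  show ?case
  proof (cases n)
    case 0
    then show ?thesis using plus_sub2[OF ideal_lin, of "x # js" A] x by auto
  next
    case (Suc k)
    show ?thesis
    proof
      fix u assume "u \<in> pw ((x # js) @ ys) n"
      then obtain g h where gh: "g \<in> pw (js @ ys) n" "h \<in> pw (x # js @ ys) k" "u = g + x * h"
        using Suc by (auto elim: plusE)
      have hA: "h \<in> A" using idealD(6)[OF ideal_pw gh(2)] Cons.prems by simp
      have "g \<in> lin A js + pw ys n" using Cons.IH[OF x(3)] gh(1) by blast
      then obtain i w where iw: "i \<in> lin A js" "w \<in> pw ys n" "g = i + w" by (rule plusE)
      have "h * x + i \<in> lin A (x # js)" using iw hA by (auto simp: mem_pid intro!: plusI)
      then have "(h * x + i) + w \<in> lin A (x # js) + pw ys n" using iw(2) by (rule plusI)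
      then show "u \<in> lin A (x # js) + pw ys n" by (simp add: gh iw algebra_simps)
    qed
  qed
qed simp

text \<open>Exchange step for parameters: if all coefficients of x were in \<open>m\<close>, then x
  would lie in m^2; otherwise a generator with unit coefficient can be traded for x.\<close>

lemma lin_split:
  assumes "set xs \<subseteq> m" "x \<in> lin A xs"
  shows "x \<in> mpow 2 \<or> (\<exists>ps y qs c. xs = ps @ y # qs \<and> c \<in> A \<and> c \<notin> m \<and> x - c * y \<in> lin A (ps @ qs))"
  using assms
proof (induction xs arbitrary: x)
  case (Cons y ys)
  obtain a u where au: "a \<in> A" "u \<in> lin A ys" "x = a * y + u"
    using Cons.prems(2) by (auto elim!: plusE simp: mem_pid)
  show ?case
  proof (cases "a \<in> m")
    case False
    then have "y # ys = [] @ y # ys \<and> a \<in> A \<and> a \<notin> m \<and> x - a * y \<in> lin A ([] @ ys)" using au by simp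
    then show ?thesis by blast
  next
    case True
    have "a * y \<in> mpow 2" using ideal_pow_Suc_mem[OF m_ideal True, of y 1] Cons.prems by (simp add: numeral_2_eq_2)
    from Cons.IH[OF _ au(2)] Cons.prems(1) have "u \<in> mpow 2 \<or> (\<exists>ps z qs c. ys = ps @ z # qs \<and> c \<in> A \<and> c \<notin> m \<and> u - c * z \<in> lin A (ps @ qs))" by simp
    then show ?thesis
    proof
      assume "u \<in> mpow 2"
      then show ?thesis using mpow_add[OF \<open>a * y \<in> mpow 2\<close>] au by simp
    next
      assume "\<exists>ps z qs c. ys = ps @ z # qs \<and> c \<in> A \<and> c \<notin> m \<and> u - c * z \<in> lin A (ps @ qs)"
      then obtain ps z qs c where h: "ys = ps @ z # qs" "c \<in> A" "c \<notin> m" "u - c * z \<in> lin A (ps @ qs)" by blast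
      have "a * y + (u - c * z) \<in> lin A ((y # ps) @ qs)"
        using h(4) au(1) by (auto simp: mem_pid intro!: plusI)
      moreover have "a * y + (u - c * z) = x - c * z" using au by simp
      ultimately have "y # ys = (y # ps) @ z # qs \<and> c \<in> A \<and> c \<notin> m \<and> x - c * z \<in> lin A ((y # ps) @ qs)"
        using h by simp
      then show ?thesis by blast
    qed
  qed
qed auto

end

section \<open>Regular local rings\<close>

text \<open>Regularity in the form in which it is applied: the same number \<open>d\<close> bounds
  the generators of \<open>m\<close> and is the length of a chain of primes.
  \<open>max_ideal_eq\<close> links \<open>m\<close> with the definition of
  \<open>ord\<close>.\<close>

locale reg_local = noeth_local A m for A m :: "'a::field set" +
  fixes d :: nat
  assumes max_ideal_eq: "max_ideal A = m"
    and gens: "\<exists>xs. set xs \<subseteq> m \<and> length xs = d \<and> lin A xs = m"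
    and chain: "\<exists>P. (\<forall>i\<le>d. prime_ideal A (P i)) \<and> (\<forall>i<d. P i \<subset> P (Suc i))"
    and qf: "quotient_field_is_F A"

lemma noeth_local_max_ideal:
  assumes "noetherian A" "local_ring A"
  shows "noeth_local A (max_ideal A)"
proof -
  interpret noetherian_subring A using assms by unfold_locales (auto simp: noetherian_def)
  have ex1: "\<exists>!M. maximal_ideal A M" using assms by (simp add: local_ring_def)
  have mm: "maximal_ideal A (max_ideal A)" unfolding max_ideal_def by (rule theI'[OF ex1])
  have un: "M = max_ideal A" if "maximal_ideal A M" for M using ex1 mm that by blast
  have mi: "ideal A (max_ideal A)" "max_ideal A \<noteq> A" using mm by (auto simp: maximal_ideal_def)
  show ?thesis
  proof
    show "ideal A (max_ideal A)" by fact
    show "1 \<notin> max_ideal A" using ideal_one[OF mi(1)] mi(2) by simp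
    fix a assume a: "a \<in> A" "a \<notin> max_ideal A"
    have "pid A a = A"
    proof (rule ccontr)
      assume ne: "pid A a \<noteq> A"
      define \<F> where "\<F> = {I. ideal A I \<and> pid A a \<subseteq> I \<and> I \<noteq> A}"
      have "pid A a \<in> \<F>" using ne ideal_pid[OF a(1)] by (simp add: \<F>_def)
      moreover have "ideal A I" if "I \<in> \<F>" for I using that by (simp add: \<F>_def)
      ultimately obtain M where M: "M \<in> \<F>" and mx: "\<forall>I\<in>\<F>. M \<subseteq> I \<longrightarrow> I = M"
        using max_exists[of "pid A a" \<F>] by blast
      have "maximal_ideal A M"
        unfolding maximal_ideal_def
      proof (intro conjI allI impI)
        show "ideal A M" "M \<noteq> A" using M by (auto simp: \<F>_def)
        fix J assume "ideal A J \<and> M \<subseteq> J"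
        then show "J = M \<or> J = A" using mx M by (auto simp: \<F>_def)
      qed
      then have "M = max_ideal A" by (rule un)
      then show False using a M pid_mem[of a] by (auto simp: \<F>_def)
    qed
    then have "1 \<in> pid A a" by simp
    then obtain c where "c \<in> A" "1 = c * a" by (auto simp: mem_pid)
    then show "inverse a \<in> A" by (metis inverse_unique mult.commute)
  qed
qed

lemma reg_localI:
  assumes reg: "regular_local_ring A" and dim: "krull_dim A \<ge> 2" and qf: "quotient_field_is_F A"
  shows "reg_local A (max_ideal A) (emb_dim A)"
proof -
  have A: "noetherian A" "local_ring A" and kd: "krull_dim A = enat (emb_dim A)"
    using reg by (auto simp: regular_local_ring_def)
  interpret noeth_local A "max_ideal A" by (rule noeth_local_max_ideal[OF A])
  have "\<exists>n X. finite X \<and> card X = n \<and> ideal_gen A X = max_ideal A"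
    using noetherian m_ideal by (auto simp: noetherian_def)
  then have "\<exists>X. finite X \<and> card X = emb_dim A \<and> ideal_gen A X = max_ideal A"
    unfolding emb_dim_def by (rule LeastI_ex)
  then obtain X where X: "finite X" "card X = emb_dim A" "ideal_gen A X = max_ideal A" by blast
  then obtain xs where xs: "set xs = X" "distinct xs" using finite_distinct_list by blast
  have Xm: "X \<subseteq> max_ideal A" using ideal_gen_sub[of X] X(3) by simp
  have 1: "set xs \<subseteq> max_ideal A \<and> length xs = emb_dim A \<and> lin A xs = max_ideal A"
    using xs X Xm lin_gen[of xs] m_sub distinct_card[OF xs(2)] by auto
  let ?S = "{enat n | n. \<exists>P :: nat \<Rightarrow> 'a set. (\<forall>i\<le>n. prime_ideal A (P i)) \<and> (\<forall>i<n. P i \<subset> P (Suc i))}"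
  have S: "Sup ?S = enat (emb_dim A)" using kd by (simp add: krull_dim_def)
  have ne: "?S \<noteq> {}"
  proof
    assume "?S = {}"
    then have "krull_dim A = 0" unfolding krull_dim_def by (simp only: Sup_empty bot_enat_def)
    then show False using dim by simp
  qed
  \<comment> \<open>An infinite set of type \<open>enat\<close> has supremum infinity, so finite
    dimension makes the set of chain lengths finite and the supremum is attained by a chain.\<close>
  then have "finite ?S" using S unfolding Sup_enat_def by (metis (no_types, lifting) enat.simps(3) infinity_ne_i0)
  then have "Sup ?S = Max ?S" using ne by (simp only: Sup_enat_def if_False if_True)
  moreover have "Max ?S \<in> ?S" by (rule Max_in[OF \<open>finite ?S\<close> ne])
  ultimately have "Sup ?S \<in> ?S" by argo
  then have 2: "\<exists>P. (\<forall>i\<le>emb_dim A. prime_ideal A (P i)) \<and> (\<forall>i<emb_dim A. P i \<subset> P (Suc i))"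
    unfolding S by auto
  show ?thesis by unfold_locales (use 1 2 qf in auto)
qed

section \<open>Independence of parameters, the order valuation and normality\<close>

context reg_local
begin

definition params :: "'a list \<Rightarrow> bool" where
  "params xs \<longleftrightarrow> set xs \<subseteq> m \<and> length xs = d \<and> lin A xs = m"

lemma paramsD: "params xs \<Longrightarrow> set xs \<subseteq> m" "params xs \<Longrightarrow> length xs = d" "params xs \<Longrightarrow> lin A xs = m"
  "params xs \<Longrightarrow> set xs \<subseteq> A"
  using m_sub by (auto simp: params_def)

lemma not_primary_short:
  assumes gs: "set gs \<subseteq> m" "length gs < d" and N: "mpow N \<subseteq> lin A gs"
  shows False
proof -
  obtain P where P: "\<forall>i\<le>d. prime_ideal A (P i)" "\<forall>i<d. P i \<subset> P (Suc i)" using chain by blast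
  show False
    by (rule height_theorem[OF noeth_local_axioms gs(1) refl N, of P]) (use P gs(2) in auto)
qed

text \<open>The graded ring of A modulo \<open>js\<close> is a polynomial ring in \<open>ys\<close>:
  a form with a coefficient outside \<open>m\<close> that vanishes there would, by
  \<open>uform_nilpotent\<close>, leave fewer than \<open>d\<close> elements generating an ideal
  that contains a power of \<open>m\<close>.\<close>

lemma uform_independent:
  assumes p: "params (js @ ys)" and u: "uform ys n u" "u \<in> lin A js + mpow (Suc n)"
  shows False
proof (cases "ys = []")
  case True
  then have "n = 0" "u \<notin> m" using u(1) by (auto elim: uform.cases)
  moreover have "lin A js + m \<subseteq> m"
    by (rule plus_least[OF m_ideal lin_least[OF m_ideal]]) (use paramsD(1)[OF p] in auto)
  ultimately show False using u(2) by auto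
next
  case False
  have ys: "set ys \<subseteq> m" "set js \<subseteq> m" using paramsD(1)[OF p] by auto
  from uform_nilpotent[OF u(1) False ys(1)] obtain gs where gs: "length gs = length ys - 1" "set gs \<subseteq> m"
    and nil: "\<forall>J t. ideal A J \<longrightarrow> set gs \<subseteq> J \<longrightarrow> u ^ t \<in> J + mpow (Suc (n * t)) \<longrightarrow>
        (\<forall>y\<in>set ys. \<exists>k. y ^ k \<in> J + mpow (Suc k))" by (elim exE conjE) (rule that)
  define J where "J = lin A (js @ gs)"
  have jg: "set (js @ gs) \<subseteq> A" using ys gs m_sub by auto
  have J: "ideal A J" unfolding J_def by (rule ideal_lin[OF jg])
  have sub: "set (js @ gs) \<subseteq> J" unfolding J_def using lin_mem[OF jg] by blast
  have "lin A js \<subseteq> J" by (rule lin_least[OF J]) (use sub in auto)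
  then have "u ^ 1 \<in> J + mpow (Suc (n * 1))" using u(2) set_plus_mono2[of "lin A js" J] by auto
  then have nil': "\<exists>k. y ^ k \<in> J + mpow (Suc k)" if "y \<in> set ys" for y
    using nil[rule_format, OF J, of 1] sub that by auto
  have "\<exists>N. mpow N \<subseteq> J"
  proof (rule nilpotent_gens[OF J paramsD(4)[OF p] paramsD(3)[OF p]])
    fix x assume "x \<in> set (js @ ys)"
    then consider "x \<in> set ys" | "x \<in> set js" by auto
    then show "\<exists>k. x ^ k \<in> J + mpow (Suc k)"
    proof cases
      case 1
      then show ?thesis by (rule nil')
    next
      case 2
      then have "x ^ 1 \<in> J" using sub by auto
      then show ?thesis using plus_sub1[OF mpow_ideal, of J] by blast
    qed
  qed
  then obtain N where "mpow N \<subseteq> lin A (js @ gs)" unfolding J_def by blast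
  moreover have "length (js @ gs) < d" using gs(1) paramsD(2)[OF p] False by (cases ys) auto
  ultimately show False using not_primary_short[of "js @ gs"] ys gs by auto
qed

text \<open>By Krull's intersection theorem there is a last n with f in I + m^n, where I is the
  ideal of \<open>js\<close>; the part of f of that degree is its leading form modulo I.\<close>

lemma uform_rep:
  assumes p: "params (js @ ys)" and f: "f \<in> A" "f \<notin> lin A js"
  shows "\<exists>n g. uform ys n g \<and> f - g \<in> lin A js"
proof -
  let ?I = "lin A js"
  have js: "set js \<subseteq> A" "set ys \<subseteq> m" using paramsD(1,4)[OF p] by auto
  have I: "ideal A ?I" by (rule ideal_lin[OF js(1)])
  have ex: "\<exists>N. f \<notin> ?I + mpow N" using Krull_intersection[OF I] f(2) by blast
  define N where "N = (LEAST N. f \<notin> ?I + mpow N)"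
  have N: "f \<notin> ?I + mpow N" unfolding N_def by (rule LeastI_ex[OF ex])
  have "f \<in> ?I + mpow 0" using plus_sub2[OF I, of A] f by auto
  then obtain n where n: "N = Suc n" using N by (cases N) auto
  have "f \<in> ?I + mpow n" using not_less_Least[of n "\<lambda>N. f \<notin> ?I + mpow N"] n by (auto simp: N_def)
  then obtain i w where iw: "i \<in> ?I" "w \<in> mpow n" "f = i + w" by (rule plusE)
  have "w \<in> ?I + pw ys n"
    using iw(2) mpow_eq_pw[OF paramsD(4)[OF p] paramsD(3)[OF p]] pw_append[OF paramsD(4)[OF p]] by blast
  then obtain j g where jg: "j \<in> ?I" "g \<in> pw ys n" "w = j + g" by (rule plusE)
  have ij: "i + j \<in> ?I" by (rule idealD(3)[OF I iw(1) jg(1)])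
  from uform_pw[OF js(2) jg(2)] have "uform ys n g"
  proof
    assume "g \<in> mpow (Suc n)"
    then have "(i + j) + g \<in> ?I + mpow (Suc n)" by (rule plusI[OF ij])
    then show ?thesis using N n iw jg by (simp add: add.assoc)
  qed
  moreover have "f - g \<in> ?I" using iw jg ij by simp
  ultimately show ?thesis by blast
qed

text \<open>Two elements outside the ideal have leading forms modulo it, and the product of these
  forms is nonzero by independence.\<close>

lemma prime_params:
  assumes p: "params (js @ ys)"
  shows "prime_ideal A (lin A js)"
proof -
  let ?I = "lin A js"
  have js: "set js \<subseteq> A" "set js \<subseteq> m" "set ys \<subseteq> m" using paramsD(1,4)[OF p] by auto
  have I: "ideal A ?I" by (rule ideal_lin[OF js(1)])
  show ?thesis
    unfolding prime_ideal_def
  proof (intro conjI ballI impI I)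
    show "?I \<noteq> A" using lin_least[OF m_ideal js(2)] one_notin by blast
    fix a b assume ab: "a \<in> A" "b \<in> A" "a * b \<in> ?I"
    show "a \<in> ?I \<or> b \<in> ?I"
    proof (rule ccontr)
      assume "\<not> ?thesis"
      then obtain n g k h where gh: "uform ys n g" "a - g \<in> ?I" "uform ys k h" "b - h \<in> ?I"
        using uform_rep[OF p ab(1)] uform_rep[OF p ab(2)] by blast
      have A: "g \<in> A" "h \<in> A" using uform_mem[OF gh(1) js(3)] uform_mem[OF gh(3) js(3)] mpow_A by auto
      have "b * (a - g) + g * (b - h) \<in> ?I"
        by (rule idealD(3)[OF I idealD(4)[OF I ab(2) gh(2)] idealD(4)[OF I A(1) gh(4)]])
      then have "a * b - g * h \<in> ?I" by (simp add: algebra_simps)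
      then have "g * h \<in> ?I" using ideal_diff[OF I ab(3)] by fastforce
      then have "g * h \<in> ?I + mpow (Suc (n + k))" using plus_sub1[OF mpow_ideal, of ?I] by blast
      then show False using uform_independent[OF p uform_mult[OF gh(1) js(3) gh(3)]] by blast
    qed
  qed
qed

lemma mpow_exact_mult:
  assumes u: "u \<in> mpow n" "u \<notin> mpow (Suc n)" and v: "v \<in> mpow k" "v \<notin> mpow (Suc k)"
  shows "u * v \<notin> mpow (Suc (n + k))"
proof
  assume uv: "u * v \<in> mpow (Suc (n + k))"
  obtain xs where p: "params xs" using gens by (auto simp: params_def)
  have eq: "mpow i = pw xs i" for i by (rule mpow_eq_pw[OF paramsD(4)[OF p] paramsD(3)[OF p]])
  have "uform xs n u" "uform xs k v" using uform_pw[OF paramsD(1)[OF p]] u v eq by blast+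
  then have "uform xs (n + k) (u * v)" by (rule uform_mult[OF _ paramsD(1)[OF p]])
  then show False using uform_independent[of "[]" xs] p uv by simp
qed

lemma ord_mem:
  assumes u: "u \<in> A" "u \<noteq> 0"
  shows "u \<in> mpow (ord A u)" "u \<notin> mpow (Suc (ord A u))"
proof -
  obtain N where N: "u \<notin> mpow N" using Krull_zero[of u] u by blast
  have bd: "\<forall>n. u \<in> mpow n \<longrightarrow> n \<le> N" using N mpow_le nat_le_linear by blast
  have 0: "u \<in> mpow 0" using u by simp
  have "ord A u = (GREATEST n. u \<in> mpow n)" by (simp add: ord_def max_ideal_eq)
  then show "u \<in> mpow (ord A u)" "u \<notin> mpow (Suc (ord A u))"
    using GreatestI_nat[of "\<lambda>n. u \<in> mpow n", OF 0] Greatest_le_nat[of "\<lambda>n. u \<in> mpow n" "Suc (ord A u)" N] bd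
    by auto
qed

lemma ord_le_iff: "u \<in> A \<Longrightarrow> u \<noteq> 0 \<Longrightarrow> n \<le> ord A u \<longleftrightarrow> u \<in> mpow n"
  using ord_mem mpow_le by (meson not_less_eq_eq)

lemma ord_eqI: "u \<in> mpow n \<Longrightarrow> u \<notin> mpow (Suc n) \<Longrightarrow> ord A u = n"
proof -
  assume u: "u \<in> mpow n" "u \<notin> mpow (Suc n)"
  then have "u \<in> A" "u \<noteq> 0" using mpow_A by auto
  then show ?thesis using ord_le_iff[of u n] ord_le_iff[of u "Suc n"] u by auto
qed

lemma ord_mult: "u \<in> A \<Longrightarrow> u \<noteq> 0 \<Longrightarrow> v \<in> A \<Longrightarrow> v \<noteq> 0 \<Longrightarrow> ord A (u * v) = ord A u + ord A v"
  by (intro ord_eqI mpow_mult mpow_exact_mult ord_mem)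

lemma ord_eq_0: "u \<in> A \<Longrightarrow> u \<noteq> 0 \<Longrightarrow> ord A u = 0 \<longleftrightarrow> u \<notin> m"
  using ord_le_iff[of u 1] by auto

lemma params_extend:
  assumes x: "x \<in> m" "x \<notin> mpow 2"
  shows "\<exists>zs. params (x # zs)"
proof -
  obtain xs where p: "params xs" using gens by (auto simp: params_def)
  have "x \<in> lin A xs" using paramsD(3)[OF p] x by simp
  from lin_split[OF paramsD(1)[OF p] this] x obtain ps y qs c where
    h: "xs = ps @ y # qs" "c \<in> A" "c \<notin> m" "x - c * y \<in> lin A (ps @ qs)" by blast
  have A: "set (x # ps @ qs) \<subseteq> m" "set (x # ps @ qs) \<subseteq> A" "set (ps @ qs) \<subseteq> A"
    using paramsD(1)[OF p] h x m_sub by auto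
  have id: "ideal A (lin A (x # ps @ qs))" by (rule ideal_lin[OF A(2)])
  have sub: "set (x # ps @ qs) \<subseteq> lin A (x # ps @ qs)" using lin_mem[OF A(2)] by blast
  have "lin A (ps @ qs) \<subseteq> lin A (x # ps @ qs)" by (rule lin_least[OF id]) (use sub in auto)
  then have "x - c * y \<in> lin A (x # ps @ qs)" using h(4) by blast
  moreover have "x \<in> lin A (x # ps @ qs)" using sub by (metis list.set_intros(1) subsetD)
  ultimately have "x - (x - c * y) \<in> lin A (x # ps @ qs)" 
    by (intro ideal_diff[OF id, of x "x - c * y"])
  then have "inverse c * (c * y) \<in> lin A (x # ps @ qs)"
    using unit[OF h(2,3)] by (intro idealD(4)[OF id, of "inverse c" "c * y"]) auto
  then have y: "y \<in> lin A (x # ps @ qs)" using h(3) by (cases "c = 0") (auto simp flip: mult.assoc)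
  have "m \<subseteq> lin A (x # ps @ qs)"
    using lin_least[OF id, of xs] y sub h(1) paramsD(3)[OF p] by auto
  moreover have "lin A (x # ps @ qs) \<subseteq> m" by (rule lin_least[OF m_ideal A(1)])
  ultimately have "params (x # ps @ qs)" using A(1) paramsD(2)[OF p] h(1) by (auto simp: params_def)
  then show ?thesis by blast
qed

text \<open>Descending induction on the number of parameters divided out: with \<open>x\<close> the next parameter, \<open>a\<close> almost
  integral over \<open>b\<close> gives \<open>a = i + t * x + e * b\<close> with \<open>t\<close> again almost integral over \<open>b\<close>, and Krull's
  intersection theorem applies.\<close>

lemma completely_integrally_closed_mod:
  "params (js @ ys) \<Longrightarrow> a \<in> A \<Longrightarrow> b \<in> A \<Longrightarrow> c \<in> A \<Longrightarrow> b \<notin> lin A js \<Longrightarrow> c \<notin> lin A js \<Longrightarrow>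
    (\<And>k. c * a ^ k \<in> lin A js + pid A (b ^ k)) \<Longrightarrow> a \<in> lin A js + pid A b"
proof (induction ys arbitrary: js a b c)
  case Nil
  then have I: "lin A js = m" using paramsD(3) by auto
  then have b: "b \<noteq> 0" "inverse b \<in> A" using Nil unit by auto
  have "a = 0 + (a * inverse b) * b" using b by simp
  also have "\<dots> \<in> lin A js + pid A b" using I Nil b by (intro plus_pidI) auto
  finally show ?case .
next
  case (Cons x ys)
  define I where "I = lin A js"
  define I' where "I' = I + pid A x"
  have js: "set js \<subseteq> A" "x \<in> m" "x \<in> A" using paramsD(1,4)[OF Cons.prems(1)] by auto
  have I'_eq: "lin A (js @ [x]) = I'" by (simp add: I_def I'_def lin_append)
  have p': "params ((js @ [x]) @ ys)" using Cons.prems(1) by simp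
  have prI: "prime_ideal A I" unfolding I_def by (rule prime_params[OF Cons.prems(1)])
  have prI': "prime_ideal A I'" using prime_params[OF p'] I'_eq by simp
  note Ii = prime_idealD(1)[OF prI] and I'i = prime_idealD(1)[OF prI']
  have II': "I \<subseteq> I'" unfolding I'_def by (rule plus_sub1[OF ideal_pid[OF js(3)]])
  have idb: "ideal A (I + pid A b)" if "b \<in> A" for b by (intro ideal_plus Ii ideal_pid that)
  have xI: "x \<notin> I"
  proof
    assume "x \<in> I"
    moreover have "uform (x # ys) (1 + 0) (x ^ 1 * (1 + x * 0) + 0)"
      by (rule uform_Cons) (use uform_unit[of 1 ys] one_notin in auto)
    ultimately show False
      using uform_independent[OF Cons.prems(1), of 1 x] plus_sub1[OF mpow_ideal, of I] unfolding I_def by auto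
  qed
  \<comment> \<open>x is a nonzerodivisor modulo I + (b): a relation x u = i + w b forces w into the
    prime \<open>I'\<close>, since b is not there, and then x divides both sides modulo I.\<close>
  have cancel: "u \<in> I + pid A b" if xu: "x * u \<in> I + pid A b" and b: "b \<in> A" "b \<notin> I'" and u: "u \<in> A" for u b
  proof -
    obtain i w where iw: "i \<in> I" "w \<in> A" "x * u = i + w * b" using xu by (rule plus_pidE)
    have iA: "i \<in> A" by (rule idealD(6)[OF Ii iw(1)])
    have "- i + u * x \<in> I + pid A x" by (rule plus_pidI[OF ideal_neg[OF Ii iw(1)] u])
    then have "w * b \<in> I'" using iw(3) by (simp add: I'_def algebra_simps)
    then have "w \<in> I'" using prime_idealD(3)[OF prI' iw(2) b(1)] b(2) by blast
    then obtain j v where jv: "j \<in> I" "v \<in> A" "w = j + v * x" unfolding I'_def by (rule plus_pidE)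
    have "x * (u - v * b) = i + j * b" using iw(3) jv(3) by (simp add: algebra_simps)
    also have "\<dots> \<in> I" by (rule idealD(3)[OF Ii iw(1) idealD(5)[OF Ii b(1) jv(1)]])
    finally have "u - v * b \<in> I" using prime_idealD(3)[OF prI js(3), of "u - v * b"] xI u jv(2) b(1) by blast
    then have "(u - v * b) + v * b \<in> I + pid A b" by (rule plus_pidI[OF _ jv(2)])
    then show ?thesis by simp
  qed
  have cancel_pow: "u \<in> I + pid A b" if "x ^ n * u \<in> I + pid A b" "b \<in> A" "b \<notin> I'" "u \<in> A" for u b n
    using that
  proof (induction n)
    case (Suc n)
    have "x ^ n * u \<in> I + pid A b"
      by (rule cancel) (use Suc.prems js in \<open>auto simp: mult.assoc\<close>)
    then show ?case using Suc by blast
  qed simp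
  have cancel_I: "u \<in> I" if "x ^ n * u \<in> I" "u \<in> A" for u n
    using prime_idealD(3)[OF prI power_mem[OF js(3)] that(2,1)] prime_ideal_power[OF prI js(3)] xI by blast
  have powI': "b ^ k \<in> A" "b ^ k \<notin> I'" if "b \<in> A" "b \<notin> I'" for b k
    using that prime_ideal_power[OF prI'] by auto
  \<comment> \<open>Otherwise x would divide u modulo I to every power, contrary to Krull's
    intersection theorem.\<close>
  have factor_x: "\<exists>e v. v \<in> A \<and> v \<notin> I' \<and> u - x ^ e * v \<in> I" if u: "u \<in> A" "u \<notin> I" for u
  proof (rule ccontr)
    assume no: "\<not> ?thesis"
    have "\<exists>v\<in>A. u - x ^ n * v \<in> I" for n
    proof (induction n)
      case 0
      then show ?case using u idealD(2)[OF Ii] by (intro bexI[of _ u]) auto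
    next
      case (Suc n)
      then obtain v where v: "v \<in> A" "u - x ^ n * v \<in> I" by blast
      then have "v \<in> I'" using no by blast
      then obtain j w where jw: "j \<in> I" "w \<in> A" "v = j + w * x" unfolding I'_def by (rule plus_pidE)
      have "(u - x ^ n * v) + x ^ n * j \<in> I"
        by (rule idealD(3)[OF Ii v(2) idealD(4)[OF Ii power_mem[OF js(3)] jw(1)]])
      then have "u - x ^ Suc n * w \<in> I" using jw(3) by (simp add: algebra_simps)
      then show ?case using jw(2) by blast
    qed
    then have "u \<in> I + mpow n" for n
    proof -
      obtain v where v: "v \<in> A" "u - x ^ n * v \<in> I" using \<open>\<And>n. \<exists>v\<in>A. u - x ^ n * v \<in> I\<close> by blast
      have "x ^ n * v \<in> mpow n" by (rule idealD(5)[OF mpow_ideal v(1) m_mem_pow[OF js(2)]])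
      then have "(u - x ^ n * v) + x ^ n * v \<in> I + mpow n" by (rule plusI[OF v(2)])
      then show ?thesis by simp
    qed
    then show False using Krull_intersection[OF Ii] u(2) by blast
  qed
  \<comment> \<open>Case with b and c both outside \<open>I'\<close>, where the induction hypothesis
    modulo \<open>I'\<close> is available.\<close>
  have claim1: "a \<in> I + pid A b" if b: "b \<in> A" "b \<notin> I'" and c: "c \<in> A" "c \<notin> I'" and a: "a \<in> A"
    and ai: "\<And>k. c * a ^ k \<in> I + pid A (b ^ k)" for a b c
  proof -
    \<comment> \<open>Elements almost integral over b with the fixed multiplier c.
      \<open>step\<close> places Z inside I + (b) + x Z, and iteration gives approximation modulo
      every power of \<open>m\<close>.\<close>
    define Z where "Z = {a \<in> A. \<forall>k. c * a ^ k \<in> I + pid A (b ^ k)}"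
    have step: "\<exists>i\<in>I. \<exists>t\<in>Z. \<exists>e\<in>A. a = i + t * x + e * b" if aZ: "a \<in> Z" for a
    proof -
      have aA: "a \<in> A" and ai: "\<And>k. c * a ^ k \<in> I + pid A (b ^ k)" using aZ by (auto simp: Z_def)
      have "a \<in> I' + pid A b"
        using Cons.IH[OF p' aA b(1) c(1)] b c ai set_plus_mono2[OF II' order_refl] unfolding I'_eq by blast
      then obtain i' e where ie: "i' \<in> I'" "e \<in> A" "a = i' + e * b" by (rule plus_pidE)
      from ie(1) obtain i t where it: "i \<in> I" "t \<in> A" "i' = i + t * x" unfolding I'_def by (rule plus_pidE)
      have iA: "i \<in> A" by (rule idealD(6)[OF Ii it(1)])
      have mulb: "b * u \<in> I + pid A (b ^ Suc k)" if "u \<in> I + pid A (b ^ k)" for u k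
      proof -
        from that obtain j w where "j \<in> I" "w \<in> A" "u = j + w * b ^ k" by (rule plus_pidE)
        then show ?thesis
          using plus_pidI[of "b * j" I w A "b ^ Suc k"] idealD(4)[OF Ii b(1), of j] by (simp add: algebra_simps)
      qed
      \<comment> \<open>Replacing a by a - e b one factor at a time keeps almost integrality over b
        with the same multiplier.\<close>
      have expand: "c * a ^ l * (a - e * b) ^ k \<in> I + pid A (b ^ (l + k))" for k l
      proof (induction k arbitrary: l)
        case 0
        then show ?case using ai by simp
      next
        case (Suc k)
        have idl: "ideal A (I + pid A (b ^ (l + Suc k)))" by (rule idb) (use b in auto)
        have "c * a ^ Suc l * (a - e * b) ^ k \<in> I + pid A (b ^ (l + Suc k))" using Suc[of "Suc l"] by simp
        moreover have "e * (b * (c * a ^ l * (a - e * b) ^ k)) \<in> I + pid A (b ^ (l + Suc k))"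
          using idealD(4)[OF idl ie(2) ] mulb[OF Suc[of l]] by simp
        ultimately have "c * a ^ Suc l * (a - e * b) ^ k - e * (b * (c * a ^ l * (a - e * b) ^ k)) \<in> I + pid A (b ^ (l + Suc k))"
          by (rule ideal_diff[OF idl])
        then show ?case by (simp add: algebra_simps)
      qed
      have "c * t ^ k \<in> I + pid A (b ^ k)" for k
      proof (rule cancel_pow[of k])
        have bk: "b ^ k \<in> A" using b by auto
        have "c * (a - e * b) ^ k \<in> I + pid A (b ^ k)" using expand[of 0 k] by simp
        moreover have "a - e * b = i + t * x" using ie it by simp
        ultimately have 1: "c * (i + t * x) ^ k \<in> I + pid A (b ^ k)" by simp
        have "(t * x) ^ k - (i + t * x) ^ k \<in> I"
          using iA it js ideal_neg[OF Ii it(1)] by (intro power_cong_mod[OF Ii]) auto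
        then have "c * ((t * x) ^ k - (i + t * x) ^ k) \<in> I" by (rule idealD(4)[OF Ii c(1)])
        then have "c * (t * x) ^ k - c * (i + t * x) ^ k \<in> I + pid A (b ^ k)"
          using plus_sub1[OF ideal_pid[OF bk], of I] by (auto simp: algebra_simps)
        then have "c * (t * x) ^ k \<in> I + pid A (b ^ k)" by (rule plus_memI[OF idb[OF bk] _ 1])
        then show "x ^ k * (c * t ^ k) \<in> I + pid A (b ^ k)" by (simp add: power_mult_distrib ac_simps)
      qed (use powI'[OF b] c it in auto)
      then have "t \<in> Z" using it by (simp add: Z_def)
      then show ?thesis using ie it by blast
    qed
    have "\<forall>a\<in>Z. a \<in> (I + pid A b) + mpow n" for n
    proof (induction n)
      case 0
      then show ?case using plus_sub2[OF idb[OF b(1)], of A] by (auto simp: Z_def)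
    next
      case (Suc n)
      show ?case
      proof
        fix a assume "a \<in> Z"
        then obtain i t e where h: "i \<in> I" "t \<in> Z" "e \<in> A" "a = i + t * x + e * b" using step by blast
        have "t \<in> (I + pid A b) + mpow n" using Suc h(2) by blast
        then have "x * t \<in> (I + pid A b) + mpow (n + 1)"
          by (rule plus_mult(2)[OF idb[OF b(1)]]) (use js in simp)
        then obtain u v where uv: "u \<in> I + pid A b" "v \<in> mpow (Suc n)" "x * t = u + v" by (auto elim: plusE)
        have "i + e * b \<in> I + pid A b" by (rule plus_pidI[OF h(1,3)])
        then have "((i + e * b) + u) + v \<in> (I + pid A b) + mpow (Suc n)"
          by (intro plusI[OF idealD(3)[OF idb[OF b(1)] _ uv(1)] uv(2)])
        moreover have "((i + e * b) + u) + v = a" using h(4) uv(3) by (simp add: algebra_simps)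
        ultimately show "a \<in> (I + pid A b) + mpow (Suc n)" by simp
      qed
    qed
    moreover have "a \<in> Z" using a ai by (simp add: Z_def)
    ultimately show ?thesis using Krull_intersection[OF idb[OF b(1)]] by blast
  qed
  \<comment> \<open>Now only c outside I is assumed: c is x^f c' modulo I, and x^f can be cancelled
    since b^k avoids \<open>I'\<close>.\<close>
  have claim2: "a \<in> I + pid A b" if b: "b \<in> A" "b \<notin> I'" and c: "c \<in> A" "c \<notin> I" and a: "a \<in> A"
    and ai: "\<And>k. c * a ^ k \<in> I + pid A (b ^ k)" for a b c
  proof -
    obtain f c' where f: "c' \<in> A" "c' \<notin> I'" "c - x ^ f * c' \<in> I" using factor_x[OF c] by blast
    show ?thesis
    proof (rule claim1[OF b f(1,2) a])
      fix k
      have bk: "b ^ k \<in> A" using b by auto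
      have "a ^ k * (c - x ^ f * c') \<in> I" by (rule idealD(4)[OF Ii power_mem[OF a] f(3)])
      then have "c * a ^ k - x ^ f * (c' * a ^ k) \<in> I + pid A (b ^ k)"
        using plus_sub1[OF ideal_pid[OF bk], of I] by (auto simp: algebra_simps)
      then have "c * a ^ k - (c * a ^ k - x ^ f * (c' * a ^ k)) \<in> I + pid A (b ^ k)"
        by (rule ideal_diff[OF idb[OF bk] ai])
      then have "x ^ f * (c' * a ^ k) \<in> I + pid A (b ^ k)" by simp
      then show "c' * a ^ k \<in> I + pid A (b ^ k)"
        by (rule cancel_pow) (use powI'[OF b] f a in auto)
    qed
  qed
  \<comment> \<open>A factor x^e in the denominator is removed by induction: for e > 0 the numerator
    a lies in \<open>I'\<close>, so one x can be divided out of both.\<close>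
  have claim3: "a \<in> I + pid A (x ^ e * b)" if b: "b \<in> A" "b \<notin> I'" and c: "c \<in> A" "c \<notin> I" and "a \<in> A"
    and "\<And>k. c * a ^ k \<in> I + pid A ((x ^ e * b) ^ k)" for a b c e
    using that(5,6)
  proof (induction e arbitrary: a)
    case 0
    then show ?case using claim2[OF b c 0(1)] by simp
  next
    case (Suc e)
    define B where "B = x ^ e * b"
    have BA: "B \<in> A" using js b by (auto simp: B_def)
    have hyp: "\<exists>i\<in>I. \<exists>w\<in>A. c * a ^ k = i + w * (x ^ k * B ^ k)" for k
    proof -
      have "c * a ^ k \<in> I + pid A (x ^ k * B ^ k)"
        using Suc.prems(2)[of k] by (simp add: B_def power_mult_distrib mult.assoc)
      then show ?thesis by (rule plus_pidE) blast
    qed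
    obtain f c' where f: "c' \<in> A" "c' \<notin> I'" "c - x ^ f * c' \<in> I" using factor_x[OF c] by blast
    have "a \<in> I'"
    proof (rule ccontr)
      assume aI: "a \<notin> I'"
      \<comment> \<open>\<open>f\<close> is the exponent of x in c; with exponent f + 1 one factor x
        survives on the right after x^f is cancelled, so c' a^k would lie in
        \<open>I'\<close>.\<close>
      define k where "k = Suc f"
      obtain i w where iw: "i \<in> I" "w \<in> A" "c * a ^ k = i + w * (x ^ k * B ^ k)" using hyp by blast
      have "i - a ^ k * (c - x ^ f * c') \<in> I"
        by (rule ideal_diff[OF Ii iw(1) idealD(4)[OF Ii power_mem[OF Suc.prems(1)] f(3)]])
      moreover have "x ^ f * (c' * a ^ k - w * (x * B ^ k)) = i - a ^ k * (c - x ^ f * c')"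
        using iw(3) by (simp add: k_def algebra_simps)
      ultimately have "c' * a ^ k - w * (x * B ^ k) \<in> I"
        using cancel_I[of f "c' * a ^ k - w * (x * B ^ k)"] f iw js BA Suc.prems(1) by auto
      then have "(c' * a ^ k - w * (x * B ^ k)) + (w * B ^ k) * x \<in> I + pid A x"
        using iw(2) BA by (intro plus_pidI) auto
      then have "c' * a ^ k \<in> I'" by (simp add: I'_def algebra_simps)
      then show False using prime_mult_notin[OF prI' f(1) _ f(2)] powI'[OF Suc.prems(1) aI] by blast
    qed
    then obtain i t where it: "i \<in> I" "t \<in> A" "a = i + t * x" unfolding I'_def by (rule plus_pidE)
    have iA: "i \<in> A" by (rule idealD(6)[OF Ii it(1)])
    have "t \<in> I + pid A B"
      unfolding B_def
    proof (rule Suc.IH[OF it(2)])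
      fix k
      obtain j w where jw: "j \<in> I" "w \<in> A" "c * a ^ k = j + w * (x ^ k * B ^ k)" using hyp by blast
      have "(t * x) ^ k - a ^ k \<in> I"
        using iA it js ideal_neg[OF Ii it(1)] Suc.prems(1) by (intro power_cong_mod[OF Ii]) auto
      then have "c * ((t * x) ^ k - a ^ k) + j \<in> I" by (intro idealD(3)[OF Ii idealD(4)[OF Ii c(1)] jw(1)])
      moreover have "x ^ k * (c * t ^ k - w * B ^ k) = c * ((t * x) ^ k - a ^ k) + j"
        using jw(3) by (simp add: algebra_simps power_mult_distrib)
      ultimately have "c * t ^ k - w * B ^ k \<in> I"
        using cancel_I[of k "c * t ^ k - w * B ^ k"] c it jw BA by auto
      then have "(c * t ^ k - w * B ^ k) + w * B ^ k \<in> I + pid A (B ^ k)" by (rule plus_pidI[OF _ jw(2)])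
      then show "c * t ^ k \<in> I + pid A ((x ^ e * b) ^ k)" by (simp add: B_def)
    qed
    then obtain j w where jw: "j \<in> I" "w \<in> A" "t = j + w * B" by (rule plus_pidE)
    have "(i + x * j) + w * (x * B) \<in> I + pid A (x * B)"
      by (intro plus_pidI idealD(3)[OF Ii it(1)] idealD(4)[OF Ii js(3) jw(1)] jw)
    then show ?case using it(3) jw(3) by (simp add: B_def algebra_simps)
  qed
  obtain e b' where b': "b' \<in> A" "b' \<notin> I'" "b - x ^ e * b' \<in> I"
    using factor_x[of b] Cons.prems(3,5) I_def by blast
  let ?B = "x ^ e * b'"
  have BA: "?B \<in> A" using js b' by auto
  have "a \<in> I + pid A ?B"
  proof (rule claim3[OF b'(1,2) Cons.prems(4)])
    show "c \<notin> I" using Cons.prems by (simp add: I_def)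
    show "a \<in> A" by fact
    fix k
    have "b ^ k - ?B ^ k \<in> I" by (rule power_cong_mod[OF Ii Cons.prems(3) BA b'(3)])
    then have "I + pid A (b ^ k) \<subseteq> I + pid A (?B ^ k)" by (rule pid_cong_mod[OF Ii])
    then show "c * a ^ k \<in> I + pid A (?B ^ k)" using Cons.prems(7)[of k] by (auto simp: I_def)
  qed
  moreover have "I + pid A ?B \<subseteq> I + pid A b"
    using pid_cong_mod[OF Ii, of ?B b] ideal_neg[OF Ii b'(3)] by simp
  ultimately show ?case by (auto simp: I_def)
qed

lemma completely_integrally_closed:
  assumes c: "c \<in> A" "c \<noteq> 0" and w: "\<And>k. c * w ^ k \<in> A"
  shows "w \<in> A"
proof -
  obtain xs where p: "params xs" using gens by (auto simp: params_def)
  obtain a b where ab: "a \<in> A" "b \<in> A" "b \<noteq> 0" "w = a / b"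
    using qf unfolding quotient_field_is_F_def by blast
  have "a \<in> lin A [] + pid A b"
  proof (rule completely_integrally_closed_mod[of "[]" xs a b c])
    fix k
    have "c * a ^ k = (c * w ^ k) * b ^ k" using ab by (simp add: power_divide)
    then show "c * a ^ k \<in> lin A [] + pid A (b ^ k)"
      using plus_pidI[of 0 "{0}" "c * w ^ k" A "b ^ k"] w[of k] by (simp only: lin.simps) simp
  qed (use p ab c in auto)
  then obtain e where "e \<in> A" "a = e * b" by (auto simp: mem_pid)
  then show ?thesis using ab by simp
qed

end

section \<open>Polynomials and Taylor shifts\<close>

text \<open>Polynomials have multisets as exponents, so that the degree of a monomial is its size.\<close>

abbreviation "coef \<equiv> Poly_Mapping.lookup"
abbreviation "supp \<equiv> Poly_Mapping.keys"
abbreviation "mono_term \<equiv> Poly_Mapping.single"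

lemma poly_decomp: "p = (\<Sum>\<alpha>\<in>supp p. mono_term \<alpha> (coef p \<alpha>))"
proof (rule poly_mapping_eqI)
  fix k
  have "coef (\<Sum>\<alpha>\<in>supp p. mono_term \<alpha> (coef p \<alpha>)) k = (\<Sum>\<alpha>\<in>supp p. if \<alpha> = k then coef p \<alpha> else 0)"
    by (auto simp: lookup_sum lookup_single when_def intro!: sum.cong)
  also have "\<dots> = coef p k" by (simp add: in_keys_iff)
  finally show "coef p k = coef (\<Sum>\<alpha>\<in>supp p. mono_term \<alpha> (coef p \<alpha>)) k" by simp
qed

lemma poly_mult_decomp:
  fixes p q :: "'b::comm_monoid_add \<Rightarrow>\<^sub>0 'a::comm_ring_1"
  shows "p * q = (\<Sum>\<alpha>\<in>supp p. \<Sum>\<beta>\<in>supp q. mono_term (\<alpha> + \<beta>) (coef p \<alpha> * coef q \<beta>))"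
proof -
  have "p * q = (\<Sum>\<alpha>\<in>supp p. mono_term \<alpha> (coef p \<alpha>)) * (\<Sum>\<beta>\<in>supp q. mono_term \<beta> (coef q \<beta>))"
    using poly_decomp[of p] poly_decomp[of q] by metis
  then show ?thesis by (simp add: sum_product mult_single)
qed

lemma lookup_mult_mem:
  fixes p q :: "'b::comm_monoid_add \<Rightarrow>\<^sub>0 'a::comm_ring_1"
  assumes add: "\<And>\<gamma> a b. a \<in> U \<gamma> \<Longrightarrow> b \<in> U \<gamma> \<Longrightarrow> a + b \<in> U \<gamma>" and zero: "\<And>\<gamma>. 0 \<in> U \<gamma>"
    and mult: "\<And>\<alpha> \<beta>. coef p \<alpha> * coef q \<beta> \<in> U (\<alpha> + \<beta>)"
  shows "coef (p * q) \<gamma> \<in> U \<gamma>"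
proof -
  have sm: "(\<Sum>i\<in>S. f i) \<in> U \<gamma>" if "\<And>i. i \<in> S \<Longrightarrow> f i \<in> U \<gamma>" for S and f :: "'b \<Rightarrow> 'a"
    using that by (induction S rule: infinite_finite_induct) (auto intro: add zero)
  show ?thesis
    unfolding poly_mult_decomp[of p q] lookup_sum
    by (intro sm) (auto simp: lookup_single when_def zero mult)
qed

lemma lookup_scale: "coef (mono_term 0 s * p) k = s * coef (p :: 'b::comm_monoid_add \<Rightarrow>\<^sub>0 'a::comm_ring_1) k"
  by (simp flip: mult_map_scale_conv_mult add: Poly_Mapping.map.rep_eq when_def)

lemma lookup_mult_0:
  fixes p q :: "'b multiset \<Rightarrow>\<^sub>0 'a::comm_ring_1"
  shows "coef (p * q) 0 = coef p 0 * coef q 0"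
proof -
  define p' where "p' = p - mono_term 0 (coef p 0)"
  have "coef (p' * q) 0 \<in> (if (0 :: 'b multiset) = 0 then {0} else UNIV)"
    by (rule lookup_mult_mem[where U = "\<lambda>\<gamma>. if \<gamma> = 0 then {0} else UNIV"])
      (auto simp: p'_def lookup_minus split: if_splits)
  moreover have "p * q = p' * q + mono_term 0 (coef p 0) * q"
    by (simp add: p'_def algebra_simps)
  ultimately show ?thesis by (simp add: lookup_add lookup_scale)
qed

text \<open>The monomial after the substitution sending each variable z to y(z) + z; extended
  linearly in \<open>shift\<close>, this is Taylor expansion at the point y.\<close>

definition shift_mon :: "('b \<Rightarrow> 'a::comm_ring_1) \<Rightarrow> 'b multiset \<Rightarrow> 'b multiset \<Rightarrow>\<^sub>0 'a" where
  "shift_mon y \<alpha> = (\<Prod>z\<in>#\<alpha>. mono_term 0 (y z) + mono_term {#z#} 1)"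

definition shift :: "('b \<Rightarrow> 'a::comm_ring_1) \<Rightarrow> ('b multiset \<Rightarrow>\<^sub>0 'a) \<Rightarrow> 'b multiset \<Rightarrow>\<^sub>0 'a" where
  "shift y p = (\<Sum>\<alpha>\<in>supp p. mono_term 0 (coef p \<alpha>) * shift_mon y \<alpha>)"

lemma shift_mon_add: "shift_mon y (\<alpha> + \<beta>) = shift_mon y \<alpha> * shift_mon y \<beta>"
  by (simp add: shift_mon_def)

lemma shift_add: "shift y (p + q) = shift y p + shift y q"
  unfolding shift_def
  by (rule setsum_keys_plus_distrib) (simp_all add: single_add distrib_right)

lemma shift_0 [simp]: "shift y 0 = 0"
  by (simp add: shift_def)

lemma shift_single: "shift y (mono_term \<alpha> c) = mono_term 0 c * shift_mon y \<alpha>"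
  by (cases "c = 0") (simp_all add: shift_def)

lemma shift_sum: "shift y (sum f S) = (\<Sum>i\<in>S. shift y (f i))"
  by (induction S rule: infinite_finite_induct) (simp_all add: shift_add)

lemma shift_mult: "shift y (p * q) = shift y p * shift y q"
proof -
  have "shift y (p * q) = (\<Sum>\<alpha>\<in>supp p. \<Sum>\<beta>\<in>supp q. mono_term 0 (coef p \<alpha> * coef q \<beta>) * shift_mon y (\<alpha> + \<beta>))"
    by (simp add: poly_mult_decomp[of p q] shift_sum shift_single)
  also have "\<dots> = (\<Sum>\<alpha>\<in>supp p. \<Sum>\<beta>\<in>supp q. (mono_term 0 (coef p \<alpha>) * shift_mon y \<alpha>) * (mono_term 0 (coef q \<beta>) * shift_mon y \<beta>))"
  proof (intro sum.cong refl)
    fix \<alpha> \<beta>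
    have "mono_term 0 (coef p \<alpha> * coef q \<beta>) = mono_term (0 :: 'a multiset) (coef p \<alpha>) * mono_term 0 (coef q \<beta>)"
      by (simp add: mult_single)
    then show "mono_term 0 (coef p \<alpha> * coef q \<beta>) * shift_mon y (\<alpha> + \<beta>) =
      (mono_term 0 (coef p \<alpha>) * shift_mon y \<alpha>) * (mono_term 0 (coef q \<beta>) * shift_mon y \<beta>)"
      by (simp add: shift_mon_add ac_simps)
  qed
  also have "\<dots> = shift y p * shift y q" by (simp add: shift_def sum_product)
  finally show ?thesis .
qed

lemma shift_diff: "shift y (p - q) = shift y p - shift y q"
  using shift_add[of y "p - q" q] by (simp add: algebra_simps)

lemma shift_const: "shift y (mono_term 0 c) = mono_term 0 c"
  by (simp add: shift_single shift_mon_def)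

lemma shift_var: "shift y (mono_term {#z#} 1) = mono_term 0 (y z) + mono_term {#z#} 1"
  by (simp add: shift_single shift_mon_def)

text \<open>Translation is invertible, so information on Taylor coefficients can be carried back to
  the original coefficients.\<close>

lemma shift_inverse: "shift (\<lambda>z. - y z) (shift y p) = p"
proof -
  have one: "shift y' 1 = 1" for y' :: "'a \<Rightarrow> 'b"
    using shift_const[of y' 1] by simp
  have "shift (\<lambda>z. - y z) (shift_mon y \<alpha>) = mono_term \<alpha> 1" for \<alpha>
  proof (induction \<alpha>)
    case empty
    then show ?case by (simp add: shift_mon_def one flip: zero_multiset_def)
  next
    case (add z \<alpha>)
    have "shift (\<lambda>z. - y z) (shift_mon y (add_mset z \<alpha>)) =
        shift (\<lambda>z. - y z) (mono_term 0 (y z) + mono_term {#z#} 1) * shift (\<lambda>z. - y z) (shift_mon y \<alpha>)"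
      by (simp add: shift_mon_def shift_mult)
    also have "shift (\<lambda>z. - y z) (mono_term 0 (y z) + mono_term {#z#} 1) = mono_term {#z#} 1"
      by (simp add: shift_add shift_const shift_var single_uminus)
    finally show ?case using add by (simp add: mult_single)
  qed
  then have "shift (\<lambda>z. - y z) (shift y p) = (\<Sum>\<alpha>\<in>supp p. mono_term 0 (coef p \<alpha>) * mono_term \<alpha> 1)"
    unfolding shift_def[of y p] by (simp add: shift_sum shift_mult shift_const)
  also have "\<dots> = p" using poly_decomp[of p] by (simp add: mult_single)
  finally show ?thesis .
qed

text \<open>Evaluation as the constant Taylor coefficient: multiplicativity then comes from that of
  \<open>shift\<close>, and \<open>peval_eq\<close> recovers the usual sum.\<close>

definition peval :: "('b \<Rightarrow> 'a::comm_ring_1) \<Rightarrow> ('b multiset \<Rightarrow>\<^sub>0 'a) \<Rightarrow> 'a" where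
  "peval y p = coef (shift y p) 0"

lemma peval_add: "peval y (p + q) = peval y p + peval y q"
  and peval_diff: "peval y (p - q) = peval y p - peval y q"
  and peval_mult: "peval y (p * q) = peval y p * peval y q"
  and peval_const: "peval y (mono_term 0 c) = c"
  and peval_var: "peval y (mono_term {#z#} 1) = y z"
  by (simp_all add: peval_def shift_add lookup_add shift_diff lookup_minus shift_mult lookup_mult_0
      shift_const shift_var lookup_single when_def)

lemma peval_eq: "peval y p = (\<Sum>\<alpha>\<in>supp p. coef p \<alpha> * (\<Prod>z\<in>#\<alpha>. y z))"
proof -
  have "coef (shift_mon y \<alpha>) 0 = (\<Prod>z\<in>#\<alpha>. y z)" for \<alpha>
    by (induction \<alpha>) (simp_all add: shift_mon_def lookup_mult_0 lookup_add lookup_single when_def flip: zero_multiset_def)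
  then show ?thesis by (simp add: peval_def shift_def lookup_sum lookup_scale)
qed

text \<open>The condition may depend on the exponent, so that one product lemma serves degree
  bounds, restricted variables and vanishing in low degrees.\<close>

definition coeffs_in :: "('b multiset \<Rightarrow> 'a set) \<Rightarrow> ('b multiset \<Rightarrow>\<^sub>0 'a::comm_ring_1) \<Rightarrow> bool" where
  "coeffs_in U p \<longleftrightarrow> (\<forall>\<alpha>. coef p \<alpha> \<in> U \<alpha>)"

lemma coeffs_in_mult:
  assumes "coeffs_in S p" "coeffs_in T q"
    and "\<And>\<gamma> a b. a \<in> U \<gamma> \<Longrightarrow> b \<in> U \<gamma> \<Longrightarrow> a + b \<in> U \<gamma>" and "\<And>\<gamma>. 0 \<in> U \<gamma>"
    and "\<And>\<alpha> \<beta> a b. a \<in> S \<alpha> \<Longrightarrow> b \<in> T \<beta> \<Longrightarrow> a * b \<in> U (\<alpha> + \<beta>)"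
  shows "coeffs_in U (p * q)"
  unfolding coeffs_in_def
proof
  fix \<gamma>
  show "coef (p * q) \<gamma> \<in> U \<gamma>"
    by (rule lookup_mult_mem) (use assms in \<open>auto simp: coeffs_in_def\<close>)
qed

lemma coeffs_in_sum:
  assumes "\<And>i. i \<in> S \<Longrightarrow> coeffs_in U (f i)"
    and add: "\<And>\<gamma> a b. a \<in> U \<gamma> \<Longrightarrow> b \<in> U \<gamma> \<Longrightarrow> a + b \<in> U \<gamma>" and zero: "\<And>\<gamma>. 0 \<in> U \<gamma>"
  shows "coeffs_in U (sum f S)"
  using assms(1)
  by (induction S rule: infinite_finite_induct) (auto simp: coeffs_in_def zero lookup_add add)

lemma shift_coeffs_in:
  assumes A: "field_subring A" and I: "ideal A I" and y: "\<And>\<alpha> z. \<alpha> \<in> supp p \<Longrightarrow> z \<in># \<alpha> \<Longrightarrow> y z \<in> A"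
    and p: "\<And>\<alpha>. coef p \<alpha> \<in> I"
  shows "coef (shift y p) \<gamma> \<in> I"
proof -
  interpret field_subring A by fact
  have M: "coeffs_in (\<lambda>_. A) (shift_mon y \<alpha>)" if "\<And>z. z \<in># \<alpha> \<Longrightarrow> y z \<in> A" for \<alpha>
    using that
  proof (induction \<alpha>)
    case empty
    then show ?case by (auto simp: shift_mon_def coeffs_in_def lookup_one when_def)
  next
    case (add z \<alpha>)
    have "coeffs_in (\<lambda>_. A) (mono_term 0 (y z) + mono_term {#z#} 1)"
      using add.prems by (auto simp: coeffs_in_def lookup_add lookup_single when_def)
    moreover have "coeffs_in (\<lambda>_. A) (shift_mon y \<alpha>)" using add by auto
    ultimately have "coeffs_in (\<lambda>_. A) ((mono_term 0 (y z) + mono_term {#z#} 1) * shift_mon y \<alpha>)"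
      by (rule coeffs_in_mult) auto
    then show ?case by (simp add: shift_mon_def)
  qed
  have "coeffs_in (\<lambda>_. I) (shift y p)"
    unfolding shift_def
  proof (rule coeffs_in_sum)
    fix \<alpha> assume \<alpha>: "\<alpha> \<in> supp p"
    show "coeffs_in (\<lambda>_. I) (mono_term 0 (coef p \<alpha>) * shift_mon y \<alpha>)"
      using M[of \<alpha>] y[OF \<alpha>] idealD(5)[OF I _ p[of \<alpha>]] by (auto simp: coeffs_in_def lookup_scale)
  qed (auto intro: idealD[OF I])
  then show ?thesis by (simp add: coeffs_in_def)
qed

definition deg_le :: "nat \<Rightarrow> ('b multiset \<Rightarrow>\<^sub>0 'a::comm_ring_1) \<Rightarrow> bool" where
  "deg_le n p \<longleftrightarrow> coeffs_in (\<lambda>\<alpha>. if size \<alpha> \<le> n then UNIV else {0}) p"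

lemma deg_le_iff: "deg_le n p \<longleftrightarrow> (\<forall>\<alpha>. n < size \<alpha> \<longrightarrow> coef p \<alpha> = 0)"
  by (auto simp: deg_le_def coeffs_in_def split: if_splits)

lemma deg_le_mult: "deg_le n p \<Longrightarrow> deg_le k q \<Longrightarrow> deg_le (n + k) (p * q)"
  unfolding deg_le_def by (rule coeffs_in_mult) (auto split: if_splits)

lemma deg_le_add: "deg_le n p \<Longrightarrow> deg_le n q \<Longrightarrow> deg_le n (p + q)"
  by (auto simp: deg_le_iff lookup_add)

lemma deg_le_ex:
  fixes p :: "'b multiset \<Rightarrow>\<^sub>0 'a::comm_ring_1"
  shows "\<exists>n. deg_le n p"
proof
  show "deg_le (Max (size ` supp p)) p"
    unfolding deg_le_iff
  proof (intro allI impI)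
    fix \<alpha> :: "'b multiset" assume *: "Max (size ` supp p) < size \<alpha>"
    have "\<alpha> \<notin> supp p"
    proof
      assume "\<alpha> \<in> supp p"
      then have "size \<alpha> \<le> Max (size ` supp p)" by (intro Max_ge) auto
      then show False using * by simp
    qed
    then show "coef p \<alpha> = 0" by (simp add: in_keys_iff)
  qed
qed

lemma deg_le_shift:
  assumes "deg_le n p" shows "deg_le n (shift y p)"
proof -
  have M: "deg_le (size \<alpha>) (shift_mon y \<alpha>)" for \<alpha>
  proof (induction \<alpha>)
    case empty
    then show ?case by (auto simp: deg_le_iff shift_mon_def lookup_one when_def)
  next
    case (add z \<alpha>)
    have "deg_le 1 (mono_term 0 (y z) + mono_term {#z#} 1)"
      by (auto simp: deg_le_iff lookup_add lookup_single when_def)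
    then show ?case using deg_le_mult[OF _ add] by (fastforce simp: shift_mon_def)
  qed
  have "deg_le n (mono_term 0 (coef p \<alpha>) * shift_mon y \<alpha>)" if "\<alpha> \<in> supp p" for \<alpha>
  proof -
    have "size \<alpha> \<le> n" using assms that by (meson deg_le_iff in_keys_iff not_le)
    then show ?thesis using M[of \<alpha>] by (auto simp: deg_le_iff lookup_scale)
  qed
  then show ?thesis
    unfolding deg_le_iff shift_def by (simp add: lookup_sum)
qed

section \<open>Quadratic transforms\<close>

text \<open>Independence of the fraction follows from additivity of \<open>ord\<close>. At 0 no
  fraction qualifies and the value is unspecified.\<close>

definition ordF :: "'a::field set \<Rightarrow> 'a \<Rightarrow> int" where
  "ordF A z = (SOME k. \<exists>a b. a \<in> A \<and> b \<in> A \<and> a \<noteq> 0 \<and> b \<noteq> 0 \<and> z = a / b \<and> k = int (ord A a) - int (ord A b))"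

context reg_local
begin

lemma ordF_divide:
  assumes ab: "a \<in> A" "b \<in> A" "a \<noteq> 0" "b \<noteq> 0"
  shows "ordF A (a / b) = int (ord A a) - int (ord A b)"
  unfolding ordF_def
proof (rule some_equality)
  show "\<exists>a' b'. a' \<in> A \<and> b' \<in> A \<and> a' \<noteq> 0 \<and> b' \<noteq> 0 \<and> a / b = a' / b' \<and>
      int (ord A a) - int (ord A b) = int (ord A a') - int (ord A b')" using ab by blast
  fix k assume "\<exists>a' b'. a' \<in> A \<and> b' \<in> A \<and> a' \<noteq> 0 \<and> b' \<noteq> 0 \<and> a / b = a' / b' \<and> k = int (ord A a') - int (ord A b')"
  then obtain a' b' where h: "a' \<in> A" "b' \<in> A" "a' \<noteq> 0" "b' \<noteq> 0" "a / b = a' / b'" "k = int (ord A a') - int (ord A b')" by blast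
  have "a * b' = a' * b" using h ab by (simp add: field_simps)
  then have "ord A a + ord A b' = ord A a' + ord A b" using ord_mult h ab by metis
  then show "k = int (ord A a) - int (ord A b)" using h by linarith
qed

lemma frac_rep: "z \<noteq> 0 \<Longrightarrow> \<exists>a b. a \<in> A \<and> b \<in> A \<and> a \<noteq> 0 \<and> b \<noteq> 0 \<and> z = a / b"
  using qf unfolding quotient_field_is_F_def by (metis div_0)

lemma ord_one [simp]: "ord A 1 = 0"
  using ord_eq_0[of 1] one_notin by simp

lemma ordF_of: "a \<in> A \<Longrightarrow> a \<noteq> 0 \<Longrightarrow> ordF A a = int (ord A a)"
  using ordF_divide[of a 1] by simp

lemma ordF_mult:
  assumes "w \<noteq> 0" "z \<noteq> 0" shows "ordF A (w * z) = ordF A w + ordF A z"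
proof -
  obtain a b c e where h: "a \<in> A" "b \<in> A" "a \<noteq> 0" "b \<noteq> 0" "w = a / b" "c \<in> A" "e \<in> A" "c \<noteq> 0" "e \<noteq> 0" "z = c / e"
    using frac_rep[OF assms(1)] frac_rep[OF assms(2)] by blast
  then have "ordF A ((a * c) / (b * e)) = int (ord A (a * c)) - int (ord A (b * e))" by (intro ordF_divide) auto
  then show ?thesis using h by (simp add: ordF_divide ord_mult)
qed

lemma ord_valuation_ring_eq: "ord_valuation_ring A = {z. z = 0 \<or> 0 \<le> ordF A z}"
proof (intro set_eqI)
  fix z
  show "z \<in> ord_valuation_ring A \<longleftrightarrow> z \<in> {z. z = 0 \<or> 0 \<le> ordF A z}"
  proof (cases "z = 0")
    case False
    obtain a b where h: "a \<in> A" "b \<in> A" "a \<noteq> 0" "b \<noteq> 0" "z = a / b" using frac_rep[OF False] by blast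
    have "ordF A z = int (ord A a) - int (ord A b)" using h ordF_divide by simp
    then show ?thesis
      using h False ordF_divide unfolding ord_valuation_ring_def by fastforce
  qed (simp add: ord_valuation_ring_def)
qed

end

lemma subring_ring_adjoin: "subring (ring_adjoin A X)"
  unfolding ring_adjoin_def subring_def by auto

lemma ring_adjoin_sub: "A \<subseteq> ring_adjoin A X" "X \<subseteq> ring_adjoin A X"
  unfolding ring_adjoin_def by auto

lemma peval_0 [simp]: "peval y 0 = 0" and peval_1 [simp]: "peval y 1 = 1"
  using peval_const[of y 0] peval_const[of y 1] by simp_all

section \<open>Homogenized polynomials as forms with a coefficient outside the maximal ideal\<close>

context noeth_local
begin

lemma prod_mset_mpow: "set_mset \<alpha> \<subseteq> m \<Longrightarrow> prod_mset \<alpha> \<in> mpow (size \<alpha>)"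
proof (induction \<alpha>)
  case (add a \<alpha>)
  then show ?case using ideal_pow_Suc_mem[OF m_ideal, of a "prod_mset \<alpha>" "size \<alpha>"] by simp
qed simp

text \<open>Powers of \<open>x\<close> homogenize a polynomial in \<open>zs\<close> to degree
  \<open>N\<close>. With \<open>x\<close> last in the list, the base case is the single monomial
  x^N.\<close>

lemma uform_sum:
  assumes "finite S" "\<And>\<alpha>. \<alpha> \<in> S \<Longrightarrow> set_mset \<alpha> \<subseteq> set zs \<and> size \<alpha> \<le> N \<and> c \<alpha> \<in> A"
    "\<alpha>0 \<in> S" "c \<alpha>0 \<notin> m" "x \<in> m" "set zs \<subseteq> m"
  shows "uform (zs @ [x]) N (\<Sum>\<alpha>\<in>S. c \<alpha> * x ^ (N - size \<alpha>) * prod_mset \<alpha>)"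
  using assms
proof (induction zs arbitrary: S c N \<alpha>0)
  case Nil
  have "\<alpha> = {#}" if "\<alpha> \<in> S" for \<alpha> using Nil.prems(2)[OF that] by simp
  then have S: "S = {{#}}" using Nil.prems(3) by auto
  have "uform [x] (N + 0) (x ^ N * (c {#} + x * 0) + 0)"
    by (rule uform_Cons) (use Nil S in \<open>auto intro: uform_Nil\<close>)
  then show ?case using S by (simp add: mult.commute)
next
  case (Cons z zs)
  have zm: "z \<in> m" "set zs \<subseteq> m" using Cons.prems by auto
  define S' where "S' = {\<alpha> \<in> S. c \<alpha> \<notin> m}"
  \<comment> \<open>The least exponent of z among monomials with coefficient outside
    \<open>m\<close>. Those attaining it (\<open>S0\<close>) give z^e g, the others
    (\<open>S1\<close>) contain z^(e+1) and give z^e z h, and the monomials with coefficient in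
    \<open>m\<close> (\<open>S2\<close>) go into the error r.\<close>
  define e where "e = Min ((\<lambda>\<alpha>. count \<alpha> z) ` S')"
  define \<rho> where "\<rho> k = replicate_mset k z" for k
  define S0 where "S0 = {\<alpha> \<in> S'. count \<alpha> z = e}"
  define S1 where "S1 = {\<alpha> \<in> S'. count \<alpha> z \<noteq> e}"
  define S2 where "S2 = {\<alpha> \<in> S. c \<alpha> \<in> m}"
  define T where "T \<alpha> = c \<alpha> * x ^ (N - size \<alpha>) * prod_mset \<alpha>" for \<alpha>
  have fin: "finite S'" "finite S0" "finite S1" "finite S2"
    using Cons.prems(1) by (auto simp: S'_def S0_def S1_def S2_def)
  have "S' \<noteq> {}" using Cons.prems by (auto simp: S'_def)
  then have "e \<in> (\<lambda>\<alpha>. count \<alpha> z) ` S'" unfolding e_def by (intro Min_in) (use fin in auto)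
  then obtain \<alpha>1 where \<alpha>1: "\<alpha>1 \<in> S0" by (auto simp: S0_def)
  have ge: "e \<le> count \<alpha> z" if "\<alpha> \<in> S'" for \<alpha>
    unfolding e_def using fin that by (intro Min_le) auto
  have inS: "set_mset \<alpha> \<subseteq> set (z # zs)" "size \<alpha> \<le> N" "c \<alpha> \<in> A" if "\<alpha> \<in> S" for \<alpha>
    using Cons.prems(2)[OF that] by auto
  have inm: "set_mset \<alpha> \<subseteq> m" if "\<alpha> \<in> S" for \<alpha> using inS[OF that] Cons.prems(6) by auto
  have split: "\<alpha> = \<rho> k + (\<alpha> - \<rho> k)" if "k \<le> count \<alpha> z" for \<alpha> k
    using that unfolding \<rho>_def by (metis count_le_replicate_mset_subset_eq subset_mset.add_diff_inverse)
  have prod_split: "prod_mset \<alpha> = z ^ k * prod_mset (\<alpha> - \<rho> k)" "size \<alpha> = k + size (\<alpha> - \<rho> k)"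
    if "k \<le> count \<alpha> z" for \<alpha> k
  proof -
    have "prod_mset \<alpha> = prod_mset (\<rho> k + (\<alpha> - \<rho> k))" using split[OF that] by simp
    then show "prod_mset \<alpha> = z ^ k * prod_mset (\<alpha> - \<rho> k)" by (simp add: \<rho>_def)
    have "size \<alpha> = size (\<rho> k + (\<alpha> - \<rho> k))" using split[OF that] by simp
    then show "size \<alpha> = k + size (\<alpha> - \<rho> k)" by (simp add: \<rho>_def)
  qed
  have eN: "e \<le> N" using prod_split(2)[of e \<alpha>1] \<alpha>1 inS(2)[of \<alpha>1] by (auto simp: S0_def S'_def)
  define c' where "c' \<beta> = c (\<beta> + \<rho> e)" for \<beta>
  define W where "W = (\<lambda>\<alpha>. \<alpha> - \<rho> e) ` S0"
  define g where "g = (\<Sum>\<beta>\<in>W. c' \<beta> * x ^ ((N - e) - size \<beta>) * prod_mset \<beta>)"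
  have restore: "(\<alpha> - \<rho> e) + \<rho> e = \<alpha>" if "\<alpha> \<in> S0" for \<alpha>
    using split[of e \<alpha>] that by (simp add: S0_def add.commute)
  have "uform (zs @ [x]) (N - e) g"
    unfolding g_def
  proof (rule Cons.IH)
    show "finite W" using fin by (simp add: W_def)
    show "\<alpha>1 - \<rho> e \<in> W" using \<alpha>1 by (simp add: W_def)
    show "c' (\<alpha>1 - \<rho> e) \<notin> m" using restore[OF \<alpha>1] \<alpha>1 by (simp add: c'_def S0_def S'_def)
    show "x \<in> m" "set zs \<subseteq> m" using Cons.prems zm by auto
    fix \<beta> assume "\<beta> \<in> W"
    then obtain \<alpha> where \<alpha>: "\<alpha> \<in> S0" "\<beta> = \<alpha> - \<rho> e" by (auto simp: W_def)
    then have \<alpha>S: "\<alpha> \<in> S" "count \<alpha> z = e" by (auto simp: S0_def S'_def)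
    have "w \<in> set zs" if w: "w \<in># \<beta>" for w
    proof -
      have "w \<in> set (z # zs)" using w in_diffD[of w \<alpha> "\<rho> e"] inS(1)[OF \<alpha>S(1)] \<alpha>(2) by blast
      moreover have "count \<beta> z = 0" using \<alpha> \<alpha>S by (simp add: \<rho>_def)
      then have "w \<noteq> z" using w by (metis count_eq_zero_iff)
      ultimately show ?thesis by simp
    qed
    moreover have "size \<beta> \<le> N - e" using prod_split(2)[of e \<alpha>] \<alpha>S inS(2)[OF \<alpha>S(1)] \<alpha>(2) by simp
    moreover have "c' \<beta> \<in> A" using restore[OF \<alpha>(1)] \<alpha>(2) inS(3)[OF \<alpha>S(1)] by (simp add: c'_def)
    ultimately show "set_mset \<beta> \<subseteq> set zs \<and> size \<beta> \<le> N - e \<and> c' \<beta> \<in> A" by auto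
  qed
  moreover
  define h where "h = (\<Sum>\<alpha>\<in>S1. c \<alpha> * x ^ (N - size \<alpha>) * prod_mset (\<alpha> - \<rho> (Suc e)))"
  have gt: "Suc e \<le> count \<alpha> z" if "\<alpha> \<in> S1" for \<alpha> using ge[of \<alpha>] that by (auto simp: S1_def)
  have "h \<in> mpow (N - e - 1)"
    unfolding h_def
  proof (rule ideal_sum[OF mpow_ideal])
    fix \<alpha> assume \<alpha>: "\<alpha> \<in> S1"
    then have \<alpha>S: "\<alpha> \<in> S" by (auto simp: S1_def S'_def)
    have "set_mset (\<alpha> - \<rho> (Suc e)) \<subseteq> m" using inm[OF \<alpha>S] by (meson in_diffD subset_iff)
    then have "x ^ (N - size \<alpha>) * prod_mset (\<alpha> - \<rho> (Suc e)) \<in> mpow (N - size \<alpha> + size (\<alpha> - \<rho> (Suc e)))"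
      by (intro mpow_mult m_mem_pow Cons.prems prod_mset_mpow)
    moreover have "N - size \<alpha> + size (\<alpha> - \<rho> (Suc e)) = N - e - 1"
      using prod_split(2)[OF gt[OF \<alpha>]] inS(2)[OF \<alpha>S] by simp
    ultimately show "c \<alpha> * x ^ (N - size \<alpha>) * prod_mset (\<alpha> - \<rho> (Suc e)) \<in> mpow (N - e - 1)"
      using mpow_scale[OF inS(3)[OF \<alpha>S]] by (simp add: mult.assoc)
  qed
  moreover
  define r where "r = sum T S2"
  have "r \<in> mpow (Suc (e + (N - e)))"
    unfolding r_def
  proof (rule ideal_sum[OF mpow_ideal])
    fix \<alpha> assume "\<alpha> \<in> S2"
    then have \<alpha>S: "\<alpha> \<in> S" "c \<alpha> \<in> m" by (auto simp: S2_def)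
    have "x ^ (N - size \<alpha>) * prod_mset \<alpha> \<in> mpow (N - size \<alpha> + size \<alpha>)"
      by (intro mpow_mult m_mem_pow Cons.prems prod_mset_mpow inm \<alpha>S)
    then have "c \<alpha> * (x ^ (N - size \<alpha>) * prod_mset \<alpha>) \<in> mpow (Suc (N - size \<alpha> + size \<alpha>))"
      by (rule ideal_pow_Suc_mem[OF m_ideal \<alpha>S(2)])
    then show "T \<alpha> \<in> mpow (Suc (e + (N - e)))"
      using inS(2)[OF \<alpha>S(1)] eN by (simp add: T_def mult.assoc)
  qed
  ultimately have U: "uform (z # zs @ [x]) (e + (N - e)) (z ^ e * (g + z * h) + r)"
    by (rule uform_Cons)
  have "inj_on (\<lambda>\<alpha>. \<alpha> - \<rho> e) S0" by (rule inj_on_inverseI[of _ "\<lambda>\<beta>. \<beta> + \<rho> e"]) (rule restore)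
  then have "g = (\<Sum>\<alpha>\<in>S0. c' (\<alpha> - \<rho> e) * x ^ ((N - e) - size (\<alpha> - \<rho> e)) * prod_mset (\<alpha> - \<rho> e))"
    unfolding g_def W_def by (subst sum.reindex) (auto simp: o_def)
  then have "z ^ e * g = (\<Sum>\<alpha>\<in>S0. z ^ e * (c' (\<alpha> - \<rho> e) * x ^ ((N - e) - size (\<alpha> - \<rho> e)) * prod_mset (\<alpha> - \<rho> e)))"
    by (simp add: sum_distrib_left)
  also have "\<dots> = sum T S0"
  proof (rule sum.cong[OF refl])
    fix \<alpha> assume \<alpha>: "\<alpha> \<in> S0"
    then have ce: "e \<le> count \<alpha> z" by (simp add: S0_def)
    have "(N - e) - size (\<alpha> - \<rho> e) = N - size \<alpha>" using prod_split(2)[OF ce] by simp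
    then show "z ^ e * (c' (\<alpha> - \<rho> e) * x ^ ((N - e) - size (\<alpha> - \<rho> e)) * prod_mset (\<alpha> - \<rho> e)) = T \<alpha>"
      using prod_split(1)[OF ce] restore[OF \<alpha>] by (simp add: T_def c'_def ac_simps)
  qed
  finally have 1: "z ^ e * g = sum T S0" .
  have "z ^ e * (z * h) = (\<Sum>\<alpha>\<in>S1. z ^ Suc e * (c \<alpha> * x ^ (N - size \<alpha>) * prod_mset (\<alpha> - \<rho> (Suc e))))"
    unfolding h_def by (simp add: sum_distrib_left ac_simps)
  also have "\<dots> = sum T S1"
  proof (rule sum.cong[OF refl])
    fix \<alpha> assume \<alpha>: "\<alpha> \<in> S1"
    show "z ^ Suc e * (c \<alpha> * x ^ (N - size \<alpha>) * prod_mset (\<alpha> - \<rho> (Suc e))) = T \<alpha>"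
      unfolding T_def prod_split(1)[OF gt[OF \<alpha>]] by (simp add: ac_simps)
  qed
  finally have 2: "z ^ e * (z * h) = sum T S1" .
  have "sum T S = sum T (S0 \<union> S1 \<union> S2)"
    by (rule arg_cong[of _ _ "sum T"]) (auto simp: S0_def S1_def S2_def S'_def)
  also have "\<dots> = sum T S0 + sum T S1 + sum T S2"
    using fin by (subst sum.union_disjoint, auto simp: S0_def S1_def S2_def S'_def)+
  finally have "sum T S = z ^ e * (g + z * h) + r" using 1 2 by (simp add: r_def distrib_left)
  then show ?case using U eN by (simp add: T_def)
qed

end

locale quad_transform = reg_local A m d + A': reg_local A' m' d'
  for A m :: "'a::field set" and d and A' m' :: "'a set" and d' +
  fixes x :: 'a and q :: "'a set"
  assumes x_m: "x \<in> m" and x_m2: "x \<notin> mpow 2"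
    and q_prime: "prime_ideal (ring_adjoin A {y / x | y. y \<in> m}) q" and m_q: "m \<subseteq> q"
    and A'_eq: "A' = localization (ring_adjoin A {y / x | y. y \<in> m}) q"
begin

abbreviation "B \<equiv> ring_adjoin A {y / x | y. y \<in> m}"

lemma x0 [simp]: "x \<noteq> 0"
  using x_m2 by auto

lemma x_A: "x \<in> A"
  using x_m m_sub by auto

lemma ord_x: "ord A x = 1"
  using x_m x_m2 by (intro ord_eqI) (auto simp: numeral_2_eq_2)

sublocale B: field_subring B
  by unfold_locales (rule subring_ring_adjoin)

lemma mpow_B: "f \<in> mpow n \<Longrightarrow> f / x ^ n \<in> B"
proof (induction n arbitrary: f)
  case 0
  then show ?case using ring_adjoin_sub(1)[of A] by auto
next
  case (Suc n)
  have "ideal A {f \<in> A. f / x ^ Suc n \<in> B}"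
    unfolding ideal_def
  proof (intro conjI ballI)
    fix a f assume "a \<in> A" "f \<in> {f \<in> A. f / x ^ Suc n \<in> B}"
    then have "a * (f / x ^ Suc n) \<in> B" "a * f \<in> A" using ring_adjoin_sub(1)[of A] by blast+
    then show "a * f \<in> {f \<in> A. f / x ^ Suc n \<in> B}" by simp
  next
    fix f g assume "f \<in> {f \<in> A. f / x ^ Suc n \<in> B}" "g \<in> {f \<in> A. f / x ^ Suc n \<in> B}"
    then have "f / x ^ Suc n + g / x ^ Suc n \<in> B" "f + g \<in> A" by blast+
    then show "f + g \<in> {f \<in> A. f / x ^ Suc n \<in> B}" by (simp add: add_divide_distrib)
  qed auto
  then have "mpow (Suc n) \<subseteq> {f \<in> A. f / x ^ Suc n \<in> B}"
  proof (rule ideal_pow_Suc_least[OF _ m_ideal])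
    fix a u assume a: "a \<in> m" "u \<in> mpow n"
    then have "(a / x) * (u / x ^ n) \<in> B" using Suc.IH ring_adjoin_sub(2)[of "{y / x | y. y \<in> m}" A] by blast
    then show "a * u \<in> {f \<in> A. f / x ^ Suc n \<in> B}" using a mpow_A m_sub by auto
  qed
  then show ?case using Suc.prems by blast
qed

lemma B_eq: "B = {f / x ^ n | f n. f \<in> mpow n}"
proof
  define C where "C = {f / x ^ n | f n. f \<in> mpow n}"
  show "{f / x ^ n | f n. f \<in> mpow n} \<subseteq> B" using mpow_B by blast
  have CI: "f / x ^ n \<in> C" if "f \<in> mpow n" for f n using that by (auto simp: C_def)
  have "subring C"
    unfolding subring_def
  proof (intro conjI ballI)
    show "0 \<in> C" "1 \<in> C" using CI[of 0 0] CI[of 1 0] by auto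
    fix a b assume "a \<in> C" "b \<in> C"
    then obtain f n g k where h: "f \<in> mpow n" "a = f / x ^ n" "g \<in> mpow k" "b = g / x ^ k" unfolding C_def by blast
    have "f * x ^ k \<in> mpow (n + k)" by (rule mpow_mult[OF h(1) m_mem_pow[OF x_m]])
    moreover have "x ^ n * g \<in> mpow (n + k)" by (rule mpow_mult[OF m_mem_pow[OF x_m] h(3)])
    ultimately have "f * x ^ k + x ^ n * g \<in> mpow (n + k)" by (rule mpow_add)
    from CI[OF this] have "(f * x ^ k + x ^ n * g) / x ^ (n + k) \<in> C" .
    moreover have "(f * x ^ k + x ^ n * g) / x ^ (n + k) = a + b"
      unfolding h by (simp add: power_add add_divide_distrib)
    ultimately show "a + b \<in> C" by simp
    from CI[OF mpow_mult[OF h(1,3)]] show "a * b \<in> C" using h by (simp add: power_add)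
    from CI[OF mpow_neg[OF h(1)]] show "- a \<in> C" using h by simp
  qed
  moreover have "A \<union> {y / x | y. y \<in> m} \<subseteq> C"
    using CI[of _ 0] CI[of _ "Suc 0"] by auto
  ultimately show "B \<subseteq> {f / x ^ n | f n. f \<in> mpow n}" unfolding ring_adjoin_def C_def by blast
qed

lemma B_A': "B \<subseteq> A'"
  unfolding A'_eq by (rule B.localization_sub[OF q_prime])

lemma A_A': "A \<subseteq> A'"
  using B_A' ring_adjoin_sub(1)[of A] by blast

lemma mpow_A': "f \<in> mpow n \<Longrightarrow> f / x ^ n \<in> A'"
  using mpow_B B_A' by blast

lemma B_q_iff: "b \<in> B \<Longrightarrow> b \<in> m' \<longleftrightarrow> b \<in> q"
proof
  assume b: "b \<in> B" and "b \<in> m'"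
  show "b \<in> q"
  proof (rule ccontr)
    assume n: "b \<notin> q"
    then have "inverse b \<in> A'" unfolding A'_eq by (rule B.localization_inverse[OF q_prime b])
    then have "inverse b * b \<in> m'" using \<open>b \<in> m'\<close> by (rule idealD(4)[OF A'.m_ideal])
    then show False using B.notin_prime_nonzero[OF q_prime n] A'.one_notin by simp
  qed
next
  assume b: "b \<in> B" and bq: "b \<in> q"
  show "b \<in> m'"
  proof (rule ccontr)
    assume n: "b \<notin> m'"
    then have "b \<noteq> 0" by auto
    have "inverse b \<in> A'" using A'.unit n b B_A' by blast
    then obtain c s where cs: "c \<in> B" "s \<in> B" "s \<notin> q" "inverse b = c / s" unfolding A'_eq localization_def by blast
    then have "s = c * b" using \<open>b \<noteq> 0\<close> B.notin_prime_nonzero[OF q_prime] by (simp add: field_simps)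
    then show False using idealD(4)[OF prime_idealD(1)[OF q_prime] cs(1) bq] cs(3) by simp
  qed
qed

lemma m_m': "m \<subseteq> m'"
proof
  fix u assume "u \<in> m"
  then have "u \<in> B" "u \<in> q" using m_q m_sub ring_adjoin_sub(1)[of A] by blast+
  then show "u \<in> m'" using B_q_iff by blast
qed

lemma m'_A: "a \<in> A \<Longrightarrow> a \<in> m' \<longleftrightarrow> a \<in> m"
proof
  assume a: "a \<in> A" "a \<in> m'"
  show "a \<in> m"
  proof (rule ccontr)
    assume n: "a \<notin> m"
    then have "inverse a \<in> A'" using unit a A_A' by blast
    then have "inverse a * a \<in> m'" using a(2) by (rule idealD(4)[OF A'.m_ideal])
    then show False using n A'.one_notin by (cases "a = 0") auto
  qed
qed (use m_m' in blast)

text \<open>Numerator and denominator are brought to a common degree N by powers of x. The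
  denominator s has order exactly N because x lies in \<open>q\<close> while s / x^N does not; this
  is why A' lies in the order valuation ring of A.\<close>

lemma A'_rep:
  assumes "w \<in> A'"
  obtains f s N where "f \<in> mpow N" "s \<in> mpow N" "s \<noteq> 0" "ord A s = N" "s / x ^ N \<notin> m'" "w = f / s"
proof -
  obtain b c where bc: "b \<in> B" "c \<in> B" "c \<notin> q" "w = b / c" using assms unfolding A'_eq localization_def by blast
  obtain f n where f: "f \<in> mpow n" "b = f / x ^ n" using bc(1) unfolding B_eq by blast
  obtain g k where g: "g \<in> mpow k" "c = g / x ^ k" using bc(2) unfolding B_eq by blast
  define N where "N = n + k"
  define s where "s = x ^ n * g"
  have c: "s / x ^ N = c" unfolding s_def N_def g(2) by (simp add: power_add)
  have F: "f * x ^ k \<in> mpow N" unfolding N_def by (rule mpow_mult[OF f(1) m_mem_pow[OF x_m]])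
  have s: "s \<in> mpow N" unfolding N_def s_def by (rule mpow_mult[OF m_mem_pow[OF x_m] g(1)])
  have c0: "c \<noteq> 0" using B.notin_prime_nonzero[OF q_prime bc(3)] .
  then have s0: "s \<noteq> 0" using c by auto
  have "s \<notin> mpow (Suc N)"
  proof
    assume "s \<in> mpow (Suc N)"
    then have "s / x ^ Suc N \<in> B" by (rule mpow_B)
    then have "s / x ^ Suc N * x \<in> q" using x_m m_q by (intro idealD(4)[OF prime_idealD(1)[OF q_prime]]) auto
    then show False using c bc(3) by simp
  qed
  then have "ord A s = N" by (rule ord_eqI[OF s])
  moreover have "s / x ^ N \<notin> m'" using c bc B_q_iff by simp
  moreover have "w = (f * x ^ k) / s" using bc(4) f(2) g(2) c0 by (simp add: s_def field_simps)
  ultimately show ?thesis using that F s s0 by blast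
qed

lemma unit_A': "s \<in> mpow N \<Longrightarrow> s / x ^ N \<notin> m' \<Longrightarrow> x ^ N / s \<in> A'"
  using A'.unit[OF mpow_A', of s N] by simp

lemma ordF_nonneg: "w \<in> A' \<Longrightarrow> w \<noteq> 0 \<Longrightarrow> 0 \<le> ordF A w"
proof -
  assume w: "w \<in> A'" "w \<noteq> 0"
  then obtain f s N where h: "f \<in> mpow N" "s \<in> mpow N" "s \<noteq> 0" "ord A s = N" "w = f / s" by (metis A'_rep)
  then have f: "f \<in> A" "f \<noteq> 0" using w mpow_A by auto
  then have "N \<le> ord A f" using ord_le_iff h(1) by blast
  then show ?thesis using h f mpow_A[OF h(2)] by (simp add: ordF_divide)
qed

text \<open>The numerator has order at least N + k, where N is the order of the denominator s, and
  x^N / s lies in A'. With \<open>ordF_nonneg\<close> it follows that on A' the order of A is the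
  exponent of x.\<close>

lemma div_x_pow: 
  assumes w: "w \<in> A'" "w \<noteq> 0" "int k \<le> ordF A w"
  shows "w / x ^ k \<in> A'"
proof -
  obtain f s N where h: "f \<in> mpow N" "s \<in> mpow N" "s \<noteq> 0" "ord A s = N" "s / x ^ N \<notin> m'" "w = f / s"
    using A'_rep[OF w(1)] by blast
  then have f: "f \<in> A" "f \<noteq> 0" using w mpow_A by auto
  then have "N + k \<le> ord A f" using w(3) h mpow_A[OF h(2)] by (simp add: ordF_divide)
  then have "f / x ^ (N + k) \<in> A'" using f by (intro mpow_A') (simp add: ord_le_iff)
  then have "f / x ^ (N + k) * (x ^ N / s) \<in> A'" using unit_A'[OF h(2,5)] by blast
  then show ?thesis using h by (simp add: power_add mult.commute)
qed

lemma strict_A': "f \<in> A \<Longrightarrow> f \<noteq> 0 \<Longrightarrow> k \<le> ord A f \<Longrightarrow> f / x ^ k \<in> A'"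
  by (intro mpow_A') (simp add: ord_le_iff)

lemma ordF_x: "ordF A x = 1"
  using ordF_of[OF x_A] ord_x by simp

section \<open>Elements of the transform as values of polynomials in the fractions z / x\<close>

context
  fixes zs assumes p: "params (x # zs)"
begin

text \<open>Polynomials over \<open>A\<close> in the variables \<open>zs\<close>. A parameter z
  serves as the name of the indeterminate whose value is z / x.\<close>

definition good :: "('a multiset \<Rightarrow>\<^sub>0 'a) \<Rightarrow> bool" where
  "good P \<longleftrightarrow> coeffs_in (\<lambda>\<alpha>. if set_mset \<alpha> \<subseteq> set zs then A else {0}) P"

text \<open>The value \<open>0\<close> outside \<open>zs\<close> makes \<open>yv z \<in> A'\<close> hold without side conditions.\<close>

definition yv :: "'a \<Rightarrow> 'a" where
  "yv z = (if z \<in> set zs then z / x else 0)"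

abbreviation "ev \<equiv> peval yv"
abbreviation "sh \<equiv> shift yv"

lemma good_iff: "good P \<longleftrightarrow> (\<forall>\<alpha>. coef P \<alpha> \<in> A \<and> (\<not> set_mset \<alpha> \<subseteq> set zs \<longrightarrow> coef P \<alpha> = 0))"
proof -
  have "c \<in> (if b then A else {0}) \<longleftrightarrow> c \<in> A \<and> (\<not> b \<longrightarrow> c = 0)" for b c by auto
  then show ?thesis by (simp only: good_def coeffs_in_def)
qed

lemma goodD: "good P \<Longrightarrow> coef P \<alpha> \<in> A" "good P \<Longrightarrow> \<alpha> \<in> supp P \<Longrightarrow> set_mset \<alpha> \<subseteq> set zs"
  unfolding good_iff in_keys_iff by blast+

lemma zs_m: "set zs \<subseteq> m" "set zs \<subseteq> A"
  using paramsD(1,4)[OF p] by auto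

lemma good_mult: "good P \<Longrightarrow> good Q \<Longrightarrow> good (P * Q)"
  unfolding good_def by (rule coeffs_in_mult) (auto split: if_splits)

lemma good_add: "good P \<Longrightarrow> good Q \<Longrightarrow> good (P + Q)"
  unfolding good_iff lookup_add by (simp add: add_mem)

lemma good_diff: "good P \<Longrightarrow> good Q \<Longrightarrow> good (P - Q)"
  unfolding good_iff lookup_minus by (simp add: diff_mem)

lemma good_const: "a \<in> A \<Longrightarrow> good (mono_term 0 a)"
  unfolding good_def coeffs_in_def by (auto simp: lookup_single when_def)

lemma good_var: "z \<in> set zs \<Longrightarrow> good (mono_term {#z#} 1)"
  unfolding good_def coeffs_in_def by (auto simp: lookup_single when_def)

text \<open>Since m is generated by x and \<open>zs\<close>, each factor from m contributes, after
  division by x, a polynomial of degree at most 1. The degree bound is what later limits the order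
  of a strict transform.\<close>

lemma mpow_poly: "f \<in> mpow n \<Longrightarrow> \<exists>P. good P \<and> deg_le n P \<and> ev P = f / x ^ n"
proof -
  define G where "G n = {f \<in> A. \<exists>P. good P \<and> deg_le n P \<and> ev P = f / x ^ n}" for n
  have const_deg: "deg_le n (mono_term (0 :: 'a multiset) a)" for n and a :: 'a
    by (auto simp: deg_le_iff lookup_single when_def)
  have GI: "ideal A (G n)" for n
    unfolding ideal_def
  proof (intro conjI ballI)
    have "good 0 \<and> deg_le n (0 :: 'a multiset \<Rightarrow>\<^sub>0 'a) \<and> ev 0 = 0 / x ^ n"
      using good_const[of 0] by (simp add: deg_le_iff)
    then show "0 \<in> G n" unfolding G_def by blast
  next
    fix f g assume "f \<in> G n" "g \<in> G n"
    then obtain P Q where h: "f \<in> A" "good P" "deg_le n P" "ev P = f / x ^ n" "g \<in> A" "good Q" "deg_le n Q" "ev Q = g / x ^ n"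
      unfolding G_def by blast
    then have "good (P + Q) \<and> deg_le n (P + Q) \<and> ev (P + Q) = (f + g) / x ^ n"
      by (simp add: good_add deg_le_add peval_add add_divide_distrib)
    then show "f + g \<in> G n" unfolding G_def using h by blast
  next
    fix a f assume "a \<in> A" "f \<in> G n"
    then obtain P where h: "a \<in> A" "f \<in> A" "good P" "deg_le n P" "ev P = f / x ^ n" unfolding G_def by blast
    then have "good (mono_term 0 a * P) \<and> deg_le n (mono_term 0 a * P) \<and> ev (mono_term 0 a * P) = (a * f) / x ^ n"
      using deg_le_mult[OF const_deg[of 0 a] h(4)] by (simp add: good_mult good_const peval_mult peval_const)
    then show "a * f \<in> G n" unfolding G_def using h by blast
  qed (auto simp: G_def)
  have m1: "m \<subseteq> G 1"
  proof -
    have "lin A (x # zs) \<subseteq> G 1"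
    proof (rule lin_least[OF GI])
      have "good (mono_term 0 1) \<and> deg_le 1 (mono_term 0 1 :: 'a multiset \<Rightarrow>\<^sub>0 'a) \<and> ev (mono_term 0 1) = x / x ^ 1"
        using good_const[of 1] const_deg[of 1 1] by simp
      then have "x \<in> G 1" unfolding G_def using x_A by blast
      moreover have "z \<in> G 1" if z: "z \<in> set zs" for z
      proof -
        have "good (mono_term {#z#} 1) \<and> deg_le 1 (mono_term {#z#} 1 :: 'a multiset \<Rightarrow>\<^sub>0 'a) \<and> ev (mono_term {#z#} 1) = z / x ^ 1"
          using good_var[OF z] z by (auto simp: peval_var yv_def deg_le_iff lookup_single when_def)
        then show ?thesis unfolding G_def using zs_m z by blast
      qed
      ultimately show "set (x # zs) \<subseteq> G 1" by auto
    qed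
    then show ?thesis using paramsD(3)[OF p] by simp
  qed
  have "mpow n \<subseteq> G n" for n
  proof (induction n)
    case 0
    show ?case
    proof
      fix a assume "a \<in> mpow 0"
      then have a: "a \<in> A" by simp
      then have "good (mono_term 0 a) \<and> deg_le 0 (mono_term (0 :: 'a multiset) a) \<and> ev (mono_term 0 a) = a / x ^ 0"
        using good_const const_deg[of 0 a] by (simp add: peval_const)
      then show "a \<in> G 0" unfolding G_def using a by blast
    qed
  next
    case (Suc n)
    show ?case
    proof (rule ideal_pow_Suc_least[OF GI m_ideal])
      fix a u assume a: "a \<in> m" and u: "u \<in> mpow n"
      obtain P where P: "good P" "deg_le 1 P" "ev P = a / x ^ 1" using a m1 unfolding G_def by blast
      obtain Q where Q: "good Q" "deg_le n Q" "ev Q = u / x ^ n" using u Suc unfolding G_def by blast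
      have "good (P * Q) \<and> deg_le (Suc n) (P * Q) \<and> ev (P * Q) = (a * u) / x ^ Suc n"
        using P Q deg_le_mult[OF P(2) Q(2)] by (simp add: good_mult peval_mult)
      moreover have "a * u \<in> A" using a u m_sub mpow_A by auto
      ultimately show "a * u \<in> G (Suc n)" unfolding G_def by blast
    qed
  qed
  moreover assume "f \<in> mpow n"
  ultimately show ?thesis unfolding G_def by blast
qed

lemma ev_homog:
  assumes "deg_le n P" and P: "good P"
  shows "x ^ n * ev P = (\<Sum>\<alpha>\<in>supp P. coef P \<alpha> * x ^ (n - size \<alpha>) * prod_mset \<alpha>)"
  unfolding peval_eq sum_distrib_left
proof (rule sum.cong[OF refl])
  fix \<alpha> assume \<alpha>: "\<alpha> \<in> supp P"
  then have "size \<alpha> \<le> n" using assms(1) by (meson deg_le_iff in_keys_iff not_le)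
  then have "x ^ n = x ^ (n - size \<alpha>) * x ^ size \<alpha>" by (simp flip: power_add)
  moreover have "x ^ size \<alpha> * (\<Prod>z\<in>#\<alpha>. yv z) = prod_mset \<alpha>"
    using goodD(2)[OF P \<alpha>] by (induction \<alpha>) (simp_all add: yv_def)
  ultimately show "x ^ n * (coef P \<alpha> * (\<Prod>z\<in>#\<alpha>. yv z)) = coef P \<alpha> * x ^ (n - size \<alpha>) * prod_mset \<alpha>"
    by (metis mult.assoc mult.left_commute)
qed

text \<open>A relation with a coefficient outside \<open>m\<close> would, after homogenization by x,
  be a nonzero leading form with value 0, contradicting the independence of the parameters.\<close>

lemma ev_zero_coeffs:
  assumes P: "good P" "ev P = 0"
  shows "coef P \<alpha> \<in> m"
proof (rule ccontr)
  assume n: "coef P \<alpha> \<notin> m"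
  obtain N where N: "deg_le N P" using deg_le_ex by blast
  have "params ([] @ zs @ [x])"
    using p lin_eqI[of "zs @ [x]" "x # zs"] zs_m x_m x_A by (auto simp: params_def)
  moreover have "uform (zs @ [x]) N (\<Sum>\<alpha>\<in>supp P. coef P \<alpha> * x ^ (N - size \<alpha>) * prod_mset \<alpha>)"
  proof (rule uform_sum)
    have "coef P \<alpha> \<noteq> 0" using n by auto
    then show "\<alpha> \<in> supp P" by (simp add: in_keys_iff)
    fix \<beta> assume \<beta>: "\<beta> \<in> supp P"
    then have "size \<beta> \<le> N" using N by (meson deg_le_iff in_keys_iff not_le)
    then show "set_mset \<beta> \<subseteq> set zs \<and> size \<beta> \<le> N \<and> coef P \<beta> \<in> A" using goodD[OF P(1)] \<beta> by blast
  qed (use n x_m zs_m in auto)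
  then have "uform (zs @ [x]) N 0" using ev_homog[OF N P(1)] P(2) by simp
  ultimately show False using uform_independent[of "[]" "zs @ [x]" N 0] by simp
qed

lemma yv_A': "yv z \<in> A'"
  using mpow_A'[of z 1] zs_m by (auto simp: yv_def)

lemma low_ideal: "ideal A' (if size \<alpha> < n then m' else A')"
  using A'.m_ideal by simp

text \<open>Over the residue field of A' the polynomial has no terms of degree below
  \<open>n\<close>, that is, it vanishes to order \<open>n\<close> at the origin.\<close>

definition low :: "nat \<Rightarrow> ('a multiset \<Rightarrow>\<^sub>0 'a) \<Rightarrow> bool" where
  "low n P \<longleftrightarrow> coeffs_in (\<lambda>\<alpha>. if size \<alpha> < n then m' else A') P"

lemma low_mult:
  assumes "low n P" "low k Q" shows "low (n + k) (P * Q)"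
  unfolding low_def
proof (rule coeffs_in_mult[OF assms[unfolded low_def]])
  show "a + b \<in> (if size \<gamma> < n + k then m' else A')"
    if "a \<in> (if size \<gamma> < n + k then m' else A')" "b \<in> (if size \<gamma> < n + k then m' else A')" for \<gamma> :: "'a multiset" and a b
    by (rule idealD(3)[OF low_ideal that])
  show "0 \<in> (if size \<gamma> < n + k then m' else A')" for \<gamma> :: "'a multiset"
    by (rule idealD(2)[OF low_ideal])
next
  fix \<alpha> \<beta> :: "'a multiset" and a b
  assume h: "a \<in> (if size \<alpha> < n then m' else A')" "b \<in> (if size \<beta> < k then m' else A')"
  then have A: "a \<in> A'" "b \<in> A'" using A'.m_sub by (auto split: if_splits)
  show "a * b \<in> (if size (\<alpha> + \<beta>) < n + k then m' else A')"
  proof (cases "size (\<alpha> + \<beta>) < n + k")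
    case True
    then consider "size \<alpha> < n" | "size \<beta> < k" by fastforce
    then have "a * b \<in> m'"
      by cases (use h A idealD(4,5)[OF A'.m_ideal] in auto)
    then show ?thesis using True by simp
  qed (use A in auto)
qed

lemma low_add: "low n P \<Longrightarrow> low n Q \<Longrightarrow> low n (P + Q)"
  unfolding low_def coeffs_in_def lookup_add using idealD(3)[OF low_ideal] by blast

lemma low_diff: "low n P \<Longrightarrow> low n Q \<Longrightarrow> low n (P - Q)"
  unfolding low_def coeffs_in_def lookup_minus using A'.ideal_diff[OF low_ideal] by blast

lemma low_mono: "low n P \<Longrightarrow> k \<le> n \<Longrightarrow> low k P"
  unfolding low_def coeffs_in_def using A'.m_sub by (fastforce split: if_splits)

lemma low_const: "a \<in> A' \<Longrightarrow> low 0 (mono_term 0 a)"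
  unfolding low_def coeffs_in_def by (auto simp: lookup_single when_def)

lemma low_sh: "good P \<Longrightarrow> low 0 (sh P)"
  unfolding low_def coeffs_in_def
  using shift_coeffs_in[OF A'.field_subring_axioms A'.ideal_self, of P yv] yv_A' goodD(1)[of P] A_A'
  by (simp add: subset_iff)

lemma low_1I: "low 0 P \<Longrightarrow> coef P 0 \<in> m' \<Longrightarrow> low 1 P"
  unfolding low_def coeffs_in_def by auto

text \<open>Up to the unit \<open>ev P\<close>, an element of A' is a value \<open>ev Q\<close>. If
  it lies in \<open>m'\<close>, the constant Taylor coefficient of Q does too, so the expansion
  vanishes to order 1 modulo \<open>m'\<close>, and vanishing orders add under products.\<close>

lemma mpow'_rep:
  assumes "w \<in> A'.mpow n"
  shows "\<exists>P Q. good P \<and> good Q \<and> ev P \<notin> m' \<and> ev P * w = ev Q \<and> low n (sh Q)"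
proof -
  define H where "H n = {w \<in> A'. \<exists>P Q. good P \<and> good Q \<and> ev P \<notin> m' \<and> ev P * w = ev Q \<and> low n (sh Q)}" for n
  have evA': "ev P \<in> A'" if "good P" for P
    using low_sh[OF that] unfolding peval_def low_def coeffs_in_def by auto
  have unitmult: "ev (P * Q) \<notin> m'" if "good P" "good Q" "ev P \<notin> m'" "ev Q \<notin> m'" for P Q
    using A'.prime_mult_notin[OF A'.prime_m] evA' that by (simp add: peval_mult)
  have repA': "\<exists>P Q. good P \<and> good Q \<and> ev P \<notin> m' \<and> ev P * w = ev Q" if w: "w \<in> A'" for w
  proof -
    obtain f s N where h: "f \<in> mpow N" "s \<in> mpow N" "s \<noteq> 0" "s / x ^ N \<notin> m'" "w = f / s" using A'_rep[OF w] by metis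
    obtain P where P: "good P" "ev P = s / x ^ N" using mpow_poly[OF h(2)] by blast
    obtain Q where Q: "good Q" "ev Q = f / x ^ N" using mpow_poly[OF h(1)] by blast
    have "ev P * w = ev Q" using P Q h by simp
    then show ?thesis using P Q h(4) by metis
  qed
  have HI: "ideal A' (H n)" for n
    unfolding ideal_def
  proof (intro conjI ballI)
    have z: "good (mono_term 0 0)" "ev (mono_term 0 0) = 0" "low n (sh (mono_term 0 0))" "good (mono_term 0 1)" "ev (mono_term 0 1) = 1"
      using good_const[of 0] good_const[of 1] peval_const[of _ 1] peval_const[of _ 0]
      by (auto simp: low_def coeffs_in_def)
    then show "0 \<in> H n" unfolding H_def using A'.one_notin
      by (intro CollectI conjI exI[of _ "mono_term 0 1"] exI[of _ "mono_term 0 0"]) auto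
  next
    fix v w assume "v \<in> H n" "w \<in> H n"
    then obtain P Q P' Q' where h: "v \<in> A'" "good P" "good Q" "ev P \<notin> m'" "ev P * v = ev Q" "low n (sh Q)"
      "w \<in> A'" "good P'" "good Q'" "ev P' \<notin> m'" "ev P' * w = ev Q'" "low n (sh Q')" unfolding H_def by blast
    have "low n (sh (Q * P' + Q' * P))"
      using low_add[OF low_mult[OF h(6) low_sh[OF h(8)]] low_mult[OF h(12) low_sh[OF h(2)]]]
      by (simp add: shift_add shift_mult)
    moreover have "ev (P * P') * (v + w) = ev (Q * P' + Q' * P)"
    proof -
      have "ev (P * P') * (v + w) = (ev P * v) * ev P' + (ev P' * w) * ev P"
        by (simp add: peval_mult algebra_simps)
      then show ?thesis using h by (simp add: peval_mult peval_add)
    qed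
    moreover have "good (P * P')" "good (Q * P' + Q' * P)" "ev (P * P') \<notin> m'" "v + w \<in> A'"
      using h good_mult good_add unitmult by auto
    ultimately show "v + w \<in> H n" unfolding H_def by blast
  next
    fix a w assume a: "a \<in> A'" and "w \<in> H n"
    then obtain P Q where h: "w \<in> A'" "good P" "good Q" "ev P \<notin> m'" "ev P * w = ev Q" "low n (sh Q)" unfolding H_def by blast
    obtain P' Q' where h': "good P'" "good Q'" "ev P' \<notin> m'" "ev P' * a = ev Q'" using repA'[OF a] by blast
    have "low n (sh (Q * Q'))" using low_mult[OF h(6) low_sh[OF h'(2)]] by (simp add: shift_mult)
    moreover have "ev (P * P') * (a * w) = ev (Q * Q')"
    proof -
      have "ev (P * P') * (a * w) = (ev P * w) * (ev P' * a)" by (simp add: peval_mult ac_simps)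
      then show ?thesis using h h' by (simp add: peval_mult)
    qed
    moreover have "good (P * P')" "good (Q * Q')" "ev (P * P') \<notin> m'" "a * w \<in> A'"
      using h h' a good_mult unitmult by auto
    ultimately show "a * w \<in> H n" unfolding H_def by blast
  qed (auto simp: H_def)
  have step: "a * w \<in> H (Suc k)" if aw: "a \<in> m'" "w \<in> H k" for a w k
  proof -
    obtain P Q where h: "w \<in> A'" "good P" "good Q" "ev P \<notin> m'" "ev P * w = ev Q" "low k (sh Q)" using aw(2) unfolding H_def by blast
    have aA: "a \<in> A'" using aw A'.m_sub by blast
    obtain P' Q' where h': "good P'" "good Q'" "ev P' \<notin> m'" "ev P' * a = ev Q'" using repA'[OF aA] by blast
    have "ev Q' \<in> m'" using idealD(4)[OF A'.m_ideal evA'[OF h'(1)] aw(1)] h'(4) by simp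
    then have "low 1 (sh Q')" using low_sh[OF h'(2)] by (intro low_1I) (auto simp: peval_def)
    then have "low (Suc k) (sh (Q' * Q))" using low_mult[OF _ h(6), of 1] by (simp add: shift_mult)
    moreover have "ev (P * P') * (a * w) = ev (Q' * Q)"
    proof -
      have "ev (P * P') * (a * w) = (ev P' * a) * (ev P * w)" by (simp add: peval_mult ac_simps)
      then show ?thesis using h h' by (simp add: peval_mult)
    qed
    moreover have "good (P * P')" "good (Q' * Q)" "ev (P * P') \<notin> m'" "a * w \<in> A'"
      using h h' aA good_mult unitmult by auto
    ultimately show ?thesis unfolding H_def by blast
  qed
  have "A'.mpow n \<subseteq> H n"
  proof (induction n)
    case 0
    show ?case
    proof
      fix w assume "w \<in> A'.mpow 0"
      then have w: "w \<in> A'" by simp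
      then show "w \<in> H 0" using repA'[OF w] low_sh unfolding H_def by blast
    qed
  next
    case (Suc n)
    show ?case by (rule A'.ideal_pow_Suc_least[OF HI A'.m_ideal]) (use step Suc in blast)
  qed
  then show ?thesis using assms unfolding H_def by blast
qed

text \<open>Modulo \<open>x\<close>, the ring \<open>B\<close> is a polynomial ring over the residue field of \<open>A\<close>. Shifting a polynomial
  by the centre \<open>yv\<close> turns elements of the \<open>n\<close>-th power of \<open>m'\<close> into polynomials over the residue field of
  \<open>A'\<close> without terms of degree below \<open>n\<close>, while degrees are preserved. So a nonzero polynomial of degree at most
  \<open>r\<close> has order at most \<open>r\<close>.\<close>

lemma ord_strict_le_aux:
  assumes f: "f \<in> A" "f \<noteq> 0"
  shows "ord A' (f / x ^ ord A f) \<le> ord A f"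
proof -
  define r where "r = ord A f"
  have fr: "f \<in> mpow r" "f \<notin> mpow (Suc r)" using ord_mem[OF f] by (auto simp: r_def)
  have gA: "f / x ^ r \<in> A'" "f / x ^ r \<noteq> 0" using mpow_A'[OF fr(1)] f by auto
  have "f / x ^ r \<notin> A'.mpow (Suc r)"
  proof
    assume "f / x ^ r \<in> A'.mpow (Suc r)"
    then obtain Ps Q where PQ: "good Ps" "good Q" "ev Ps \<notin> m'" "ev Ps * (f / x ^ r) = ev Q" "low (Suc r) (sh Q)"
      using mpow'_rep by blast
    obtain P where P: "good P" "deg_le r P" "ev P = f / x ^ r" using mpow_poly[OF fr(1)] by blast
    \<comment> \<open>D has value 0, hence coefficients in \<open>m\<close>; it disappears modulo
      \<open>m'\<close>, and the product of the shifted \<open>Ps\<close> and \<open>P\<close>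
      inherits the low-degree vanishing of the shifted Q.\<close>
    define D where "D = Ps * P - Q"
    have D: "good D" unfolding D_def by (intro good_diff good_mult PQ P)
    have "ev D = 0" using PQ(4) P(3) by (simp add: D_def peval_diff peval_mult)
    then have "coef D \<alpha> \<in> m'" for \<alpha> using ev_zero_coeffs[OF D] m_m' by blast
    then have "coef (sh D) \<alpha> \<in> m'" for \<alpha>
      by (intro shift_coeffs_in[OF A'.field_subring_axioms A'.m_ideal]) (use yv_A' in auto)
    then have "low (Suc r) (sh D)" using A'.m_sub by (auto simp: low_def coeffs_in_def)
    then have "low (Suc r) (sh D + sh Q)" using PQ(5) by (rule low_add)
    then have prod: "low (Suc r) (sh Ps * sh P)" by (simp add: D_def shift_diff shift_mult)
    define c where "c = ev Ps"
    have cA: "c \<in> A'" "c \<notin> m'" using low_sh[OF PQ(1)] PQ(3) by (auto simp: c_def peval_def low_def coeffs_in_def)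
    define p' where "p' = sh Ps - mono_term 0 c"
    have "low 0 p'" unfolding p'_def by (intro low_diff low_sh PQ low_const cA)
    moreover have "coef p' 0 = 0" by (simp add: p'_def c_def peval_def lookup_minus)
    ultimately have p': "low 1 p'" by (intro low_1I) auto
    \<comment> \<open>The shifted \<open>Ps\<close> is a unit constant c plus \<open>p'\<close>,
      which has constant term 0. So the vanishing order of the product is transferred to the shifted
      \<open>P\<close>, one degree at a time.\<close>
    have "low n (sh P)" if "n \<le> Suc r" for n
      using that
    proof (induction n)
      case 0
      then show ?case by (intro low_sh P)
    next
      case (Suc n)
      have "low (Suc n) (p' * sh P)" using low_mult[OF p' Suc.IH] Suc.prems by simp
      then have "low (Suc n) (sh Ps * sh P - p' * sh P)"
        by (rule low_diff[OF low_mono[OF prod Suc.prems]])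
      then have "low (Suc n) (mono_term 0 c * sh P)" by (simp add: p'_def algebra_simps)
      then have "low (0 + Suc n) (mono_term 0 (inverse c) * (mono_term 0 c * sh P))"
        by (intro low_mult low_const A'.unit cA)
      moreover have "mono_term 0 (inverse c) * (mono_term 0 c * sh P) = sh P"
      proof -
        have "c \<noteq> 0" using cA by auto
        then show ?thesis by (simp add: mult_single flip: mult.assoc)
      qed
      ultimately show ?case by simp
    qed
    then have lowP: "low (Suc r) (sh P)" by blast
    have shm: "coef (sh P) \<alpha> \<in> m'" for \<alpha>
    proof (cases "size \<alpha> \<le> r")
      case True
      then show ?thesis using lowP unfolding low_def coeffs_in_def by (metis less_Suc_eq_le)
    next
      case False
      then show ?thesis using deg_le_shift[OF P(2)] by (simp add: deg_le_iff)
    qed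
    \<comment> \<open>Undoing the translation carries \<open>m'\<close> back to the coefficients of
      \<open>P\<close>. These lie in A, and A meets \<open>m'\<close> in \<open>m\<close>, so f
      would lie in m^(r+1).\<close>
    have "coef (shift (\<lambda>z. - yv z) (sh P)) \<alpha> \<in> m'" for \<alpha>
      by (rule shift_coeffs_in[OF A'.field_subring_axioms A'.m_ideal]) (use yv_A' shm in auto)
    then have Pm: "coef P \<alpha> \<in> m" for \<alpha>
      using m'_A goodD(1)[OF P(1)] by (simp add: shift_inverse)
    have "f = x ^ r * ev P" using P(3) by simp
    also have "\<dots> = (\<Sum>\<alpha>\<in>supp P. coef P \<alpha> * x ^ (r - size \<alpha>) * prod_mset \<alpha>)" by (rule ev_homog[OF P(2,1)])
    also have "\<dots> \<in> mpow (Suc r)"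
    proof (rule ideal_sum[OF mpow_ideal])
      fix \<alpha> assume \<alpha>: "\<alpha> \<in> supp P"
      have "size \<alpha> \<le> r" using P(2) \<alpha> by (meson deg_le_iff in_keys_iff not_le)
      moreover have "set_mset \<alpha> \<subseteq> m" using goodD(2)[OF P(1) \<alpha>] zs_m by blast
      then have "coef P \<alpha> * (x ^ (r - size \<alpha>) * prod_mset \<alpha>) \<in> mpow (Suc (r - size \<alpha> + size \<alpha>))"
        by (intro ideal_pow_Suc_mem[OF m_ideal Pm] mpow_mult m_mem_pow x_m prod_mset_mpow)
      ultimately show "coef P \<alpha> * x ^ (r - size \<alpha>) * prod_mset \<alpha> \<in> mpow (Suc r)" by (simp add: mult.assoc)
    qed
    finally show False using fr(2) by blast
  qed
  then have "\<not> Suc r \<le> ord A' (f / x ^ r)" using A'.ord_le_iff[OF gA] by simp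
  then show ?thesis by (simp add: r_def)
qed

end

lemma ord_strict_le: "f \<in> A \<Longrightarrow> f \<noteq> 0 \<Longrightarrow> ord A' (f / x ^ ord A f) \<le> ord A f"
  using ord_strict_le_aux params_extend[OF x_m x_m2] by blast

end

section \<open>Discrete valuation rings and prime elements\<close>

definition prime_elt :: "'a::field set \<Rightarrow> 'a \<Rightarrow> bool" where
  "prime_elt A p \<longleftrightarrow> p \<in> A \<and> p \<noteq> 0 \<and> prime_ideal A (pid A p)"

text \<open>\<open>U\<close> is local with maximal ideal pU, written in terms of membership
  alone.\<close>

definition uniformizer :: "'a::field set \<Rightarrow> 'a \<Rightarrow> bool" where
  "uniformizer U p \<longleftrightarrow> subring U \<and> p \<in> U \<and> p \<noteq> 0 \<and> inverse p \<notin> U \<and>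
     (\<forall>u\<in>U. u \<noteq> 0 \<longrightarrow> u / p \<in> U \<or> inverse u \<in> U)"

text \<open>The last clause says that pU contracts to pA. This is the invariant carried along the
  sequence while \<open>U\<close> stays fixed.\<close>

definition centered :: "'a::field set \<Rightarrow> 'a set \<Rightarrow> 'a \<Rightarrow> bool" where
  "centered A U p \<longleftrightarrow> A \<subseteq> U \<and> p \<in> A \<and> (\<forall>a\<in>A. a / p \<in> U \<longrightarrow> a / p \<in> A)"

lemma mem_pid_div: "p \<noteq> 0 \<Longrightarrow> a \<in> pid A p \<longleftrightarrow> a / p \<in> A"
  by (auto simp: mem_pid field_simps) (metis nonzero_eq_divide_eq)

lemma (in field_subring) uniformizer_localization:
  assumes p: "prime_elt A p"
  shows "uniformizer (localization A (pid A p)) p" "centered A (localization A (pid A p)) p"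
proof -
  have pA: "p \<in> A" "p \<noteq> 0" and pr: "prime_ideal A (pid A p)" using p by (auto simp: prime_elt_def)
  let ?U = "localization A (pid A p)"
  interpret U: field_subring ?U by unfold_locales (rule subring_localization[OF pr])
  note AU = localization_sub[OF pr]
  show "uniformizer ?U p"
    unfolding uniformizer_def
  proof (intro conjI ballI impI)
    show "subring ?U" by (rule subring_localization[OF pr])
    show "p \<in> ?U" using AU pA by blast
    show "p \<noteq> 0" by fact
    show "inverse p \<notin> ?U"
    proof
      assume "inverse p \<in> ?U"
      then obtain a s where h: "a \<in> A" "s \<in> A" "s \<notin> pid A p" "inverse p = a / s" unfolding localization_def by blast
      have "s \<noteq> 0" using notin_prime_nonzero[OF pr h(3)] .
      then have "s = a * p" using h(4) pA by (simp add: field_simps)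
      then show False using h by (auto simp: mem_pid)
    qed
    fix u assume u: "u \<in> ?U" "u \<noteq> 0"
    then obtain a s where h: "a \<in> A" "s \<in> A" "s \<notin> pid A p" "u = a / s" unfolding localization_def by blast
    have s: "inverse s \<in> ?U" by (rule localization_inverse[OF pr h(2,3)])
    show "u / p \<in> ?U \<or> inverse u \<in> ?U"
    proof (cases "a \<in> pid A p")
      case True
      then have "a / p \<in> ?U" using mem_pid_div[OF pA(2)] AU by blast
      then have "a / p * inverse s \<in> ?U" using s by blast
      then show ?thesis using h(4) by (simp add: field_simps)
    next
      case False
      then have "inverse a * s \<in> ?U" using localization_inverse[OF pr h(1)] AU h(2) by blast
      then show ?thesis using h(4) by (simp add: field_simps)
    qed
  qed
  show "centered A ?U p"
    unfolding centered_def
  proof (intro conjI ballI impI AU pA)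
    fix a assume a: "a \<in> A" "a / p \<in> ?U"
    then obtain b s where h: "b \<in> A" "s \<in> A" "s \<notin> pid A p" "a / p = b / s" unfolding localization_def by blast
    have "s \<noteq> 0" using notin_prime_nonzero[OF pr h(3)] .
    then have "a * s = b * p" using h(4) pA by (simp add: field_simps)
    then have "a * s \<in> pid A p" using h(1) by (auto simp: mem_pid)
    then have "a \<in> pid A p" using prime_idealD(3)[OF pr a(1) h(2)] h(3) by blast
    then show "a / p \<in> A" using mem_pid_div[OF pA(2)] by blast
  qed
qed

text \<open>The ideal pA is the contraction of the maximal ideal pU, hence prime.\<close>

lemma (in field_subring) prime_elt_centered:
  assumes U: "uniformizer U p" and c: "centered A U p"
  shows "prime_elt A p"
proof -
  interpret U: field_subring U using U by unfold_locales (simp add: uniformizer_def)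
  have pU: "p \<noteq> 0" "inverse p \<notin> U" and pA: "p \<in> A" and AU: "A \<subseteq> U" using U c by (auto simp: uniformizer_def centered_def)
  have "prime_ideal A (pid A p)"
    unfolding prime_ideal_def
  proof (intro conjI ballI impI ideal_pid pA)
    show "pid A p \<noteq> A"
    proof
      assume "pid A p = A"
      then have "1 \<in> pid A p" by simp
      then have "1 / p \<in> A" using mem_pid_div[OF pU(1)] by blast
      then show False using AU pU(2) by (auto simp: inverse_eq_divide)
    qed
    fix a b assume ab: "a \<in> A" "b \<in> A" "a * b \<in> pid A p"
    show "a \<in> pid A p \<or> b \<in> pid A p"
    proof (cases "a = 0 \<or> a / p \<in> U")
      case True
      then show ?thesis using c ab(1) mem_pid_div[OF pU(1)] by (auto simp: centered_def)
    next
      case False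
      then have "inverse a \<in> U" using U ab(1) AU unfolding uniformizer_def by blast
      moreover have "a * b / p \<in> U" using ab(3) mem_pid_div[OF pU(1)] AU by blast
      ultimately have "inverse a * (a * b / p) \<in> U" by blast
      moreover have "inverse a * (a * b / p) = b / p" using False by (simp add: field_simps)
      ultimately have "b / p \<in> U" by (simp only:)
      then show ?thesis using c ab(2) mem_pid_div[OF pU(1)] by (auto simp: centered_def)
    qed
  qed
  then show ?thesis using pU pA by (simp add: prime_elt_def)
qed

text \<open>The ascending chain condition bounds the power of \<open>p\<close> dividing a nonzero
  element, so each nonzero element of F is a unit of \<open>U\<close> times a unique power of
  \<open>p\<close>; the exponent is the valuation.\<close>

lemma DVR_uniformizer:
  assumes U: "uniformizer U p" and N: "noetherian U" and qf: "quotient_field_is_F U"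
  shows "DVR U"
proof -
  interpret noetherian_subring U using U N by unfold_locales (auto simp: uniformizer_def)
  have pU: "p \<in> U" "p \<noteq> 0" "inverse p \<notin> U" and dich: "\<And>u. u \<in> U \<Longrightarrow> u \<noteq> 0 \<Longrightarrow> u / p \<in> U \<or> inverse u \<in> U"
    using U by (auto simp: uniformizer_def)
  define E where "E = {u. u \<noteq> 0 \<and> u \<in> U \<and> inverse u \<in> U}"
  have E_mult: "u * w \<in> E" if "u \<in> E" "w \<in> E" for u w using that by (auto simp: E_def)
  have E_inv: "inverse u \<in> E" if "u \<in> E" for u using that by (auto simp: E_def)
  have rep: "\<exists>n. w / p ^ n \<in> E" if w: "w \<in> U" "w \<noteq> 0" for w
  proof -
    have "\<exists>n. w / p ^ n \<notin> U"
    proof (rule ccontr)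
      assume "\<not> ?thesis"
      then have all: "w / p ^ n \<in> U" for n by blast
      have "\<exists>k. pid U (w / p ^ Suc k) = pid U (w / p ^ k)"
      proof (rule ascending_stable)
        show "ideal U (pid U (w / p ^ n))" for n by (rule ideal_pid[OF all])
        show "pid U (w / p ^ n) \<subseteq> pid U (w / p ^ Suc n)" for n
        proof (rule pid_least[OF ideal_pid[OF all]])
          have "w / p ^ n = p * (w / p ^ Suc n)" using pU by simp
          then show "w / p ^ n \<in> pid U (w / p ^ Suc n)" unfolding mem_pid using pU by blast
        qed
      qed
      then obtain k where k: "pid U (w / p ^ Suc k) = pid U (w / p ^ k)" by blast
      then have "w / p ^ Suc k \<in> pid U (w / p ^ k)" using pid_mem[of "w / p ^ Suc k"] by simp
      then obtain u where u: "u \<in> U" "w / p ^ Suc k = u * (w / p ^ k)" unfolding mem_pid by blast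
      then have "inverse p = u" using pU w by (simp add: field_simps)
      then show False using u pU by simp
    qed
    then obtain n where "w / p ^ n \<notin> U" by blast
    define N where "N = (LEAST n. w / p ^ n \<notin> U)"
    have N: "w / p ^ N \<notin> U" unfolding N_def by (rule LeastI[of "\<lambda>n. w / p ^ n \<notin> U"]) fact
    then obtain j where j: "N = Suc j" using w by (cases N) auto
    have jU: "w / p ^ j \<in> U" using not_less_Least[of j "\<lambda>n. w / p ^ n \<notin> U"] j by (auto simp: N_def)
    moreover have "w / p ^ j / p \<notin> U" using N j by (simp add: field_simps)
    ultimately have "inverse (w / p ^ j) \<in> U" using dich[OF jU] w pU by simp
    then show ?thesis using jU w pU unfolding E_def by auto
  qed
  have repF: "\<exists>k. z * p powi (- k) \<in> E" if z: "z \<noteq> 0" for z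
  proof -
    obtain a b where ab: "a \<in> U" "b \<in> U" "b \<noteq> 0" "z = a / b" using qf unfolding quotient_field_is_F_def by blast
    then have "a \<noteq> 0" using z by auto
    then obtain i j where ij: "a / p ^ i \<in> E" "b / p ^ j \<in> E" using rep ab by blast
    have "(a / p ^ i) * inverse (b / p ^ j) \<in> E" using E_mult[OF ij(1) E_inv[OF ij(2)]] .
    moreover have "(a / p ^ i) * inverse (b / p ^ j) = z * p powi (- (int i - int j))"
      using ab pU by (simp add: power_int_diff power_int_minus field_simps)
    ultimately show ?thesis by metis
  qed
  have pE: "k = 0" if k: "p powi k \<in> E" for k
  proof -
    have no: "\<not> 0 < j" if j: "p powi j \<in> E" for j
    proof
      assume "0 < j"
      then obtain n where n: "j = int (Suc n)" by (metis gr0_implies_Suc zero_less_imp_eq_int)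
      have pj: "p powi j = p ^ Suc n" unfolding n by (rule power_int_of_nat)
      have "inverse (p powi j) * p ^ n \<in> U" using j pU unfolding E_def by auto
      moreover have "inverse (p powi j) * p ^ n = inverse p" using pU unfolding pj by (simp add: field_simps)
      ultimately show False using pU by simp
    qed
    have "p powi (- k) \<in> E" using E_inv[OF k] by (simp add: power_int_minus)
    then show ?thesis using no[OF k] no[of "- k"] by linarith
  qed
  define v where "v z = (THE k. z * p powi (- k) \<in> E)" for z
  have v_eq: "v z = k" if "z * p powi (- k) \<in> E" for z k
    unfolding v_def
  proof (rule the_equality)
    show "z * p powi (- k) \<in> E" by fact
    fix j assume j: "z * p powi (- j) \<in> E"
    then have z0: "z \<noteq> 0" by (auto simp: E_def)
    have "inverse (z * p powi (- j)) * (z * p powi (- k)) \<in> E" by (rule E_mult[OF E_inv[OF j] that])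
    moreover have "inverse (z * p powi (- j)) * (z * p powi (- k)) = p powi (j - k)"
      using z0 pU by (simp add: power_int_diff power_int_minus field_simps)
    ultimately have "p powi (j - k) \<in> E" by (simp only:)
    then show "j = k" using pE[of "j - k"] by simp
  qed
  have vE: "z * p powi (- v z) \<in> E" if "z \<noteq> 0" for z using repF[OF that] v_eq by auto
  have v_mult: "v (a * b) = v a + v b" if "a \<noteq> 0" "b \<noteq> 0" for a b
  proof (rule v_eq)
    have "p powi (- v a + - v b) = p powi (- v a) * p powi (- v b)" using pU by (intro power_int_add) simp
    then have "a * b * p powi (- (v a + v b)) = (a * p powi (- v a)) * (b * p powi (- v b))"
      by (simp add: ac_simps)
    then show "a * b * p powi (- (v a + v b)) \<in> E" using E_mult[OF vE[OF that(1)] vE[OF that(2)]] by (simp only:)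
  qed
  have v_p: "v (p powi k) = k" for k
    by (rule v_eq) (use pU in \<open>auto simp: E_def power_int_minus\<close>)
  have v_U: "0 \<le> v z \<longleftrightarrow> z \<in> U" if z: "z \<noteq> 0" for z
  proof
    assume "0 \<le> v z"
    then obtain n where n: "v z = int n" by (metis nonneg_int_cases)
    have "z * p powi (- v z) * p ^ n \<in> U" using vE[OF z] pU by (auto simp: E_def)
    then show "z \<in> U" using n pU by (simp add: power_int_minus mult.assoc)
  next
    assume "z \<in> U"
    then obtain n where "z / p ^ n \<in> E" using rep z by blast
    then have "v z = int n" by (intro v_eq) (simp add: power_int_minus divide_inverse)
    then show "0 \<le> v z" by simp
  qed
  have v_add: "min (v a) (v b) \<le> v (a + b)" if ab: "a \<noteq> 0" "b \<noteq> 0" "a + b \<noteq> 0" for a b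
  proof -
    have *: "v a \<le> v (a + b)" if "v a \<le> v b" and ab: "a \<noteq> 0" "b \<noteq> 0" "a + b \<noteq> 0" for a b
    proof -
      have v_inv: "v (inverse a) = - v a" using v_mult[of a "inverse a"] v_p[of 0] ab by simp
      have "0 \<le> v (b * inverse a)" using v_mult[of b "inverse a"] v_inv that by simp
      then have "b * inverse a \<in> U" using v_U ab by simp
      then have "1 + b * inverse a \<in> U" by blast
      moreover have eq: "a + b = a * (1 + b * inverse a)" using ab by (simp add: field_simps)
      moreover from eq have "1 + b * inverse a \<noteq> 0" using ab by auto
      ultimately have "0 \<le> v (1 + b * inverse a)" using v_U by blast
      then show ?thesis using v_mult[OF ab(1) \<open>1 + b * inverse a \<noteq> 0\<close>] eq by simp
    qed
    show ?thesis
    proof (cases "v a \<le> v b")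
      case True
      then show ?thesis using *[of a b] ab by simp
    next
      case False
      then show ?thesis using *[of b a] ab by (simp add: add.commute)
    qed
  qed
  show ?thesis
    unfolding DVR_def
  proof (intro exI[of _ v] conjI allI impI)
    show "\<exists>a. a \<noteq> 0 \<and> v a = k" for k using v_p[of k] pU by (intro exI[of _ "p powi k"]) simp
    show "U = {z. z = 0 \<or> 0 \<le> v z}"
    proof (rule set_eqI)
      show "z \<in> U \<longleftrightarrow> z \<in> {z. z = 0 \<or> 0 \<le> v z}" for z using v_U[of z] by (cases "z = 0") auto
    qed
  qed (use v_mult v_add in auto)
qed

section \<open>Normal noetherian domains as intersections of discrete valuation rings\<close>

lemma quotient_field_mono: "quotient_field_is_F A \<Longrightarrow> A \<subseteq> C \<Longrightarrow> quotient_field_is_F C"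
  unfolding quotient_field_is_F_def by blast

lemma DVR_localization:
  assumes C: "noetherian C" and qf: "quotient_field_is_F C" and P: "prime_ideal C P"
    and U: "uniformizer (localization C P) p"
  shows "DVR (localization C P)"
proof -
  interpret C: noetherian_subring C using C by unfold_locales (auto simp: noetherian_def)
  show ?thesis
    by (rule DVR_uniformizer[OF U noetherian_frac_over[OF C C.frac_over_localization[OF P]]
          quotient_field_mono[OF qf C.localization_sub[OF P]]])
qed

text \<open>For a noetherian domain with quotient field F this is integral closedness: an element of
  F is integral exactly when it maps some nonzero ideal into itself.\<close>

definition normal_dom :: "'a::field set \<Rightarrow> bool" where
  "normal_dom C \<longleftrightarrow> (\<forall>w P. ideal C P \<longrightarrow> P \<noteq> {0} \<longrightarrow> (\<forall>u\<in>P. w * u \<in> P) \<longrightarrow> w \<in> C)"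

text \<open>A maximal member P among the denominator ideals of multiples w z outside
  \<open>C\<close> is prime. Normality makes w z equal to t / p with p in P and t outside P, so P
  becomes principal in the localization. If z lay there, so would 1/p.\<close>

lemma DVR_exists:
  assumes C: "noetherian C" and qf: "quotient_field_is_F C" and n: "normal_dom C" and z: "z \<notin> C"
  shows "\<exists>U. DVR U \<and> C \<subseteq> U \<and> z \<notin> U"
proof -
  interpret C: noetherian_subring C using C by unfold_locales (auto simp: noetherian_def)
  define K where "K w = {c \<in> C. c * (w * z) \<in> C}" for w
  define \<F> where "\<F> = {K w | w. w \<in> C \<and> w * z \<notin> C}"
  have Ki: "ideal C (K w)" for w
    unfolding ideal_def K_def by (auto simp: distrib_right mult.assoc)
  have "K 1 \<in> \<F>" unfolding \<F>_def using z by force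
  moreover have "ideal C I" if "I \<in> \<F>" for I using that Ki by (auto simp: \<F>_def)
  ultimately obtain P where P: "P \<in> \<F>" and mx: "\<forall>I\<in>\<F>. P \<subseteq> I \<longrightarrow> I = P"
    using C.max_exists[of "K 1" \<F>] by blast
  obtain w where w: "w \<in> C" "w * z \<notin> C" "P = K w" using P by (auto simp: \<F>_def)
  have prP: "prime_ideal C P"
    unfolding prime_ideal_def
  proof (intro conjI ballI impI)
    show "ideal C P" using Ki w by simp
    have "1 \<notin> P" using w by (simp add: K_def)
    then show "P \<noteq> C" using C.one_mem by metis
    fix a b assume ab: "a \<in> C" "b \<in> C" "a * b \<in> P"
    show "a \<in> P \<or> b \<in> P"
    proof (rule ccontr)
      assume nn: "\<not> ?thesis"
      then have "a * (w * z) \<notin> C" using w ab by (auto simp: K_def)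
      then have "K (a * w) \<in> \<F>" unfolding \<F>_def using ab w by (force simp: mult.assoc)
      moreover have "P \<subseteq> K (a * w)"
      proof
        fix c assume "c \<in> P"
        then have "c \<in> C" "a * (c * (w * z)) \<in> C" using w ab by (auto simp: K_def)
        then show "c \<in> K (a * w)" by (simp add: K_def ac_simps)
      qed
      ultimately have "K (a * w) = P" using mx by blast
      moreover have "b \<in> K (a * w)" using ab w by (simp add: K_def ac_simps)
      ultimately show False using nn by blast
    qed
  qed
  obtain a b where ab: "a \<in> C" "b \<in> C" "b \<noteq> 0" "w * z = a / b" using qf unfolding quotient_field_is_F_def by blast
  then have "b \<in> P" using w by (simp add: K_def)
  then have "P \<noteq> {0}" using ab by auto
  \<comment> \<open>As w z is not in \<open>C\<close>, it does not map P into itself, although it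
    maps P into \<open>C\<close> by definition of P.\<close>
  then obtain p where p: "p \<in> P" "w * z * p \<notin> P"
    using n w(2) prime_idealD(1)[OF prP] unfolding normal_dom_def by blast
  define t where "t = w * z * p"
  have tC: "t \<in> C" "t \<notin> P" "p \<in> C" using p w by (auto simp: K_def t_def ac_simps)
  have p0: "p \<noteq> 0" "t \<noteq> 0" using tC idealD(2)[OF prime_idealD(1)[OF prP]] by (auto simp: t_def)
  let ?U = "localization C P"
  interpret U: field_subring ?U by unfold_locales (rule C.subring_localization[OF prP])
  note CU = C.localization_sub[OF prP]
  have np: "inverse p \<notin> ?U"
  proof
    assume "inverse p \<in> ?U"
    then obtain a s where h: "a \<in> C" "s \<in> C" "s \<notin> P" "inverse p = a / s" unfolding localization_def by blast
    have "s \<noteq> 0" using C.notin_prime_nonzero[OF prP h(3)] .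
    then have "s = a * p" using h(4) p0 by (simp add: field_simps)
    then show False using h idealD(4)[OF prime_idealD(1)[OF prP] h(1) p(1)] by simp
  qed
  have "uniformizer ?U p"
    unfolding uniformizer_def
  proof (intro conjI ballI impI)
    show "subring ?U" by (rule C.subring_localization[OF prP])
    show "p \<in> ?U" using CU tC by blast
    fix u assume u: "u \<in> ?U" "u \<noteq> 0"
    then obtain a s where h: "a \<in> C" "s \<in> C" "s \<notin> P" "u = a / s" unfolding localization_def by blast
    show "u / p \<in> ?U \<or> inverse u \<in> ?U"
    proof (cases "a \<in> P")
      case True
      then have "a * (w * z) \<in> C" using w by (simp add: K_def)
      moreover have "inverse (s * t) \<in> ?U"
        by (rule C.localization_inverse[OF prP]) (use h tC C.prime_mult_notin[OF prP] in auto)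
      ultimately have "a * (w * z) * inverse (s * t) \<in> ?U" using CU by blast
      moreover have "a * (w * z) * inverse (s * t) = u / p" using h(4) p0 by (simp add: t_def field_simps)
      ultimately show ?thesis by simp
    next
      case False
      then have "inverse a * s \<in> ?U" using C.localization_inverse[OF prP h(1)] CU h(2) by blast
      then show ?thesis using h(4) by (simp add: field_simps)
    qed
  qed (use p0 np in auto)
  then have "DVR ?U" by (rule DVR_localization[OF C qf prP])
  moreover have "z \<notin> ?U"
  proof
    assume "z \<in> ?U"
    moreover have "w \<in> ?U" using CU w(1) by blast
    moreover have "inverse t \<in> ?U" by (rule C.localization_inverse[OF prP tC(1,2)])
    ultimately have "w * z * inverse t \<in> ?U" by (intro U.mult_mem)
    moreover have "w * z * inverse t = inverse p" using p0 by (simp add: t_def field_simps)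
    ultimately show False using np by simp
  qed
  ultimately show ?thesis using CU by blast
qed

text \<open>The contraction of P to \<open>A\<close> has finitely many generators, so one
  denominator s, a unit of \<open>C\<close>, clears all their products with w. Then s w maps the
  contraction into itself and lies in \<open>A\<close>.\<close>

lemma normal_frac_over:
  assumes A: "noetherian A" "normal_dom A" and C: "frac_over A C"
  shows "normal_dom C"
  unfolding normal_dom_def
proof (intro allI impI)
  fix w P assume P: "ideal C P" "P \<noteq> {0}" and wP: "\<forall>u\<in>P. w * u \<in> P"
  interpret A: noetherian_subring A using A by unfold_locales (auto simp: noetherian_def)
  have C': "subring C" "A \<subseteq> C" and fr: "\<And>c. c \<in> C \<Longrightarrow> \<exists>a\<in>A. \<exists>s\<in>A. s \<noteq> 0 \<and> inverse s \<in> C \<and> c = a / s"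
    using C by (auto simp: frac_over_def)
  interpret C: field_subring C by unfold_locales (rule C')
  define P0 where "P0 = P \<inter> A"
  have P0: "ideal A P0" using P(1) C'(2) unfolding P0_def ideal_def by (auto simp: subset_iff)
  obtain xs where xs: "set xs \<subseteq> P0" "lin A xs = P0" using A.finitely_generated[OF P0] by blast
  have "\<exists>s\<in>A. s \<noteq> 0 \<and> inverse s \<in> C \<and> (\<forall>x\<in>set ys. s * w * x \<in> A)" if "set ys \<subseteq> P0" for ys
    using that
  proof (induction ys)
    case Nil
    then show ?case by (intro bexI[of _ 1]) auto
  next
    case (Cons y ys)
    then obtain s where s: "s \<in> A" "s \<noteq> 0" "inverse s \<in> C" "\<forall>x\<in>set ys. s * w * x \<in> A" by auto
    have "w * y \<in> C" using wP Cons.prems idealD(6)[OF P(1)] by (auto simp: P0_def)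
    then obtain a t where t: "a \<in> A" "t \<in> A" "t \<noteq> 0" "inverse t \<in> C" "w * y = a / t" using fr by blast
    have "s * t * w * y = s * (t * (w * y))" by (simp add: ac_simps)
    also have "\<dots> = s * a" using t by simp
    finally have "s * t * w * y = s * a" .
    moreover have "s * a \<in> A" using s t by auto
    ultimately have "s * t * w * y \<in> A" by (simp only:)
    moreover have "s * t * w * x \<in> A" if "x \<in> set ys" for x
    proof -
      have "t * (s * w * x) \<in> A" using s t that by blast
      then show ?thesis by (simp add: ac_simps)
    qed
    moreover have "s * t \<in> A" "s * t \<noteq> 0" "inverse (s * t) \<in> C" using s t by auto
    ultimately show ?case by (intro bexI[of _ "s * t"]) auto
  qed
  then obtain s where s: "s \<in> A" "s \<noteq> 0" "inverse s \<in> C" "\<forall>x\<in>set xs. s * w * x \<in> A" using xs(1) by blast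
  have "ideal A {u \<in> A. s * w * u \<in> P0}"
    using P0 unfolding ideal_def by (auto simp: distrib_left mult.left_commute)
  moreover have "set xs \<subseteq> {u \<in> A. s * w * u \<in> P0}"
  proof
    fix x assume x: "x \<in> set xs"
    then have xP: "x \<in> P" "x \<in> A" using xs by (auto simp: P0_def)
    then have "s * (w * x) \<in> P" using wP s(1) C'(2) by (intro idealD(4)[OF P(1), of s "w * x"]) auto
    then show "x \<in> {u \<in> A. s * w * u \<in> P0}" using s(4) x xP by (simp add: P0_def mult.assoc)
  qed
  ultimately have "P0 \<subseteq> {u \<in> A. s * w * u \<in> P0}" using A.lin_least xs(2) by blast
  moreover have "P0 \<noteq> {0}"
  proof -
    obtain c where c: "c \<in> P" "c \<noteq> 0" using P idealD(2)[OF P(1)] by blast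
    then obtain a t where t: "a \<in> A" "t \<in> A" "t \<noteq> 0" "c = a / t" using fr idealD(6)[OF P(1)] by blast
    have "t * c \<in> P" using t C'(2) c(1) by (intro idealD(4)[OF P(1)]) auto
    then have "a \<in> P0" "a \<noteq> 0" using t c by (auto simp: P0_def)
    then show ?thesis by blast
  qed
  ultimately have "s * w \<in> A" using A(2) P0 unfolding normal_dom_def by (metis (no_types, lifting) mem_Collect_eq subsetD)
  then have "inverse s * (s * w) \<in> C" using s(3) C'(2) by blast
  then show "w \<in> C" using s(2) by (simp flip: mult.assoc)
qed

lemma (in reg_local) normal: "normal_dom A"
  unfolding normal_dom_def
proof (intro allI impI)
  fix w P assume P: "ideal A P" "P \<noteq> {0}" and wP: "\<forall>u\<in>P. w * u \<in> P"
  obtain c where c: "c \<in> P" "c \<noteq> 0" using P idealD(2)[OF P(1)] by blast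
  have "c * w ^ k \<in> P" for k
  proof (induction k)
    case (Suc k)
    then have "w * (c * w ^ k) \<in> P" using wP by blast
    then show ?case by (simp add: ac_simps)
  qed (use c in simp)
  then show "w \<in> A" using completely_integrally_closed[of c w] c idealD(6)[OF P(1)] by blast
qed

section \<open>Prime elements and their strict transforms\<close>

context quad_transform
begin

text \<open>The order of A is additive and nonnegative on A', and elements of positive order are
  divisible by x in A'; so one factor of a multiple of x is divisible by x.\<close>

lemma x_prime: "prime_elt A' x"
proof -
  have xA': "x \<in> A'" using x_A A_A' by blast
  have "prime_ideal A' (pid A' x)"
    unfolding prime_ideal_def
  proof (intro conjI ballI impI A'.ideal_pid xA')
    have "pid A' x \<subseteq> m'" by (rule A'.pid_least[OF A'.m_ideal]) (use x_m m_m' in blast)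
    then show "pid A' x \<noteq> A'" using A'.one_notin A'.one_mem by blast
    fix c e assume ce: "c \<in> A'" "e \<in> A'" "c * e \<in> pid A' x"
    show "c \<in> pid A' x \<or> e \<in> pid A' x"
    proof (cases "c = 0 \<or> e = 0")
      case True
      then show ?thesis using idealD(2)[OF A'.ideal_pid[OF xA']] by blast
    next
      case False
      obtain a where a: "a \<in> A'" "c * e = a * x" using ce(3) by (auto simp: mem_pid)
      then have "a \<noteq> 0" using False by auto
      then have "ordF A c + ordF A e = ordF A a + 1"
        using ordF_mult[of c e] ordF_mult[of a x] a(2) False ordF_x by simp
      moreover have "0 \<le> ordF A a" using ordF_nonneg a(1) \<open>a \<noteq> 0\<close> by blast
      ultimately have "1 \<le> ordF A c \<or> 1 \<le> ordF A e" by linarith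
      then have "c / x \<in> A' \<or> e / x \<in> A'" using div_x_pow[of c 1] div_x_pow[of e 1] ce False by auto
      then show ?thesis using mem_pid_div[OF x0] by blast
    qed
  qed
  then show ?thesis using xA' by (simp add: prime_elt_def)
qed

text \<open>Since p does not divide x in A, centredness makes x a unit of \<open>U\<close>; p and
  its strict transform are therefore associates in \<open>U\<close>. What remains is that the
  denominators of A' are units of \<open>U\<close> and that divisibility by the transform descends
  to A'.\<close>

lemma strict_centered:
  assumes U: "uniformizer U p" and c: "centered A U p" and xp: "x / p \<notin> A" and p': "p / x ^ ord A p \<in> m'"
  shows "uniformizer U (p / x ^ ord A p)" "centered A' U (p / x ^ ord A p)"
proof -
  interpret U: field_subring U using U by unfold_locales (simp add: uniformizer_def)
  have pU: "p \<noteq> 0" "inverse p \<notin> U" and pA: "p \<in> A" and AU: "A \<subseteq> U"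
    and dich: "\<And>u. u \<in> U \<Longrightarrow> u \<noteq> 0 \<Longrightarrow> u / p \<in> U \<or> inverse u \<in> U"
    and cen: "\<And>a. a \<in> A \<Longrightarrow> a / p \<in> U \<Longrightarrow> a / p \<in> A"
    using U c by (auto simp: uniformizer_def centered_def)
  define r where "r = ord A p"
  define p1 where "p1 = p / x ^ r"
  have "x / p \<notin> U" using cen[OF x_A] xp by blast
  then have xi: "inverse x \<in> U" using dich[of x] x_A AU by auto
  have xU: "x \<in> U" using x_A AU by blast
  have xiff: "u / p1 \<in> U \<longleftrightarrow> u / p \<in> U" for u
  proof
    assume "u / p1 \<in> U"
    then have "u / p1 * inverse x ^ r \<in> U" using xi by blast
    then show "u / p \<in> U" using pU by (simp add: p1_def field_simps)
  next
    assume "u / p \<in> U"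
    then have "u / p * x ^ r \<in> U" using xU by blast
    then show "u / p1 \<in> U" using pU by (simp add: p1_def field_simps)
  qed
  have "p * inverse x ^ r \<in> U" using pA AU xi by blast
  then have p1U: "p1 \<in> U" by (simp add: p1_def field_simps)
  have p10: "p1 \<noteq> 0" using pU by (simp add: p1_def)
  have u1: "uniformizer U p1"
    unfolding uniformizer_def
  proof (intro conjI ballI impI)
    show "subring U" using U by (simp add: uniformizer_def)
    show "inverse p1 \<notin> U" using xiff[of 1] pU by (simp add: inverse_eq_divide)
    show "u / p1 \<in> U \<or> inverse u \<in> U" if "u \<in> U" "u \<noteq> 0" for u using dich[OF that] xiff by blast
  qed (use p1U p10 in auto)
  have p1A': "p1 \<in> A'" and p1m: "p1 \<in> m'" using p' A'.m_sub by (auto simp: p1_def r_def)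
  have A'U: "w \<in> U \<and> (w / p1 \<in> U \<longrightarrow> w / p1 \<in> A')" if w: "w \<in> A'" for w
  proof -
    obtain f s N where h: "f \<in> mpow N" "s \<in> mpow N" "s \<noteq> 0" "ord A s = N" "s / x ^ N \<notin> m'" "w = f / s"
      using A'_rep[OF w] by blast
    have sA: "s \<in> A" "f \<in> A" using h mpow_A by auto
    have xs: "x ^ N / s \<in> A'" by (rule unit_A'[OF h(2,5)])
    \<comment> \<open>The factor x^r / x^N may be a division or a multiplication, so
      \<open>r\<close> and \<open>N\<close> have to be compared before natural subtraction is
      used.\<close>
    have split: "h' * x ^ r / x ^ N \<in> A'" if h': "h' \<in> A" "h' \<noteq> 0" "N \<le> ord A h' + r" for h'
    proof (cases "r \<le> N")
      case True
      then have "h' / x ^ (N - r) \<in> A'" using h' by (intro strict_A') auto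
      then show ?thesis using True by (simp add: power_diff)
    next
      case False
      then have "h' * x ^ (r - N) \<in> A'" using h'(1) x_A A_A' by blast
      then show ?thesis using False by (simp add: power_diff)
    qed
    \<comment> \<open>If p divided s in A, then s / x^N would be a multiple of the strict transform
      in A', hence in \<open>m'\<close>, contrary to the choice of s. Here the assumption that the
      transform is a nonunit enters.\<close>
    have "inverse s \<in> U"
    proof (rule ccontr)
      assume "inverse s \<notin> U"
      then have "s / p \<in> A" using dich[of s] sA AU h(3) cen by blast
      moreover have "s / p \<noteq> 0" using h pU by simp
      moreover have "ord A s = ord A (s / p) + r"
        using ord_mult[of "s / p" p] calculation pA pU by (simp add: r_def)
      ultimately have "(s / p) * x ^ r / x ^ N \<in> A'" using h(4) by (intro split) auto
      then have "(s / p) * x ^ r / x ^ N * p1 \<in> m'" using p1m by (intro idealD(4)[OF A'.m_ideal])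
      then show False using h(5) pU by (simp add: p1_def)
    qed
    then have "f * inverse s \<in> U" using sA AU by blast
    then have wU: "w \<in> U" using h(6) by (simp add: divide_inverse)
    moreover have "w / p1 \<in> A'" if wp: "w / p1 \<in> U"
    proof (cases "f = 0")
      case True
      then show ?thesis using h by simp
    next
      case False
      have "w / p \<in> U" using xiff wp by blast
      then have "w / p * s \<in> U" using sA AU by blast
      then have "f / p \<in> A" using cen[OF sA(2)] h by simp
      moreover have "f / p \<noteq> 0" using False pU by simp
      moreover have "ord A f = ord A (f / p) + r"
        using ord_mult[of "f / p" p] calculation pA pU by (simp add: r_def)
      moreover have "N \<le> ord A f" using ord_le_iff[OF sA(2) False] h(1) by blast
      ultimately have "(f / p) * x ^ r / x ^ N \<in> A'" by (intro split) auto
      then have "(f / p) * x ^ r / x ^ N * (x ^ N / s) \<in> A'" using xs by blast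
      moreover have "(f / p) * x ^ r / x ^ N * (x ^ N / s) = w / p1" using h pU by (simp add: p1_def)
      ultimately show ?thesis by simp
    qed
    ultimately show ?thesis by blast
  qed
  then have "centered A' U p1" using p1A' unfolding centered_def by blast
  then show "uniformizer U (p / x ^ ord A p)" "centered A' U (p / x ^ ord A p)" using u1 by (auto simp: p1_def r_def)
qed

text \<open>A nonunit divisor of x has order 1 like x itself, so its strict transform is p / x, with
  inverse x / p already in A.\<close>

lemma strict_unit_of_dvd_x:
  assumes p: "p \<in> m" "p \<noteq> 0" and xp: "x / p \<in> A"
  shows "p / x ^ ord A p \<notin> m'"
proof
  assume p': "p / x ^ ord A p \<in> m'"
  have pA: "p \<in> A" using p m_sub by blast
  have "ord A x = ord A (x / p) + ord A p" using ord_mult[of "x / p" p] xp pA p by simp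
  moreover have "ord A p \<noteq> 0" using ord_eq_0[OF pA p(2)] p by simp
  ultimately have 1: "ord A p = 1" using ord_x by simp
  have "(x / p) * (p / x) \<in> m'" using p' 1 xp A_A' by (intro idealD(4)[OF A'.m_ideal]) auto
  then show False using p A'.one_notin by simp
qed

lemma strict_prime:
  assumes p: "prime_elt A p" and p': "p / x ^ ord A p \<in> m'"
  shows "prime_elt A' (p / x ^ ord A p)"
proof -
  have pA: "p \<in> A" "p \<noteq> 0" and pr: "prime_ideal A (pid A p)" using p by (auto simp: prime_elt_def)
  have pm: "p \<in> m" using prime_sub_m[OF pr] pid_mem[of p] by blast
  have "x / p \<notin> A" using strict_unit_of_dvd_x[OF pm pA(2)] p' by blast
  then show ?thesis
    using A'.prime_elt_centered strict_centered[OF uniformizer_localization[OF p]] p' by blast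
qed

end

section \<open>Limits in the patch topology\<close>

lemma max_ideal_valuation_ring:
  assumes U: "valuation_ring U"
  shows "max_ideal U = {u \<in> U. u = 0 \<or> inverse u \<notin> U}"
proof -
  interpret field_subring U using U by unfold_locales (simp add: valuation_ring_def)
  have dich: "z \<in> U \<or> inverse z \<in> U" if "z \<noteq> 0" for z using U that by (simp add: valuation_ring_def)
  define M where "M = {u \<in> U. u = 0 \<or> inverse u \<notin> U}"
  have scale: "a * u \<in> M" if a: "a \<in> U" and u: "u \<in> M" for a u
  proof (cases "a * u = 0")
    case True
    have "0 \<in> M" by (simp add: M_def)
    then show ?thesis using True by (simp only:)
  next
    case False
    have "inverse (a * u) \<notin> U"
    proof
      assume "inverse (a * u) \<in> U"
      then have "a * inverse (a * u) \<in> U" by (rule mult_mem[OF a])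
      moreover have "a * inverse (a * u) = inverse u" using False by (simp add: field_simps)
      ultimately have "inverse u \<in> U" by (simp only:)
      then show False using u False by (simp add: M_def)
    qed
    then show ?thesis using a u by (auto simp: M_def)
  qed
  have M: "ideal U M"
    unfolding ideal_def
  proof (intro conjI ballI)
    show "M \<subseteq> U" "0 \<in> M" by (auto simp: M_def)
    show "a * u \<in> M" if "a \<in> U" "u \<in> M" for a u using scale that .
    have add: "u + w \<in> M" if uw: "u \<in> M" "w \<in> M" "w \<noteq> 0" "u / w \<in> U" for u w
    proof -
      have "(u / w + 1) * w \<in> M" by (rule scale[OF _ uw(2)]) (use uw in auto)
      then show ?thesis using uw(3) by (simp add: distrib_right)
    qed
    fix u w assume uw: "u \<in> M" "w \<in> M"
    show "u + w \<in> M"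
    proof (cases "u = 0 \<or> w = 0")
      case False
      then have "u / w \<in> U \<or> w / u \<in> U" using dich[of "u / w"] by simp
      then show ?thesis using add[of u w] add[of w u] uw False by (auto simp: add.commute)
    qed (use uw in auto)
  qed
  have "1 \<notin> M" by (simp add: M_def)
  then have MU: "M \<noteq> U" using one_mem by metis
  have proper: "J \<subseteq> M" if J: "ideal U J" "J \<noteq> U" for J
  proof
    fix u assume u: "u \<in> J"
    have uU: "u \<in> U" by (rule idealD(6)[OF J(1) u])
    have "inverse u \<notin> U" if "u \<noteq> 0"
    proof
      assume "inverse u \<in> U"
      then have "inverse u * u \<in> J" by (rule idealD(4)[OF J(1) _ u])
      then show False using ideal_one[OF J(1)] J(2) that by simp
    qed
    then show "u \<in> M" using uU by (auto simp: M_def)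
  qed
  have "max_ideal U = M"
    unfolding max_ideal_def
  proof (rule the_equality)
    show "maximal_ideal U M"
      unfolding maximal_ideal_def using M MU proper by blast
    fix M' assume "maximal_ideal U M'"
    then have M': "ideal U M'" "M' \<noteq> U" "\<And>J. ideal U J \<Longrightarrow> M' \<subseteq> J \<Longrightarrow> J = M' \<or> J = U"
      by (auto simp: maximal_ideal_def)
    have "M' \<subseteq> M" by (rule proper[OF M'(1,2)])
    then show "M' = M" using M'(3)[OF M] MU by blast
  qed
  then show ?thesis by (simp only: M_def)
qed

text \<open>A limit point only provides one index with \<open>Vs i\<close> different from
  \<open>V\<close>. To push it beyond n, the neighbourhood is shrunk so that among the first n rings
  only copies of \<open>V\<close> remain: an element t of \<open>V\<close> outside
  \<open>Vs n\<close> is added to G, or, for t in \<open>Vs n\<close> outside \<open>V\<close>, its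
  inverse is added to H.\<close>

lemma patch_limit_frequently:
  assumes lim: "patch_limit_point R Vs V" and GH: "finite G" "finite H" "V \<in> patch_basic R G H"
  shows "\<exists>i\<ge>n. Vs i \<in> patch_basic R G H"
proof -
  have V: "valuation_ring V" "R \<subseteq> V" using lim by (auto simp: patch_limit_point_def ZR_def)
  have "\<exists>G' H'. finite G' \<and> finite H' \<and> G \<subseteq> G' \<and> H \<subseteq> H' \<and> V \<in> patch_basic R G' H' \<and>
      (\<forall>j<n. Vs j \<in> patch_basic R G' H' \<longrightarrow> Vs j = V)"
  proof (induction n)
    case 0
    then show ?case using GH by auto
  next
    case (Suc n)
    then obtain G' H' where h: "finite G'" "finite H'" "G \<subseteq> G'" "H \<subseteq> H'" "V \<in> patch_basic R G' H'"
      "\<forall>j<n. Vs j \<in> patch_basic R G' H' \<longrightarrow> Vs j = V" by blast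
    have mono: "patch_basic R G'' H'' \<subseteq> patch_basic R G' H'" if "G' \<subseteq> G''" "H' \<subseteq> H''" for G'' H''
      using that by (auto simp: patch_basic_def)
    show ?case
    proof (cases "Vs n \<in> patch_basic R G' H' \<longrightarrow> Vs n = V")
      case True
      then show ?thesis using h by (metis less_Suc_eq)
    next
      case False
      then have Vn: "valuation_ring (Vs n)" "Vs n \<noteq> V" by (auto simp: patch_basic_def ZR_def)
      then consider t where "t \<in> V" "t \<notin> Vs n" | t where "t \<in> Vs n" "t \<notin> V" by blast
      then show ?thesis
      proof cases
        case 1
        have "V \<in> patch_basic R (insert t G') H'" using h(5) 1 by (auto simp: patch_basic_def)
        moreover have "Vs n \<notin> patch_basic R (insert t G') H'" using 1 by (auto simp: patch_basic_def)
        ultimately show ?thesis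
          using h mono[of "insert t G'" H'] by (intro exI[of _ "insert t G'"] exI[of _ H']) (auto simp: less_Suc_eq)
      next
        case 2
        have t0: "t \<noteq> 0" using 2 V by (auto simp: valuation_ring_def subring_def)
        then have "inverse t \<in> V" using 2 V by (auto simp: valuation_ring_def)
        then have "inverse t \<in> max_ideal V" using max_ideal_valuation_ring[OF V(1)] 2 by simp
        then have "V \<in> patch_basic R G' (insert (inverse t) H')" using h(5) by (auto simp: patch_basic_def)
        moreover have "inverse t \<notin> max_ideal (Vs n)" using max_ideal_valuation_ring[OF Vn(1)] 2 t0 by simp
        then have "Vs n \<notin> patch_basic R G' (insert (inverse t) H')" by (auto simp: patch_basic_def)
        ultimately show ?thesis
          using h mono[of G' "insert (inverse t) H'"]
          by (intro exI[of _ G'] exI[of _ "insert (inverse t) H'"]) (auto simp: less_Suc_eq)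
      qed
    qed
  qed
  then obtain G' H' where h: "finite G'" "finite H'" "G \<subseteq> G'" "H \<subseteq> H'" "V \<in> patch_basic R G' H'"
    "\<forall>j<n. Vs j \<in> patch_basic R G' H' \<longrightarrow> Vs j = V" by blast
  then obtain i where i: "Vs i \<in> patch_basic R G' H'" "Vs i \<noteq> V"
    using lim unfolding patch_limit_point_def by blast
  then have "n \<le> i" using h(6) not_le by blast
  moreover have "Vs i \<in> patch_basic R G H" using i(1) h(3,4) by (auto simp: patch_basic_def)
  ultimately show ?thesis by blast
qed

section \<open>Sequences of quadratic transforms\<close>

lemma prod_list_remove1:
  fixes ps :: "'a::comm_monoid_mult list"
  shows "p \<in> set ps \<Longrightarrow> prod_list ps = p * prod_list (remove1 p ps)"
  by (induction ps) (auto simp: ac_simps)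

definition factorable :: "'a::field set \<Rightarrow> 'a \<Rightarrow> bool" where
  "factorable A f \<longleftrightarrow> (\<exists>u ps. u \<in> A \<and> u \<noteq> 0 \<and> inverse u \<in> A \<and> (\<forall>p\<in>set ps. prime_elt A p) \<and> f = u * prod_list ps)"

lemma (in field_subring) factorable_mult:
  assumes "factorable A f" "factorable A g" shows "factorable A (f * g)"
proof -
  obtain u ps w qs where h: "u \<in> A" "u \<noteq> 0" "inverse u \<in> A" "\<forall>p\<in>set ps. prime_elt A p" "f = u * prod_list ps"
    "w \<in> A" "w \<noteq> 0" "inverse w \<in> A" "\<forall>p\<in>set qs. prime_elt A p" "g = w * prod_list qs"
    using assms unfolding factorable_def by blast
  have "f * g = (u * w) * prod_list (ps @ qs)" using h by simp
  moreover have "u * w \<in> A" "u * w \<noteq> 0" "inverse (u * w) \<in> A" using h by auto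
  moreover have "\<forall>p\<in>set (ps @ qs). prime_elt A p" using h by auto
  ultimately show ?thesis unfolding factorable_def by blast
qed

lemma (in field_subring) factorable_unit: "u \<in> A \<Longrightarrow> u \<noteq> 0 \<Longrightarrow> inverse u \<in> A \<Longrightarrow> factorable A u"
  unfolding factorable_def by (intro exI[of _ u] exI[of _ "[]"]) simp

lemma (in field_subring) factorable_prime: "prime_elt A p \<Longrightarrow> factorable A p"
  unfolding factorable_def by (intro exI[of _ 1] exI[of _ "[p]"]) simp

lemma (in field_subring) factorable_pow: "factorable A f \<Longrightarrow> factorable A (f ^ n)"
  by (induction n) (auto intro: factorable_mult factorable_unit)

text \<open>Brings z to lowest terms: a listed prime that divides the numerator is cancelled, and
  the list becomes shorter.\<close>

lemma (in field_subring) reduce_primes: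
  assumes "\<forall>p\<in>set ps. prime_elt A p" "z * prod_list ps \<in> A"
  shows "\<exists>qs. (\<forall>p\<in>set qs. prime_elt A p) \<and> z * prod_list qs \<in> A \<and> (\<forall>p\<in>set qs. z * prod_list qs / p \<notin> A)"
  using assms
proof (induction "length ps" arbitrary: ps rule: less_induct)
  case less
  show ?case
  proof (cases "\<forall>p\<in>set ps. z * prod_list ps / p \<notin> A")
    case True
    then show ?thesis using less.prems by blast
  next
    case False
    then obtain p where p: "p \<in> set ps" "z * prod_list ps / p \<in> A" by blast
    have p0: "p \<noteq> 0" using less.prems(1) p(1) by (simp add: prime_elt_def)
    have "prod_list ps = p * prod_list (remove1 p ps)" by (rule prod_list_remove1[OF p(1)])
    then have "z * prod_list (remove1 p ps) \<in> A" using p(2) p0 by simp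
    moreover have "length (remove1 p ps) < length ps"
      using p(1) by (simp add: length_remove1) (metis One_nat_def diff_less length_pos_if_in_set zero_less_one)
    moreover have "\<forall>p'\<in>set (remove1 p ps). prime_elt A p'"
      using less.prems(1) set_remove1_subset[of p ps] by blast
    ultimately show ?thesis using less.hyps by blast
  qed
qed

context quad_transform
begin

lemma unit_A_A': "u \<in> A \<Longrightarrow> inverse u \<in> A \<Longrightarrow> u \<in> A' \<and> inverse u \<in> A'"
  using A_A' by blast

text \<open>A prime p of A is its strict transform times a power of x, where x is prime in A' and
  the transform is prime or a unit.\<close>

lemma factorable_step:
  assumes "factorable A f" shows "factorable A' f"
proof -
  obtain u ps where h: "u \<in> A" "u \<noteq> 0" "inverse u \<in> A" "\<forall>p\<in>set ps. prime_elt A p" "f = u * prod_list ps"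
    using assms unfolding factorable_def by blast
  have pf: "factorable A' p" if p: "prime_elt A p" for p
  proof -
    have pA: "p \<in> A" "p \<noteq> 0" using p by (auto simp: prime_elt_def)
    define p1 where "p1 = p / x ^ ord A p"
    have p1: "p1 \<in> A'" "p1 \<noteq> 0" using strict_A'[OF pA order_refl] pA by (auto simp: p1_def)
    have "factorable A' p1"
    proof (cases "p1 \<in> m'")
      case True
      then show ?thesis using A'.factorable_prime strict_prime[OF p] by (simp add: p1_def)
    next
      case False
      then show ?thesis using A'.factorable_unit[OF p1] A'.unit[OF p1(1)] by blast
    qed
    moreover have "factorable A' (x ^ ord A p)" by (intro A'.factorable_pow A'.factorable_prime x_prime)
    ultimately have "factorable A' (p1 * x ^ ord A p)" by (rule A'.factorable_mult)
    then show ?thesis by (simp add: p1_def)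
  qed
  have "factorable A' (prod_list qs)" if "\<forall>p\<in>set qs. prime_elt A p" for qs
    using that
  proof (induction qs)
    case Nil
    then show ?case using A'.factorable_unit[of 1] by simp
  next
    case (Cons p qs)
    then show ?case using A'.factorable_mult[OF pf] by simp
  qed
  moreover have "factorable A' u" using A'.factorable_unit[OF _ h(2)] unit_A_A' h by blast
  ultimately show ?thesis using A'.factorable_mult h(4,5) by blast
qed

text \<open>Strict transforms are multiplicative because \<open>ord\<close> is additive. The map
  \<open>g\<close> lets one fixed list of primes index its transforms at every stage.\<close>

lemma strict_prod:
  assumes "\<forall>p\<in>set ps. g p \<in> A \<and> g p \<noteq> 0"
  shows "prod_list (map g ps) \<in> A \<and> prod_list (map g ps) \<noteq> 0 \<and>
    prod_list (map (\<lambda>p. g p / x ^ ord A (g p)) ps) = prod_list (map g ps) / x ^ ord A (prod_list (map g ps))"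
  using assms
proof (induction ps)
  case (Cons p ps)
  then have IH: "prod_list (map g ps) \<in> A" "prod_list (map g ps) \<noteq> 0"
    "prod_list (map (\<lambda>p. g p / x ^ ord A (g p)) ps) = prod_list (map g ps) / x ^ ord A (prod_list (map g ps))"
    and p: "g p \<in> A" "g p \<noteq> 0" by auto
  show ?case using IH p ord_mult[OF p IH(1,2)] by (auto simp: power_add)
qed simp

end

section \<open>The infinite sequence and its union\<close>

locale quad_sequence =
  fixes Rs m :: "nat \<Rightarrow> 'a::field set" and d :: "nat \<Rightarrow> nat" and x :: "nat \<Rightarrow> 'a" and q :: "nat \<Rightarrow> 'a set"
  assumes qt: "\<And>i. quad_transform (Rs i) (m i) (d i) (Rs (Suc i)) (m (Suc i)) (d (Suc i)) (x i) (q i)"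
begin

sublocale T: quad_transform "Rs i" "m i" "d i" "Rs (Suc i)" "m (Suc i)" "d (Suc i)" "x i" "q i" for i
  by (rule qt)

abbreviation "S \<equiv> \<Union>i. Rs i"

lemma Rs_mono: "i \<le> j \<Longrightarrow> Rs i \<subseteq> Rs j"
  using lift_Suc_mono_le[of Rs] T.A_A' by blast

lemma m_mono: "i \<le> j \<Longrightarrow> m i \<subseteq> m j"
  using lift_Suc_mono_le[of m] T.m_m' by blast

lemma x_m_le: "i \<le> j \<Longrightarrow> x i \<in> m j"
  using T.x_m m_mono by blast

lemma subring_S: "subring S"
  unfolding subring_def
proof (intro conjI ballI)
  show "0 \<in> S" "1 \<in> S" using T.zero_mem[of 0] T.one_mem[of 0] by auto
  fix a b assume "a \<in> S" "b \<in> S"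
  then obtain i j where ij: "a \<in> Rs i" "b \<in> Rs j" by blast
  have k: "a \<in> Rs (max i j)" "b \<in> Rs (max i j)"
    using ij Rs_mono[of i "max i j"] Rs_mono[of j "max i j"] by auto
  show "a + b \<in> S" using T.add_mem[OF k] by (rule UN_I[OF UNIV_I])
  show "a * b \<in> S" using T.mult_mem[OF k] by (rule UN_I[OF UNIV_I])
  show "- a \<in> S" using T.neg_mem[OF k(1)] by (rule UN_I[OF UNIV_I])
qed

lemma x_inverse_notin: "inverse (x n) \<notin> S"
proof
  assume "inverse (x n) \<in> S"
  then obtain j where "inverse (x n) \<in> Rs j" by blast
  then have "inverse (x n) \<in> Rs (max n j)" using Rs_mono[of j "max n j"] by auto
  moreover have "x n \<in> m (max n j)" by (rule x_m_le) simp
  ultimately have "inverse (x n) * x n \<in> m (max n j)" by (rule idealD(4)[OF T.m_ideal])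
  then show False using T.one_notin T.x0 by simp
qed

text \<open>A fraction a / b for z is carried along, both parts being divided at each stage by x^r
  with r the smaller order. The numbers r descend and become constant; from then on a nonnegative
  sign persists.\<close>

lemma ordF_eventually:
  assumes z: "z \<noteq> 0"
  shows "\<exists>n. (\<forall>i\<ge>n. 0 \<le> ordF (Rs i) z) \<or> (\<forall>i\<ge>n. ordF (Rs i) z < 0)"
proof -
  define P where "P i ab \<longleftrightarrow> fst ab \<in> Rs i \<and> snd ab \<in> Rs i \<and> fst ab \<noteq> 0 \<and> snd ab \<noteq> 0 \<and> z = fst ab / snd ab"
    for i and ab :: "'a \<times> 'a"
  define \<rho> where "\<rho> i ab = min (ord (Rs i) (fst ab)) (ord (Rs i) (snd ab))" for i and ab :: "'a \<times> 'a"
  define Q where "Q i ab ab' \<longleftrightarrow> ab' = (fst ab / x i ^ \<rho> i ab, snd ab / x i ^ \<rho> i ab)" for i and ab ab' :: "'a \<times> 'a"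
  have "\<exists>f. \<forall>n. P n (f n) \<and> Q n (f n) (f (Suc n))"
  proof (rule dependent_nat_choice)
    obtain a b where "a \<in> Rs 0" "b \<in> Rs 0" "a \<noteq> 0" "b \<noteq> 0" "z = a / b" using T.frac_rep[OF z] by blast
    then have "P 0 (a, b)" by (simp add: P_def)
    then show "\<exists>ab. P 0 ab" by blast
  next
    fix ab i assume p: "P i ab"
    let ?ab = "(fst ab / x i ^ \<rho> i ab, snd ab / x i ^ \<rho> i ab)"
    have "fst ?ab \<in> Rs (Suc i)" "snd ?ab \<in> Rs (Suc i)"
      using p T.strict_A'[of "fst ab" i "\<rho> i ab"] T.strict_A'[of "snd ab" i "\<rho> i ab"] by (auto simp: P_def \<rho>_def)
    then have "P (Suc i) ?ab" using p by (simp add: P_def)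
    then show "\<exists>ab'. P (Suc i) ab' \<and> Q i ab ab'" by (auto simp: Q_def)
  qed
  then obtain f where f: "\<And>n. P n (f n)" "\<And>n. Q n (f n) (f (Suc n))" by blast
  define a where "a n = fst (f n)" for n
  define b where "b n = snd (f n)" for n
  define r where "r n = min (ord (Rs n) (a n)) (ord (Rs n) (b n))" for n
  have ab: "a n \<in> Rs n" "b n \<in> Rs n" "a n \<noteq> 0" "b n \<noteq> 0" "z = a n / b n" for n
    using f(1)[of n] by (auto simp: P_def a_def b_def)
  have step: "a (Suc n) = a n / x n ^ r n" "b (Suc n) = b n / x n ^ r n" for n
    using f(2)[of n] by (auto simp: Q_def a_def b_def r_def \<rho>_def)
  have v: "ordF (Rs n) z = int (ord (Rs n) (a n)) - int (ord (Rs n) (b n))" for n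
    using T.ordF_divide[OF ab(1-4)[of n]] ab(5)[of n] by simp
  have a_le: "ord (Rs (Suc n)) (a (Suc n)) \<le> r n" if "ord (Rs n) (a n) = r n" for n
    using T.ord_strict_le[OF ab(1,3)[of n]] step(1)[of n] that by simp
  have b_le: "ord (Rs (Suc n)) (b (Suc n)) \<le> r n" if "ord (Rs n) (b n) = r n" for n
    using T.ord_strict_le[OF ab(2,4)[of n]] step(2)[of n] that by simp
  obtain n where n: "\<And>k. r n \<le> r k" using ex_has_least_nat[of "\<lambda>_. True" _ r] by blast
  \<comment> \<open>The part attaining the minimum is replaced by its strict transform, whose order
    is no larger.\<close>
  have dec: "r (Suc k) \<le> r k" for k
    using a_le[of k] b_le[of k] unfolding r_def by (auto simp: min_def split: if_splits)
  have const: "r k = r n" if "k \<ge> n" for k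
    using lift_Suc_antimono_le[of r n k] dec n[of k] that by (metis le_antisym)
  \<comment> \<open>A nonnegative sign means that the denominator attains the minimum r. Its next
    order is at most r, which equals the next minimum and so bounds the next order of the numerator
    from below.\<close>
  have stay: "0 \<le> ordF (Rs (Suc i)) z" if i: "i \<ge> n" "0 \<le> ordF (Rs i) z" for i
  proof -
    have "ord (Rs i) (b i) = r i" using i(2) v[of i] by (simp add: r_def)
    then have "ord (Rs (Suc i)) (b (Suc i)) \<le> r i" by (rule b_le)
    also have "r i = r (Suc i)" using const[of i] const[of "Suc i"] i(1) by simp
    also have "r (Suc i) \<le> ord (Rs (Suc i)) (a (Suc i))" by (simp add: r_def)
    finally show ?thesis using v[of "Suc i"] by simp
  qed
  show ?thesis
  proof (cases "\<exists>i\<ge>n. 0 \<le> ordF (Rs i) z")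
    case True
    then obtain i where i: "i \<ge> n" "0 \<le> ordF (Rs i) z" by blast
    have "0 \<le> ordF (Rs j) z" if "j \<ge> i" for j
      using that by (induction j rule: dec_induct) (use i stay in auto)
    then show ?thesis by blast
  next
    case False
    then show ?thesis by (meson not_le)
  qed
qed

lemma factorable_x: "n < i \<Longrightarrow> factorable (Rs i) (x n)"
proof (induction i)
  case (Suc i)
  show ?case
  proof (cases "n = i")
    case True
    then show ?thesis using T.factorable_prime[OF T.x_prime] by simp
  next
    case False
    then show ?thesis using Suc T.factorable_step by simp
  qed
qed simp

text \<open>The ring C is S[1/x_n], a ring of fractions of the normal noetherian ring
  \<open>Rs n\<close>. A valuation ring containing C but not z contains S properly, since it
  contains 1/x_n.\<close>

lemma DVR_not_power:
  assumes z: "\<And>k. x n ^ k * z \<notin> S"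
  shows "\<exists>U. DVR U \<and> S \<subset> U \<and> z \<notin> U"
proof -
  interpret S: field_subring S by unfold_locales (rule subring_S)
  define C where "C = {s / x n ^ k | s k. s \<in> S}"
  have CI: "s / x n ^ k \<in> C" if "s \<in> S" for s k using that by (auto simp: C_def)
  have xS: "x n \<in> S" using T.x_A by blast
  have x0: "x n \<noteq> 0" by (rule T.x0)
  have subC: "subring C"
    unfolding subring_def
  proof (intro conjI ballI)
    show "0 \<in> C" "1 \<in> C" using CI[of 0 0] CI[of 1 0] S.zero_mem S.one_mem by auto
    fix a b assume "a \<in> C" "b \<in> C"
    then obtain s k t l where h: "s \<in> S" "a = s / x n ^ k" "t \<in> S" "b = t / x n ^ l" unfolding C_def by blast
    have "s * x n ^ l + x n ^ k * t \<in> S" by (intro S.add_mem S.mult_mem S.power_mem xS h)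
    from CI[OF this, of "k + l"] have "(s * x n ^ l + x n ^ k * t) / x n ^ (k + l) \<in> C" .
    moreover have "(s * x n ^ l + x n ^ k * t) / x n ^ (k + l) = a + b"
      unfolding h using x0 by (simp add: power_add add_divide_distrib)
    ultimately show "a + b \<in> C" by (simp only:)
    from CI[OF S.mult_mem[OF h(1,3)], of "k + l"] show "a * b \<in> C" using h by (simp add: power_add)
    from CI[OF S.neg_mem[OF h(1)], of k] show "- a \<in> C" using h by simp
  qed
  interpret C: field_subring C by unfold_locales (rule subC)
  have SC: "S \<subseteq> C" using CI[of _ 0] by auto
  \<comment> \<open>x_n lies in the maximal ideal of \<open>Rs i\<close> and is therefore divisible
    by x_i in \<open>Rs (Suc i)\<close>; inverting x_n inverts every later x_i.\<close>
  have xC: "inverse (x i) \<in> C" if i: "n \<le> i" for i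
  proof -
    have "x n \<in> m i" by (rule x_m_le[OF i])
    then have "x n / x i ^ 1 \<in> Rs (Suc i)" by (intro T.mpow_A') simp
    then have "x n / x i \<in> S" by auto
    from CI[OF this, of 1] show ?thesis using x0 by (simp add: inverse_eq_divide)
  qed
  \<comment> \<open>A denominator s introduced at stage i divides a power of x_i in
    \<open>Rs (Suc i)\<close>, so it is a unit of C; expressing f and s over \<open>Rs n\<close> by
    induction gives the fraction.\<close>
  have frac: "\<exists>a\<in>Rs n. \<exists>s\<in>Rs n. s \<noteq> 0 \<and> inverse s \<in> C \<and> w = a / s" if "n \<le> i" "w \<in> Rs i" for w i
    using that
  proof (induction i arbitrary: w rule: dec_induct)
    case base
    then show ?case using T.one_mem C.one_mem by (intro bexI[of _ w] bexI[of _ 1]) auto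
  next
    case (step i)
    obtain f s N where h: "f \<in> ideal_pow (Rs i) (m i) N" "s \<in> ideal_pow (Rs i) (m i) N" "s \<noteq> 0"
      "s / x i ^ N \<notin> m (Suc i)" "w = f / s" using T.A'_rep[OF step.prems] by metis
    have "x i ^ N / s \<in> C" using T.unit_A'[OF h(2,4)] SC by blast
    then have "x i ^ N / s * inverse (x i) ^ N \<in> C" using xC[OF step.hyps(1)] by blast
    moreover have "x i ^ N / s * inverse (x i) ^ N = inverse s" using T.x0[of i] by (simp add: field_simps)
    ultimately have sC: "inverse s \<in> C" by (simp only:)
    obtain a t where at: "a \<in> Rs n" "t \<in> Rs n" "t \<noteq> 0" "inverse t \<in> C" "f = a / t"
      using step.IH[OF T.mpow_A[OF h(1)]] by blast
    obtain a' t' where at': "a' \<in> Rs n" "t' \<in> Rs n" "t' \<noteq> 0" "inverse t' \<in> C" "s = a' / t'"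
      using step.IH[OF T.mpow_A[OF h(2)]] by blast
    have a'0: "a' \<noteq> 0" using at' h(3) by auto
    have "inverse s * inverse t' * inverse t \<in> C" by (intro C.mult_mem sC at at')
    moreover have "inverse s * inverse t' * inverse t = inverse (a' * t)" using at' by (simp add: field_simps)
    ultimately have "inverse (a' * t) \<in> C" by (simp only:)
    moreover have "a * t' \<in> Rs n" "a' * t \<in> Rs n" using at at' T.mult_mem by auto
    moreover have "w = (a * t') / (a' * t)" using h(5) at at' by simp
    moreover have "a' * t \<noteq> 0" using a'0 at(3) by simp
    ultimately show ?case by blast
  qed
  have fo: "frac_over (Rs n) C"
    unfolding frac_over_def
  proof (intro conjI ballI subC)
    show "Rs n \<subseteq> C" using SC by blast
    fix c assume "c \<in> C"
    then obtain s k j where h: "s \<in> Rs j" "c = s / x n ^ k" unfolding C_def by blast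
    have "s \<in> Rs (max n j)" using h(1) Rs_mono[of j "max n j"] by auto
    then obtain a t where at: "a \<in> Rs n" "t \<in> Rs n" "t \<noteq> 0" "inverse t \<in> C" "s = a / t"
      using frac[of "max n j" s] by auto
    have "inverse t * inverse (x n) ^ k \<in> C" using at(4) xC[of n] by blast
    then have "inverse (t * x n ^ k) \<in> C" by (simp add: power_inverse)
    moreover have "t * x n ^ k \<in> Rs n" using at(2) T.x_A T.mult_mem T.power_mem by blast
    moreover have "c = a / (t * x n ^ k)" using h at by simp
    moreover have "t * x n ^ k \<noteq> 0" using at x0 by simp
    ultimately show "\<exists>a\<in>Rs n. \<exists>s\<in>Rs n. s \<noteq> 0 \<and> inverse s \<in> C \<and> c = a / s" using at(1) by blast
  qed
  have "z \<notin> C"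
  proof
    assume "z \<in> C"
    then have "\<exists>s k. z = s / x n ^ k \<and> s \<in> S" by (simp only: C_def mem_Collect_eq)
    then obtain s k where sk: "z = s / x n ^ k" "s \<in> S" by (elim exE conjE)
    have "x n ^ k * z = s" using x0 sk(1) by simp
    then have "x n ^ k * z \<in> S" using sk(2) by (simp only:)
    then show False using z[of k] by simp
  qed
  moreover have "noetherian C" by (rule noetherian_frac_over[OF T.noetherian fo])
  moreover have "normal_dom C" by (rule normal_frac_over[OF T.noetherian T.normal fo])
  moreover have "quotient_field_is_F C" by (rule quotient_field_mono[OF T.qf[of n]]) (use SC in blast)
  ultimately obtain U where U: "DVR U" "C \<subseteq> U" "z \<notin> U" using DVR_exists by blast
  have "inverse (x n) \<in> U" using xC U by blast
  then have "S \<subset> U" using U SC x_inverse_notin by blast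
  then show ?thesis using U by blast
qed

lemma DVR_surviving_prime:
  assumes z: "z \<noteq> 0" "z \<notin> S" and v: "\<And>i. i0 \<le> i \<Longrightarrow> 0 \<le> ordF (Rs i) z" and xz: "x i0 ^ k * z \<in> S"
  shows "\<exists>U. DVR U \<and> S \<subset> U \<and> z \<notin> U"
proof -
  obtain j where j: "x i0 ^ k * z \<in> Rs j" using xz by blast
  \<comment> \<open>The factorization of x_i0 into primes begins at stage i0 + 1, and
    \<open>j\<close> is the stage that contains x_i0^k z.\<close>
  define n where "n = max j (Suc i0)"
  have n: "i0 < n" "x i0 ^ k * z \<in> Rs n" using j Rs_mono[of j n] by (auto simp: n_def)
  have "factorable (Rs n) (x i0 ^ k)" using T.factorable_pow factorable_x[OF n(1)] by blast
  then obtain u ps0 where u: "u \<in> Rs n" "u \<noteq> 0" "inverse u \<in> Rs n" "\<forall>p\<in>set ps0. prime_elt (Rs n) p"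
    "x i0 ^ k = u * prod_list ps0" unfolding factorable_def by blast
  have "inverse u * (x i0 ^ k * z) \<in> Rs n" by (rule T.mult_mem[OF u(3) n(2)])
  moreover have "inverse u * (x i0 ^ k * z) = z * prod_list ps0" using u(2,5) by simp
  ultimately have "z * prod_list ps0 \<in> Rs n" by (simp only:)
  then obtain ps where ps: "\<forall>p\<in>set ps. prime_elt (Rs n) p" "z * prod_list ps \<in> Rs n"
    "\<forall>p\<in>set ps. z * prod_list ps / p \<notin> Rs n" using T.reduce_primes[OF u(4)] by blast
  \<comment> \<open>\<open>st p j\<close> is the j-fold strict transform of p, an element of
    \<open>Rs (n + j)\<close>.\<close>
  define st where "st p = rec_nat p (\<lambda>j y. y / x (n + j) ^ ord (Rs (n + j)) y)" for p
  have st0: "st p 0 = p" and stS: "st p (Suc j) = st p j / x (n + j) ^ ord (Rs (n + j)) (st p j)" for p j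
    by (simp_all add: st_def)
  have st_mem: "st p j \<in> Rs (n + j) \<and> st p j \<noteq> 0" if "p \<in> set ps" for p j
  proof (induction j)
    case 0
    then show ?case using ps(1) that by (simp add: st0 prime_elt_def)
  next
    case (Suc j)
    then show ?case using T.strict_A'[of "st p j" "n + j"] T.x0 by (simp add: stS)
  qed
  define b where "b j = prod_list (map (\<lambda>p. st p j) ps)" for j
  have b: "b j \<in> Rs (n + j)" "b j \<noteq> 0" "b (Suc j) = b j / x (n + j) ^ ord (Rs (n + j)) (b j)" for j
    using T.strict_prod[of ps "\<lambda>p. st p j" "n + j"] st_mem by (simp_all add: b_def stS)
  \<comment> \<open>Nonnegative order of z gives z * b j at least the order of \<open>b j\<close>,
    so it can be divided by the same power of x.\<close>
  have zb: "z * b j \<in> Rs (n + j)" for j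
  proof (induction j)
    case 0
    then show ?case using ps(2) by (simp add: b_def st0)
  next
    case (Suc j)
    have nz: "z * b j \<noteq> 0" using z b by simp
    have "int (ord (Rs (n + j)) (z * b j)) = ordF (Rs (n + j)) z + int (ord (Rs (n + j)) (b j))"
      using T.ordF_of[OF Suc nz] T.ordF_mult[OF z(1) b(2)] T.ordF_of[OF b(1,2)] by simp
    moreover have "0 \<le> ordF (Rs (n + j)) z" using v n(1) by simp
    ultimately have "ord (Rs (n + j)) (b j) \<le> ord (Rs (n + j)) (z * b j)" by linarith
    then have "z * b j / x (n + j) ^ ord (Rs (n + j)) (b j) \<in> Rs (Suc (n + j))" by (rule T.strict_A'[OF Suc nz])
    then show ?case by (simp add: b(3))
  qed
  \<comment> \<open>A unit has order 0, so the next transform divides by nothing; units stay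
    units.\<close>
  have dead: "st p (j + l) \<notin> m (n + (j + l))" if p: "p \<in> set ps" and nj: "st p j \<notin> m (n + j)" for p j l
  proof (induction l)
    case (Suc l)
    let ?i = "n + (j + l)"
    have "ord (Rs ?i) (st p (j + l)) = 0" using T.ord_eq_0[of "st p (j + l)" ?i] st_mem[OF p, of "j + l"] Suc by simp
    then have "st p (Suc (j + l)) = st p (j + l)" by (simp add: stS)
    then show ?case using T.m'_A[of "st p (j + l)" ?i] st_mem[OF p, of "j + l"] Suc by simp
  qed (use nj in simp)
  have "\<exists>p\<in>set ps. \<forall>j. st p j \<in> m (n + j)"
  proof (rule ccontr)
    assume "\<not> ?thesis"
    then obtain J where J: "\<And>p. p \<in> set ps \<Longrightarrow> st p (J p) \<notin> m (n + J p)" by metis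
    \<comment> \<open>The sum serves as a common bound for the stages at which the primes become
      units.\<close>
    define N where "N = (\<Sum>p\<in>set ps. J p)"
    have "inverse (prod_list (map (\<lambda>p. st p N) qs)) \<in> Rs (n + N)" if "set qs \<subseteq> set ps" for qs
      using that
    proof (induction qs)
      case (Cons p qs)
      then have p: "p \<in> set ps" by simp
      have "J p \<le> N" unfolding N_def using p by (intro member_le_sum) auto
      then have "st p N \<notin> m (n + N)" using dead[OF p J[OF p], of "N - J p"] by simp
      then have "inverse (st p N) \<in> Rs (n + N)" using T.unit st_mem[OF p] by blast
      then have "inverse (prod_list (map (\<lambda>p. st p N) qs)) * inverse (st p N) \<in> Rs (n + N)"
        using Cons by (intro T.mult_mem) auto
      then show ?case by (simp add: mult.commute)
    qed (use T.one_mem in simp)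
    then have "inverse (b N) \<in> Rs (n + N)" by (simp add: b_def)
    then have "z * b N * inverse (b N) \<in> Rs (n + N)" by (rule T.mult_mem[OF zb[of N]])
    then have "z \<in> Rs (n + N)" using b(2)[of N] by (simp add: mult.assoc)
    then show False using z(2) by blast
  qed
  then obtain p where p: "p \<in> set ps" "\<And>j. st p j \<in> m (n + j)" by blast
  have prp: "prime_elt (Rs n) p" using ps(1) p(1) by blast
  define U where "U = localization (Rs n) (pid (Rs n) p)"
  have no_x: "x (n + j) / st p j \<notin> Rs (n + j)" for j
    using T.strict_unit_of_dvd_x[OF p(2)] st_mem[OF p(1)] p(2)[of "Suc j"] by (auto simp: stS)
  have UC: "uniformizer U (st p j) \<and> centered (Rs (n + j)) U (st p j)" for j
  proof (induction j)
    case 0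
    then show ?case using T.uniformizer_localization[OF prp] by (simp add: st0 U_def)
  next
    case (Suc j)
    then show ?case using T.strict_centered[OF _ _ no_x] p(2)[of "Suc j"] by (simp add: stS)
  qed
  have "DVR U"
    unfolding U_def
  proof (rule DVR_localization[OF T.noetherian T.qf])
    show "prime_ideal (Rs n) (pid (Rs n) p)" using prp by (simp add: prime_elt_def)
    show "uniformizer (localization (Rs n) (pid (Rs n) p)) p" using UC[of 0] by (simp add: st0 U_def)
  qed
  moreover have SU: "S \<subseteq> U"
  proof
    fix s assume "s \<in> S"
    then obtain j where "s \<in> Rs j" by blast
    then have "s \<in> Rs (n + j)" using Rs_mono[of j "n + j"] by auto
    then show "s \<in> U" using UC[of j] by (auto simp: centered_def)
  qed
  \<comment> \<open>This makes the containment proper: p does not divide x_n in \<open>Rs n\<close>,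
    so by centredness not in \<open>U\<close>, and x_n is a unit there.\<close>
  moreover have "inverse (x n) \<in> U"
  proof -
    have "x n \<in> Rs n" by (rule T.x_A)
    moreover have "centered (Rs n) U p" "uniformizer U p" using UC[of 0] by (simp_all add: st0)
    moreover have "x n / p \<notin> Rs n" using no_x[of 0] by (simp add: st0)
    ultimately show ?thesis using SU T.x0[of n] unfolding centered_def uniformizer_def by blast
  qed
  \<comment> \<open>Otherwise the other primes of the list, all in \<open>U\<close>, would make the
    numerator divisible by p in \<open>U\<close>, hence in \<open>Rs n\<close>, against lowest
    terms.\<close>
  moreover have "z \<notin> U"
  proof
    assume zU: "z \<in> U"
    have c: "centered (Rs n) U p" "subring U" using UC[of 0] by (auto simp: st0 uniformizer_def)
    interpret U: field_subring U by unfold_locales (rule c)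
    have p0: "p \<noteq> 0" using prp by (simp add: prime_elt_def)
    have eq: "prod_list ps = p * prod_list (remove1 p ps)" by (rule prod_list_remove1[OF p(1)])
    have "set (remove1 p ps) \<subseteq> U"
      using ps(1) SU set_remove1_subset[of p ps] by (auto simp: prime_elt_def)
    then have "z * prod_list (remove1 p ps) \<in> U" by (intro U.mult_mem zU U.prod_list_mem)
    then have "z * prod_list ps / p \<in> U" using eq p0 by simp
    then have "z * prod_list ps / p \<in> Rs n" using c(1) ps(2) unfolding centered_def by blast
    then show False using ps(3) p(1) by blast
  qed
  ultimately show ?thesis using x_inverse_notin by blast
qed

lemma ord_valuation_ring_mem: "z \<noteq> 0 \<Longrightarrow> z \<in> ord_valuation_ring (Rs i) \<longleftrightarrow> 0 \<le> ordF (Rs i) z"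
  by (simp add: T.ord_valuation_ring_eq)

lemma S_eq_Int:
  assumes bdry: "patch_limit_point (Rs 0) (\<lambda>i. ord_valuation_ring (Rs i)) V"
  shows "S = V \<inter> noetherian_hull S"
proof
  have V: "valuation_ring V" "Rs 0 \<subseteq> V" "V \<in> ZR (Rs 0)" using bdry by (auto simp: patch_limit_point_def ZR_def)
  \<comment> \<open>Each s of S lies in all order valuation rings from some stage on. If s were
    outside \<open>V\<close>, its inverse in the maximal ideal would define a neighbourhood of
    \<open>V\<close> that is met at arbitrarily late stages.\<close>
  have SV: "S \<subseteq> V"
  proof
    fix s assume "s \<in> S"
    then obtain i where i: "s \<in> Rs i" by blast
    show "s \<in> V"
    proof (rule ccontr)
      assume n: "s \<notin> V"
      then have s0: "s \<noteq> 0" using V by (auto simp: valuation_ring_def subring_def)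
      then have "inverse s \<in> V" using V(1) n by (auto simp: valuation_ring_def)
      then have "inverse s \<in> max_ideal V" using max_ideal_valuation_ring[OF V(1)] n by simp
      then have "V \<in> patch_basic (Rs 0) {} {inverse s}" using V(3) by (simp add: patch_basic_def)
      then obtain j where j: "j \<ge> i" "ord_valuation_ring (Rs j) \<in> patch_basic (Rs 0) {} {inverse s}"
        using patch_limit_frequently[OF bdry, of "{}" "{inverse s}" i] by auto
      then have "s \<notin> ord_valuation_ring (Rs j)"
        using max_ideal_valuation_ring[of "ord_valuation_ring (Rs j)"] s0 by (auto simp: patch_basic_def ZR_def)
      moreover have "s \<in> Rs j" using i Rs_mono[OF j(1)] by blast
      then have "0 \<le> ordF (Rs j) s" using T.ordF_of[of s j] s0 by simp
      ultimately show False using ord_valuation_ring_mem[OF s0] by blast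
    qed
  qed
  then show "S \<subseteq> V \<inter> noetherian_hull S" by (auto simp: noetherian_hull_def)
  show "V \<inter> noetherian_hull S \<subseteq> S"
  proof
    fix z assume "z \<in> V \<inter> noetherian_hull S"
    then have zV: "z \<in> V" and zT: "\<And>U. DVR U \<Longrightarrow> S \<subset> U \<Longrightarrow> z \<in> U" by (auto simp: noetherian_hull_def)
    show "z \<in> S"
    proof (rule ccontr)
      assume zS: "z \<notin> S"
      have z0: "z \<noteq> 0" using zS T.zero_mem by blast
      \<comment> \<open>Containing z is an open condition, so the order of z is nonnegative at
        arbitrarily late stages; this excludes the eventually negative alternative.\<close>
      have freq: "\<exists>i\<ge>n. 0 \<le> ordF (Rs i) z" for n
      proof -
        have "V \<in> patch_basic (Rs 0) {z} {}" using V(3) zV by (simp add: patch_basic_def)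
        then obtain i where "i \<ge> n" "ord_valuation_ring (Rs i) \<in> patch_basic (Rs 0) {z} {}"
          using patch_limit_frequently[OF bdry, of "{z}" "{}" n] by auto
        then show ?thesis using ord_valuation_ring_mem[OF z0] by (auto simp: patch_basic_def)
      qed
      obtain i0 where i0: "\<And>i. i0 \<le> i \<Longrightarrow> 0 \<le> ordF (Rs i) z"
        using ordF_eventually[OF z0] freq by (meson not_le)
      obtain k where "x i0 ^ k * z \<in> S" using DVR_not_power[of i0 z] zT by blast
      then show False using DVR_surviving_prime[OF z0 zS i0] zT by blast
    qed
  qed
qed

end

theorem theorem5p4:
  fixes Rs :: "nat \<Rightarrow> 'a::field set" and V :: "'a set"
  assumes qf: "quotient_field_is_F (Rs 0)"
    and reg: "\<And>i. regular_local_ring (Rs i)"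
    and dim: "\<And>i. krull_dim (Rs i) \<ge> 2"
    and lqt: "\<And>i. local_quadratic_transform (Rs i) (Rs (Suc i))"
    and strict: "\<And>i. Rs i \<subset> Rs (Suc i)"
    and bdry: "patch_limit_point (Rs 0) (\<lambda>i. ord_valuation_ring (Rs i)) V"
  shows "(\<Union>i. Rs i) = V \<inter> noetherian_hull (\<Union>i. Rs i)"
proof -
  have "Rs 0 \<subseteq> Rs i" for i
    using lift_Suc_mono_le[of Rs 0 i] strict by (simp add: psubset_imp_subset)
  then have "quotient_field_is_F (Rs i)" for i
    using quotient_field_mono[OF qf] by blast
  then have R: "reg_local (Rs i) (max_ideal (Rs i)) (emb_dim (Rs i))" for i
    using reg_localI reg dim by blast
  have "\<exists>x q. quad_transform (Rs i) (max_ideal (Rs i)) (emb_dim (Rs i)) (Rs (Suc i))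
      (max_ideal (Rs (Suc i))) (emb_dim (Rs (Suc i))) x q" for i
  proof -
    obtain x q where "x \<in> max_ideal (Rs i)" "x \<notin> ideal_pow (Rs i) (max_ideal (Rs i)) 2"
      "prime_ideal (ring_adjoin (Rs i) {y / x | y. y \<in> max_ideal (Rs i)}) q" "max_ideal (Rs i) \<subseteq> q"
      "Rs (Suc i) = localization (ring_adjoin (Rs i) {y / x | y. y \<in> max_ideal (Rs i)}) q"
      using lqt[of i] unfolding local_quadratic_transform_def Let_def by blast
    then have "quad_transform_axioms (Rs i) (max_ideal (Rs i)) (Rs (Suc i)) x q"
      by (intro quad_transform_axioms.intro)
    then show ?thesis using R quad_transform.intro by blast
  qed
  then obtain x q where "\<And>i. quad_transform (Rs i) (max_ideal (Rs i)) (emb_dim (Rs i)) (Rs (Suc i))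
      (max_ideal (Rs (Suc i))) (emb_dim (Rs (Suc i))) (x i) (q i)" by metis
  then interpret quad_sequence Rs "\<lambda>i. max_ideal (Rs i)" "\<lambda>i. emb_dim (Rs i)" x q
    by (rule quad_sequence.intro)
  show ?thesis by (rule S_eq_Int[OF bdry])
qed

end
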